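(* Let $b,\sigma:\mathbb{R}\times\mathcal{P}_2(\mathbb{R})\to\mathbb{R}$ be such that, for some constant $K>0$, $|b(x,\mu)-b(y,\nu)|+|\sigma(x,\mu)-\sigma(y,\nu)|\le K(|x-y|+\mathcal{W}_2(\mu,\nu))$ for all $x,y\in\mathbb{R}$, $\mu,\nu\in\mathcal{P}_2(\mathbb{R})$. Let $h:\mathbb{R}\to\mathbb{R}$ be increasing and bi-Lipschitz: there are $0<m\le M$ with $m|x-y|\le|h(x)-h(y)|\le M|x-y|$ for all $x,y\in\mathbb{R}$. Let $\xi$ be an $\mathcal{F}_0$-measurable random variable with $\mathbb{E}[\xi^2]<\infty$ and $\mathbb{E}[h(\xi)]\ge 0$. Then the mean reflected McKean-Vlasov SDE $$\begin{cases}X_t=\xi+\int_0^t b(X_s,\mathcal{L}_{X_s})\,ds+\int_0^t\sigma(X_s,\mathcal{L}_{X_s})\,dB_s+K_t,& t\ge 0,\\ \mathbb{E}[h(X_t)]\ge 0,\quad \int_0^t\mathbb{E}[h(X_s)]\,dK_s=0,& t\ge 0,\end{cases}$$ has a unique deterministic flat solution $(X,K)$. Moreover, for all $t\ge 0$, $$K_t=\sup_{s\le t}\inf\{x\ge 0:\mathbb{E}[h(x+U_s)]\ge 0\}=\sup_{s\le t}G_0(\mathcal{L}_{U_s}),$$ where $U_t=\xi+\int_0^t b(X_s,\mathcal{L}_{X_s})\,ds+\int_0^t\sigma(X_s,\mathcal{L}_{X_s})\,dB_s$.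
   Context: $(\Omega,\mathcal{F},\{\mathcal{F}_t\}_{t\ge0},\mathbb{P})$ is a complete filtered probability space carrying a standard one-dimensional $\{\mathcal{F}_t\}$-Brownian motion $B$. $\mathcal{L}_Z$ denotes the law of a random variable $Z$. $\mathcal{P}_p(\mathbb{R})$ is the set of Borel probability measures on $\mathbb{R}$ with finite $p$-th moment, and $\mathcal{W}_p$ is the $p$-Wasserstein distance on it. A flat deterministic solution is a pair $(X,K)$ satisfying the system, where $X$ is a continuous adapted process (with $\mathbb{E}[\sup_{t\le T}|X_t|^2]<\infty$ for all $T>0$) and $K$ is a non-decreasing continuous deterministic function with $K_0=0$. For $\nu\in\mathcal{P}_1(\mathbb{R})$, $G_0(\nu):=\inf\{x\ge 0:\int h(x+z)\,\nu(dz)\ge 0\}$. *)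

theory Defs
  imports "HOL-Probability.Probability"
begin

section \<open>Laws and Wasserstein distances\<close>

abbreviation law :: "'a measure \<Rightarrow> ('a \<Rightarrow> real) \<Rightarrow> real measure" where
  "law M Z \<equiv> distr M borel Z"

definition prob_moment :: "real \<Rightarrow> real measure set" where
  "prob_moment p =
     {\<mu>. prob_space \<mu> \<and> sets \<mu> = sets borel \<and> integrable \<mu> (\<lambda>x. \<bar>x\<bar> powr p)}"

definition couplings :: "real measure \<Rightarrow> real measure \<Rightarrow> (real \<times> real) measure set" where
  "couplings \<mu> \<nu> =
     {\<pi>. sets \<pi> = sets (borel \<Otimes>\<^sub>M borel) \<and> distr \<pi> borel fst = \<mu> \<and> distr \<pi> borel snd = \<nu>}"

text \<open>The infimum is finite when both measures lie in \<^term>\<open>prob_moment p\<close> and \<open>p \<ge> 1\<close>;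
  the value is meaningful only there.\<close>

definition wasserstein :: "real \<Rightarrow> real measure \<Rightarrow> real measure \<Rightarrow> real" where
  "wasserstein p \<mu> \<nu> =
     enn2real (INF \<pi>\<in>couplings \<mu> \<nu>. \<integral>\<^sup>+ (x, y). ennreal (\<bar>x - y\<bar> powr p) \<partial>\<pi>) powr (1 / p)"

section \<open>Filtered probability spaces and Brownian motion\<close>

text \<open>Time is \<^typ>\<open>real\<close>, but only times \<open>t \<ge> 0\<close> are meaningful: nothing is assumed about, or
  asserted of, a filtration or a process at negative times. Right-continuity of the filtration is
  not assumed.\<close>

locale complete_filtered_prob_space = prob_space M + complete_measure M
  for M :: "'a measure" +
  fixes F :: "real \<Rightarrow> 'a measure"
  assumes filtration: "filtration (space M) (\<lambda>t. F (max 0 t))"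
    and subalgebra: "\<And>t. 0 \<le> t \<Longrightarrow> subalgebra M (F t)"
    and null_sets_F0: "null_sets M \<subseteq> sets (F 0)"

definition adapted :: "(real \<Rightarrow> 'a measure) \<Rightarrow> (real \<Rightarrow> 'a \<Rightarrow> real) \<Rightarrow> bool" where
  "adapted F X \<longleftrightarrow> (\<forall>t\<ge>0. X t \<in> borel_measurable (F t))"

definition continuous_process :: "'a measure \<Rightarrow> (real \<Rightarrow> 'a \<Rightarrow> real) \<Rightarrow> bool" where
  "continuous_process M X \<longleftrightarrow> (\<forall>\<omega>\<in>space M. continuous_on {0..} (\<lambda>t. X t \<omega>))"

definition brownian_motion ::
    "'a measure \<Rightarrow> (real \<Rightarrow> 'a measure) \<Rightarrow> (real \<Rightarrow> 'a \<Rightarrow> real) \<Rightarrow> bool" where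
  "brownian_motion M F B \<longleftrightarrow>
     adapted F B \<and>
     (AE \<omega> in M. B 0 \<omega> = 0) \<and>
     (AE \<omega> in M. continuous_on {0..} (\<lambda>t. B t \<omega>)) \<and>
     (\<forall>s t. 0 \<le> s \<and> s < t \<longrightarrow>
        distributed M lborel (\<lambda>\<omega>. B t \<omega> - B s \<omega>) (normal_density 0 (sqrt (t - s))) \<and>
        prob_space.indep_set M (sets (F s))
          (sets (vimage_algebra (space M) (\<lambda>\<omega>. B t \<omega> - B s \<omega>) borel)))"

section \<open>The Ito integral\<close>

text \<open>A simple integrand is given by times \<open>\<tau> 0 \<le> \<dots> \<le> \<tau> n\<close> and bounded weights \<open>\<eta> i\<close>, where
  \<open>\<eta> i\<close> is known at time \<open>\<tau> i\<close> and is used on the interval \<open>(\<tau> i, \<tau> (i + 1)]\<close>.\<close>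

definition simple_integrand ::
    "'a measure \<Rightarrow> (real \<Rightarrow> 'a measure) \<Rightarrow> nat \<Rightarrow> (nat \<Rightarrow> real) \<Rightarrow> (nat \<Rightarrow> 'a \<Rightarrow> real) \<Rightarrow> bool" where
  "simple_integrand M F n \<tau> \<eta> \<longleftrightarrow>
     0 \<le> \<tau> 0 \<and> (\<forall>i<n. \<tau> i \<le> \<tau> (Suc i)) \<and>
     (\<forall>i<n. \<eta> i \<in> borel_measurable (F (\<tau> i)) \<and> bounded (\<eta> i ` space M))"

definition simple_process ::
    "nat \<Rightarrow> (nat \<Rightarrow> real) \<Rightarrow> (nat \<Rightarrow> 'a \<Rightarrow> real) \<Rightarrow> real \<Rightarrow> 'a \<Rightarrow> real" where
  "simple_process n \<tau> \<eta> t \<omega> = (\<Sum>i<n. \<eta> i \<omega> * indicator {\<tau> i<..\<tau> (Suc i)} t)"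

definition simple_ito_integral ::
    "(real \<Rightarrow> 'a \<Rightarrow> real) \<Rightarrow> nat \<Rightarrow> (nat \<Rightarrow> real) \<Rightarrow> (nat \<Rightarrow> 'a \<Rightarrow> real) \<Rightarrow> real \<Rightarrow> 'a \<Rightarrow> real" where
  "simple_ito_integral B n \<tau> \<eta> t \<omega> =
     (\<Sum>i<n. \<eta> i \<omega> * (B (min t (\<tau> (Suc i))) \<omega> - B (min t (\<tau> i)) \<omega>))"

definition ito_integrand ::
    "'a measure \<Rightarrow> (real \<Rightarrow> 'a measure) \<Rightarrow> (real \<Rightarrow> 'a \<Rightarrow> real) \<Rightarrow> bool" where
  "ito_integrand M F H \<longleftrightarrow>
     (\<forall>T\<ge>0. (\<lambda>(t, \<omega>). H t \<omega>) \<in> borel_measurable (restrict_space borel {0..T} \<Otimes>\<^sub>M F T)) \<and>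
     (\<forall>T\<ge>0. (\<integral>\<^sup>+\<omega>. (\<integral>\<^sup>+t\<in>{0..T}. ennreal ((H t \<omega>)\<^sup>2) \<partial>lborel) \<partial>M) < \<infinity>)"

text \<open>\<open>is_ito_integral M F B H I\<close>: the process \<open>I\<close> is a continuous version of
  \<open>t \<mapsto> \<integral>\<^sub>0\<^sup>t H\<^sub>s dB\<^sub>s\<close>, obtained as the \<open>L\<^sup>2\<close>-limit of the integrals of simple processes that
  converge to \<open>H\<close> in \<open>L\<^sup>2([0,T] \<times> \<Omega>)\<close> for every \<open>T\<close>. Such an \<open>I\<close> is unique up to
  indistinguishability.\<close>

definition is_ito_integral ::
    "'a measure \<Rightarrow> (real \<Rightarrow> 'a measure) \<Rightarrow> (real \<Rightarrow> 'a \<Rightarrow> real) \<Rightarrow>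
     (real \<Rightarrow> 'a \<Rightarrow> real) \<Rightarrow> (real \<Rightarrow> 'a \<Rightarrow> real) \<Rightarrow> bool" where
  "is_ito_integral M F B H I \<longleftrightarrow>
     ito_integrand M F H \<and> adapted F I \<and> continuous_process M I \<and>
     (\<exists>n \<tau> \<eta>.
        (\<forall>k::nat. simple_integrand M F (n k) (\<tau> k) (\<eta> k)) \<and>
        (\<forall>T\<ge>0. (\<lambda>k. \<integral>\<^sup>+\<omega>. (\<integral>\<^sup>+t\<in>{0..T}.
             ennreal ((H t \<omega> - simple_process (n k) (\<tau> k) (\<eta> k) t \<omega>)\<^sup>2) \<partial>lborel) \<partial>M)
           \<longlonglongrightarrow> 0) \<and>
        (\<forall>t\<ge>0. (\<lambda>k. \<integral>\<^sup>+\<omega>.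
             ennreal ((I t \<omega> - simple_ito_integral B (n k) (\<tau> k) (\<eta> k) t \<omega>)\<^sup>2) \<partial>M)
           \<longlonglongrightarrow> 0))"

section \<open>Mean reflected McKean-Vlasov equations\<close>

text \<open>The process \<open>U\<^sub>t = \<xi> + \<integral>\<^sub>0\<^sup>t b(X\<^sub>s, L\<^sub>X\<^sub>s) ds + I\<^sub>t\<close>, to be used with a version \<open>I\<close> of
  \<open>\<integral>\<^sub>0\<^sup>t \<sigma>(X\<^sub>s, L\<^sub>X\<^sub>s) dB\<^sub>s\<close>.\<close>

definition unreflected ::
    "'a measure \<Rightarrow> (real \<Rightarrow> real measure \<Rightarrow> real) \<Rightarrow> ('a \<Rightarrow> real) \<Rightarrow> (real \<Rightarrow> 'a \<Rightarrow> real) \<Rightarrow>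
     (real \<Rightarrow> 'a \<Rightarrow> real) \<Rightarrow> real \<Rightarrow> 'a \<Rightarrow> real" where
  "unreflected M b \<xi> X I t \<omega> =
     \<xi> \<omega> + (LINT s:{0..t}|lborel. b (X s \<omega>) (law M (X s))) + I t \<omega>"

text \<open>The integral against \<open>dK\<close> is the Lebesgue-Stieltjes integral. Since \<^const>\<open>interval_measure\<close>
  wants a function on the whole line, \<open>K\<close> is extended by \<open>K 0\<close> to negative times.\<close>

definition flat_solution ::
    "'a measure \<Rightarrow> (real \<Rightarrow> 'a measure) \<Rightarrow> (real \<Rightarrow> 'a \<Rightarrow> real) \<Rightarrow>
     (real \<Rightarrow> real measure \<Rightarrow> real) \<Rightarrow> (real \<Rightarrow> real measure \<Rightarrow> real) \<Rightarrow> (real \<Rightarrow> real) \<Rightarrow>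
     ('a \<Rightarrow> real) \<Rightarrow> (real \<Rightarrow> 'a \<Rightarrow> real) \<Rightarrow> (real \<Rightarrow> real) \<Rightarrow> bool" where
  "flat_solution M F B b \<sigma> h \<xi> X K \<longleftrightarrow>
     adapted F X \<and> continuous_process M X \<and>
     (\<forall>T>0. (\<integral>\<^sup>+\<omega>. (SUP t\<in>{0..T}. ennreal (\<bar>X t \<omega>\<bar>\<^sup>2)) \<partial>M) < \<infinity>) \<and>
     mono_on {0..} K \<and> continuous_on {0..} K \<and> K 0 = 0 \<and>
     (\<exists>I. is_ito_integral M F B (\<lambda>s \<omega>. \<sigma> (X s \<omega>) (law M (X s))) I \<and>
          (AE \<omega> in M. \<forall>t\<ge>0. X t \<omega> = unreflected M b \<xi> X I t \<omega> + K t)) \<and>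
     (\<forall>t\<ge>0. 0 \<le> (\<integral>\<omega>. h (X t \<omega>) \<partial>M)) \<and>
     (\<forall>t\<ge>0. (LINT s:{0..t}|interval_measure (\<lambda>s. K (max 0 s)). (\<integral>\<omega>. h (X s \<omega>) \<partial>M)) = 0)"

definition G0 :: "(real \<Rightarrow> real) \<Rightarrow> real measure \<Rightarrow> real" where
  "G0 h \<nu> = Inf {x. 0 \<le> x \<and> 0 \<le> (\<integral>z. h (x + z) \<partial>\<nu>)}"

end

theory Submission
  imports Defs
begin

text \<open>For square-integrable \<open>Z\<close> the increasing function \<open>x \<mapsto> E[h(x + Z)]\<close> has exactly one zero
  \<open>r(Z)\<close>, and \<open>r\<close> is Lipschitz for the \<open>L\<^sup>1\<close>-distance because \<open>h\<close> is bi-Lipschitz. For a given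
  continuous \<open>U\<close> the only non-decreasing \<open>K\<close> that keeps \<open>E[h(U\<^sub>t + K\<^sub>t)]\<close> non-negative and grows
  only when this mean vanishes is the running maximum of the positive part of \<open>r(U\<^sub>s)\<close>. Solving the
  equation is therefore finding a fixed point of the map that sends \<open>X\<close> to \<open>U + K\<close>, where \<open>U\<close> is
  computed from the coefficients along \<open>X\<close>. By Doob's inequality this map is a contraction
  for \<open>E[sup\<^sub>s\<^sub>\<le>\<^sub>t |X\<^sub>s|\<^sup>2]\<close> weighted exponentially in \<open>t\<close>, so Picard iteration converges and the fixed
  point is unique. All integrands that occur have continuous paths, hence sampling them on a grid
  yields the simple processes that define the Ito integral.\<close>

text \<open>Laws enter only through the coefficients, and the joint law of two variables on the
  given space is a coupling. Every Wasserstein distance is therefore replaced at once by a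
  mean-square distance, and no optimal transport occurs. The regulator is deterministic, so its
  variation is paid for by the same second moments; the factor \<open>(m' / m)^2\<close> is the
  price of inverting the mean of \<open>h\<close>. The estimate for the map bounds the distance at
  time t by an integral of earlier distances, which is why an exponential weight works on all of
  \<open>[0,T]\<close> and no short intervals have to be glued. The rate 1/16 is a choice: second
  moments of order \<open>16^-n\<close> stay summable after multiplication by \<open>4^n\<close>, so
  the increments themselves are almost surely at most a random constant times \<open>2^-n\<close>,
  uniformly in time. This yields continuous limits, and the null sets in \<open>F 0\<close> keep
  them adapted. Martingales are described by orthogonality of increments instead of conditional
  expectations, a property that visibly survives \<open>L^2\<close> limits.\<close>

lemma ennreal_square_add_le:
  fixes x y :: real
  shows "ennreal ((x + y)\<^sup>2) \<le> 2 * ennreal (x\<^sup>2) + 2 * ennreal (y\<^sup>2)"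
proof -
  have "(x + y)\<^sup>2 \<le> 2 * x\<^sup>2 + 2 * y\<^sup>2"
    using sum_squares_bound[of x y] by (simp add: power2_sum)
  then have "ennreal ((x + y)\<^sup>2) \<le> ennreal (2 * x\<^sup>2 + 2 * y\<^sup>2)"
    by (rule ennreal_leI)
  also have "\<dots> = 2 * ennreal (x\<^sup>2) + 2 * ennreal (y\<^sup>2)"
    by (simp add: ennreal_plus ennreal_mult')
  finally show ?thesis .
qed

lemma ennreal_square_diff_le:
  fixes x y :: real
  shows "ennreal ((x - y)\<^sup>2) \<le> 2 * ennreal (x\<^sup>2) + 2 * ennreal (y\<^sup>2)"
  using ennreal_square_add_le[of x "- y"] by simp

text \<open>All estimates come from second moments and so bound squares; this converts them into
  convergence.\<close>

lemma tendsto_square_le: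
  fixes f g :: "nat \<Rightarrow> real"
  assumes "\<And>n. (f n - l)\<^sup>2 \<le> g n" and "g \<longlonglongrightarrow> 0"
  shows "f \<longlonglongrightarrow> l"
proof -
  have "(\<lambda>n. sqrt (g n)) \<longlonglongrightarrow> sqrt 0" by (intro tendsto_intros assms)
  moreover have "\<bar>f n - l\<bar> \<le> sqrt (g n)" for n
    using real_sqrt_le_mono[OF assms(1)[of n]] by simp
  ultimately have "(\<lambda>n. f n - l) \<longlonglongrightarrow> 0"
    by - (rule Lim_null_comparison[of "\<lambda>n. f n - l" "\<lambda>n. sqrt (g n)"], auto)
  then show ?thesis by (simp add: LIM_zero_iff)
qed

lemma continuous_on_atLeast_I:
  fixes f :: "real \<Rightarrow> real"
  assumes "\<And>T. 0 \<le> T \<Longrightarrow> continuous_on {0..T} f"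
  shows "continuous_on {0..} f"
  unfolding continuous_on_eq_continuous_within
proof
  fix x :: real assume x: "x \<in> {0..}"
  have "continuous (at x within {0..x+1}) f"
    using assms[of "x + 1"] x by (auto simp: continuous_on_eq_continuous_within)
  moreover have "at x within {0..x+1} = at x within {0..}"
    by (rule at_within_nhd[of x "{..<x+1}"]) auto
  ultimately show "continuous (at x within {0..}) f" by simp
qed

section \<open>Suprema of squared paths\<close>

text \<open>With values in \<open>ennreal\<close> the supremum exists for every path, bounded or
  not, and its expectation needs no integrability condition.\<close>

definition supsq :: "(real \<Rightarrow> 'a \<Rightarrow> real) \<Rightarrow> real \<Rightarrow> 'a \<Rightarrow> ennreal" where
  "supsq X T \<omega> = (SUP t\<in>{0..T}. ennreal ((X t \<omega>)\<^sup>2))"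

lemma supsq_upper: "0 \<le> t \<Longrightarrow> t \<le> T \<Longrightarrow> ennreal ((X t \<omega>)\<^sup>2) \<le> supsq X T \<omega>"
  unfolding supsq_def by (rule SUP_upper) auto

lemma supsq_least: "(\<And>t. 0 \<le> t \<Longrightarrow> t \<le> T \<Longrightarrow> ennreal ((X t \<omega>)\<^sup>2) \<le> C) \<Longrightarrow> supsq X T \<omega> \<le> C"
  unfolding supsq_def by (rule SUP_least) auto

lemma supsq_mono: "T \<le> T' \<Longrightarrow> supsq X T \<omega> \<le> supsq X T' \<omega>"
  unfolding supsq_def by (rule SUP_subset_mono) auto

lemma supsq_cong: "(\<And>t. 0 \<le> t \<Longrightarrow> t \<le> T \<Longrightarrow> X t \<omega> = Y t \<omega>) \<Longrightarrow> supsq X T \<omega> = supsq Y T \<omega>"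
  unfolding supsq_def by (rule SUP_cong) auto

lemma supsq_add:
  "supsq (\<lambda>t \<omega>. X t \<omega> + Y t \<omega>) T \<omega> \<le> 2 * supsq X T \<omega> + 2 * supsq Y T \<omega>"
proof (rule supsq_least)
  fix t assume t: "0 \<le> t" "t \<le> T"
  have "ennreal ((X t \<omega> + Y t \<omega>)\<^sup>2) \<le> 2 * ennreal ((X t \<omega>)\<^sup>2) + 2 * ennreal ((Y t \<omega>)\<^sup>2)"
    by (rule ennreal_square_add_le)
  also have "\<dots> \<le> 2 * supsq X T \<omega> + 2 * supsq Y T \<omega>"
    by (intro add_mono mult_left_mono supsq_upper t) auto
  finally show "ennreal ((X t \<omega> + Y t \<omega>)\<^sup>2) \<le> 2 * supsq X T \<omega> + 2 * supsq Y T \<omega>" .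
qed

lemma supsq_uminus: "supsq (\<lambda>t \<omega>. - X t \<omega>) T \<omega> = supsq X T \<omega>"
  by (simp add: supsq_def)

lemma supsq_diff:
  "supsq (\<lambda>t \<omega>. X t \<omega> - Y t \<omega>) T \<omega> \<le> 2 * supsq X T \<omega> + 2 * supsq Y T \<omega>"
  using supsq_add[of X "\<lambda>t \<omega>. - Y t \<omega>" T \<omega>] by (simp add: supsq_uminus)

text \<open>An uncountable supremum need not be measurable. Along a continuous path the dyadic
  points of \<open>[0,T]\<close> suffice, which leaves countably many times; the grids are nested,
  as the proof of Doob's inequality will need.\<close>

lemma supsq_grid:
  assumes c: "continuous_on {0..} (\<lambda>t. X t \<omega>)" and T: "0 \<le> T"
  shows "supsq X T \<omega> = (SUP n. SUP j\<in>{..2^n}. ennreal ((X (T * real j / 2^n) \<omega>)\<^sup>2))"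
    (is "_ = ?R")
proof (rule antisym)
  show "?R \<le> supsq X T \<omega>"
  proof (intro SUP_least supsq_upper)
    fix n j :: nat assume "j \<in> {..2^n}"
    then have "real j \<le> real (2^n)" by (subst of_nat_le_iff) simp
    then show "T * real j / 2^n \<le> T" using T by (simp add: field_simps mult_left_mono)
  qed (use T in simp)
next
  show "supsq X T \<omega> \<le> ?R"
  proof (rule supsq_least)
    fix t assume t: "0 \<le> t" "t \<le> T"
    \<comment> \<open>\<open>u n\<close> is the grid point of level n just below t. For
      \<open>T = 0\<close> division by zero gives \<open>t / T = 0\<close>, hence
      \<open>u n = 0 = t\<close>.\<close>
    define j where "j n = nat \<lfloor>t / T * 2^n\<rfloor>" for n
    define u where "u n = T * real (j n) / 2^n" for n
    have j: "j n \<le> 2^n" for n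
    proof -
      have "t / T \<le> 1" using t T by (auto simp: divide_le_eq_1)
      then have "t / T * 2^n \<le> 2^n" using mult_right_mono[of "t / T" 1 "2^n"] by simp
      then have "\<lfloor>t / T * 2^n\<rfloor> \<le> 2^n" by (simp add: floor_le_iff)
      then show ?thesis unfolding j_def by (simp add: nat_le_iff)
    qed
    have u0: "0 \<le> u n" for n using T by (simp add: u_def)
    have ub: "\<bar>u n - t\<bar> \<le> T * (1/2)^n" for n
    proof (cases "T = 0")
      case True then show ?thesis using t by (simp add: u_def)
    next
      case False
      then have T0: "T > 0" using T by simp
      have "real (j n) = of_int \<lfloor>t / T * 2^n\<rfloor>" unfolding j_def using t T by simp
      then have "\<bar>real (j n) - t / T * 2^n\<bar> \<le> 1" by linarith
      then have "(T / 2^n) * \<bar>real (j n) - t / T * 2^n\<bar> \<le> (T / 2^n) * 1"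
        using T0 by (intro mult_left_mono) auto
      moreover have "u n - t = (T / 2^n) * (real (j n) - t / T * 2^n)"
        using T0 by (simp add: u_def field_simps)
      then have "\<bar>u n - t\<bar> = (T / 2^n) * \<bar>real (j n) - t / T * 2^n\<bar>"
        using T0 by (simp only: abs_mult) simp
      ultimately show ?thesis by (simp add: power_one_over)
    qed
    have "(\<lambda>n. T * (1/2)^n) \<longlonglongrightarrow> T * 0" by (intro tendsto_intros) auto
    then have "(\<lambda>n. u n - t) \<longlonglongrightarrow> 0"
      by - (rule Lim_null_comparison[of _ "\<lambda>n. T * (1/2)^n"], auto simp: ub)
    then have ut: "u \<longlonglongrightarrow> t" by (simp add: LIM_zero_iff)
    have "(\<lambda>n. X (u n) \<omega>) \<longlonglongrightarrow> X t \<omega>"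
      by (rule continuous_on_tendsto_compose[OF c ut]) (use t u0 in auto)
    then have lim: "(\<lambda>n. ennreal ((X (u n) \<omega>)\<^sup>2)) \<longlonglongrightarrow> ennreal ((X t \<omega>)\<^sup>2)"
      by (intro tendsto_ennrealI tendsto_intros)
    have le: "ennreal ((X (u n) \<omega>)\<^sup>2) \<le> ?R" for n
      unfolding u_def using j[of n] by (intro SUP_upper2[of n] SUP_upper2[of "j n"]) auto
    show "ennreal ((X t \<omega>)\<^sup>2) \<le> ?R"
      by (rule LIMSEQ_le_const2[OF lim]) (use le in auto)
  qed
qed

lemma supsq_measurable:
  assumes "continuous_process M X" "0 \<le> T" "space N = space M"
    and [measurable]: "\<And>t. 0 \<le> t \<Longrightarrow> t \<le> T \<Longrightarrow> X t \<in> borel_measurable N"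
  shows "supsq X T \<in> borel_measurable N"
proof -
  have m: "X (T * real j / 2^n) \<in> borel_measurable N" if "j \<in> {..2^n}" for j n :: nat
  proof -
    have "real j \<le> real (2^n)" using that by (subst of_nat_le_iff) simp
    then show ?thesis using \<open>0 \<le> T\<close> by (intro assms) (simp_all add: field_simps mult_left_mono)
  qed
  have "supsq X T \<in> borel_measurable N \<longleftrightarrow>
    (\<lambda>\<omega>. SUP n. SUP j\<in>{..2^n}. ennreal ((X (T * real j / 2^n) \<omega>)\<^sup>2)) \<in> borel_measurable N"
    using assms by (intro measurable_cong supsq_grid) (auto simp: continuous_process_def)
  also have \<dots>
    by (intro borel_measurable_SUP) (auto intro!: measurable_compose[OF _ measurable_ennreal] borel_measurable_power m)
  finally show ?thesis .
qed

section \<open>Square-integrable continuous adapted processes\<close>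

context prob_space
begin

text \<open>Jensen's inequality for the square, read off from the non-negativity of the variance of
  the absolute value.\<close>

lemma expectation_abs_square_le:
  fixes Z :: "'a \<Rightarrow> real"
  assumes [measurable]: "Z \<in> borel_measurable M" and "integrable M (\<lambda>\<omega>. (Z \<omega>)\<^sup>2)"
  shows "integrable M Z" "(\<integral>\<omega>. \<bar>Z \<omega>\<bar> \<partial>M)\<^sup>2 \<le> (\<integral>\<omega>. (Z \<omega>)\<^sup>2 \<partial>M)"
proof -
  show i: "integrable M Z" by (rule square_integrable_imp_integrable) (use assms in auto)
  then have "variance (\<lambda>\<omega>. \<bar>Z \<omega>\<bar>) = (\<integral>\<omega>. (Z \<omega>)\<^sup>2 \<partial>M) - (\<integral>\<omega>. \<bar>Z \<omega>\<bar> \<partial>M)\<^sup>2"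
    using assms by (subst variance_eq) auto
  moreover have "0 \<le> variance (\<lambda>\<omega>. \<bar>Z \<omega>\<bar>)" by (rule variance_positive)
  ultimately show "(\<integral>\<omega>. \<bar>Z \<omega>\<bar> \<partial>M)\<^sup>2 \<le> (\<integral>\<omega>. (Z \<omega>)\<^sup>2 \<partial>M)" by simp
qed

lemma integrable_square_iff:
  fixes Z :: "'a \<Rightarrow> real"
  assumes [measurable]: "Z \<in> borel_measurable M"
  shows "integrable M (\<lambda>\<omega>. (Z \<omega>)\<^sup>2) \<longleftrightarrow> (\<integral>\<^sup>+\<omega>. ennreal ((Z \<omega>)\<^sup>2) \<partial>M) < \<infinity>"
  by (auto simp: integrable_iff_bounded)

lemma nn_integral_square:
  fixes Z :: "'a \<Rightarrow> real"
  assumes "integrable M (\<lambda>\<omega>. (Z \<omega>)\<^sup>2)"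
  shows "(\<integral>\<^sup>+\<omega>. ennreal ((Z \<omega>)\<^sup>2) \<partial>M) = ennreal (\<integral>\<omega>. (Z \<omega>)\<^sup>2 \<partial>M)"
  using assms by (intro nn_integral_eq_integral) auto

lemma integrable_square_diff:
  fixes Z Z' :: "'a \<Rightarrow> real"
  assumes [measurable]: "Z \<in> borel_measurable M" "Z' \<in> borel_measurable M"
    and i: "integrable M (\<lambda>\<omega>. (Z \<omega>)\<^sup>2)" "integrable M (\<lambda>\<omega>. (Z' \<omega>)\<^sup>2)"
  shows "integrable M (\<lambda>\<omega>. (Z \<omega> - Z' \<omega>)\<^sup>2)"
proof (rule Bochner_Integration.integrable_bound[of M "\<lambda>\<omega>. 2 * (Z \<omega>)\<^sup>2 + 2 * (Z' \<omega>)\<^sup>2"])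
  have "(x - y)\<^sup>2 \<le> 2 * x\<^sup>2 + 2 * y\<^sup>2" for x y :: real
    using sum_squares_bound[of x "-y"] by (simp add: power2_diff)
  then show "AE \<omega> in M. norm ((Z \<omega> - Z' \<omega>)\<^sup>2) \<le> norm (2 * (Z \<omega>)\<^sup>2 + 2 * (Z' \<omega>)\<^sup>2)" by simp
qed (use i in auto)

lemma integrable_mult_square:
  fixes Z Z' :: "'a \<Rightarrow> real"
  assumes [measurable]: "Z \<in> borel_measurable M" "Z' \<in> borel_measurable M"
    and i: "integrable M (\<lambda>\<omega>. (Z \<omega>)\<^sup>2)" "integrable M (\<lambda>\<omega>. (Z' \<omega>)\<^sup>2)"
  shows "integrable M (\<lambda>\<omega>. Z \<omega> * Z' \<omega>)"
proof (rule Bochner_Integration.integrable_bound[of M "\<lambda>\<omega>. (Z \<omega>)\<^sup>2 + (Z' \<omega>)\<^sup>2"])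
  have "\<bar>x * y\<bar> \<le> x\<^sup>2 + y\<^sup>2" for x y :: real
    using sum_squares_bound[of x y] sum_squares_bound[of x "-y"] by (simp add: abs_le_iff)
  then show "AE \<omega> in M. norm (Z \<omega> * Z' \<omega>) \<le> norm ((Z \<omega>)\<^sup>2 + (Z' \<omega>)\<^sup>2)" by simp
qed (use i in auto)

text \<open>The joint law of \<open>X\<close> and \<open>Y\<close> is an admissible coupling, so its
  cost bounds the infimum. Only this direction is ever needed: it removes Wasserstein distances from
  all later estimates.\<close>

lemma wasserstein_law_le:
  assumes [measurable]: "X \<in> borel_measurable M" "Y \<in> borel_measurable M"
    and i: "integrable M (\<lambda>\<omega>. (X \<omega> - Y \<omega>)\<^sup>2)"
  shows "wasserstein 2 (law M X) (law M Y) \<le> sqrt (\<integral>\<omega>. (X \<omega> - Y \<omega>)\<^sup>2 \<partial>M)"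
proof -
  define \<pi> where "\<pi> = distr M (borel \<Otimes>\<^sub>M borel) (\<lambda>\<omega>. (X \<omega>, Y \<omega>))"
  let ?I = "INF \<pi>\<in>couplings (law M X) (law M Y). \<integral>\<^sup>+ (x, y). ennreal (\<bar>x - y\<bar> powr 2) \<partial>\<pi>"
  have p2: "\<bar>x\<bar> powr 2 = x\<^sup>2" for x :: real by (cases "x = 0") auto
  have "\<pi> \<in> couplings (law M X) (law M Y)"
    by (simp add: couplings_def \<pi>_def distr_distr comp_def)
  then have "?I \<le> (\<integral>\<^sup>+ (x, y). ennreal (\<bar>x - y\<bar> powr 2) \<partial>\<pi>)"
    by (rule INF_lower)
  also have "\<dots> = (\<integral>\<^sup>+\<omega>. ennreal ((X \<omega> - Y \<omega>)\<^sup>2) \<partial>M)"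
    unfolding \<pi>_def p2 by (subst nn_integral_distr) (auto simp: split_beta')
  also have "\<dots> = ennreal (\<integral>\<omega>. (X \<omega> - Y \<omega>)\<^sup>2 \<partial>M)"
    by (rule nn_integral_square[OF i])
  finally have "enn2real ?I \<le> (\<integral>\<omega>. (X \<omega> - Y \<omega>)\<^sup>2 \<partial>M)"
    by (intro enn2real_leI) auto
  then have "enn2real ?I powr (1/2) \<le> (\<integral>\<omega>. (X \<omega> - Y \<omega>)\<^sup>2 \<partial>M) powr (1/2)"
    by (intro powr_mono2) auto
  also have "\<dots> = sqrt (\<integral>\<omega>. (X \<omega> - Y \<omega>)\<^sup>2 \<partial>M)"
    by (intro powr_half_sqrt) auto
  finally show ?thesis by (simp add: wasserstein_def)
qed

lemma law_prob_moment_2: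
  assumes [measurable]: "X \<in> borel_measurable M" and i: "integrable M (\<lambda>\<omega>. (X \<omega>)\<^sup>2)"
  shows "law M X \<in> prob_moment 2"
proof -
  have p2: "\<bar>x\<bar> powr 2 = x\<^sup>2" for x :: real by (cases "x = 0") auto
  show ?thesis unfolding prob_moment_def p2
    using i by (auto intro!: prob_space_distr simp: integrable_distr_eq)
qed

end

section \<open>Coefficients that are Lipschitz in the state and in the law\<close>

definition lipschitz_coeff :: "real \<Rightarrow> (real \<Rightarrow> real measure \<Rightarrow> real) \<Rightarrow> bool" where
  "lipschitz_coeff L f \<longleftrightarrow> 0 \<le> L \<and> (\<forall>x y. \<forall>\<mu>\<in>prob_moment 2. \<forall>\<nu>\<in>prob_moment 2.
     \<bar>f x \<mu> - f y \<nu>\<bar> \<le> L * (\<bar>x - y\<bar> + wasserstein 2 \<mu> \<nu>))"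

text \<open>Coupling turns the distance of the laws into an \<open>L^2\<close> distance; the factor
  2 comes from \<open>(a + b)^2 \<le> 2 a^2 + 2 b^2\<close>. The expectation does not depend on the
  sample point, so the bound can be used path by path as well as in the mean.\<close>

lemma (in prob_space) lipschitz_coeff_diff:
  assumes f: "lipschitz_coeff L f"
    and [measurable]: "Z \<in> borel_measurable M" "Z' \<in> borel_measurable M"
    and i: "integrable M (\<lambda>\<omega>. (Z \<omega>)\<^sup>2)" "integrable M (\<lambda>\<omega>. (Z' \<omega>)\<^sup>2)"
  shows "(f x (law M Z) - f y (law M Z'))\<^sup>2
     \<le> 2 * L\<^sup>2 * ((x - y)\<^sup>2 + (\<integral>\<omega>. (Z \<omega> - Z' \<omega>)\<^sup>2 \<partial>M))"
proof -
  let ?e = "\<integral>\<omega>. (Z \<omega> - Z' \<omega>)\<^sup>2 \<partial>M"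
  have "\<bar>f x (law M Z) - f y (law M Z')\<bar> \<le> L * (\<bar>x - y\<bar> + wasserstein 2 (law M Z) (law M Z'))"
    using f law_prob_moment_2[of Z] law_prob_moment_2[of Z'] i by (auto simp: lipschitz_coeff_def)
  also have "\<dots> \<le> L * (\<bar>x - y\<bar> + sqrt ?e)"
    using f by (intro mult_left_mono add_left_mono wasserstein_law_le integrable_square_diff i)
      (auto simp: lipschitz_coeff_def)
  finally have "\<bar>f x (law M Z) - f y (law M Z')\<bar>\<^sup>2 \<le> (L * (\<bar>x - y\<bar> + sqrt ?e))\<^sup>2"
    by (intro power_mono) auto
  also have "\<dots> = L\<^sup>2 * (\<bar>x - y\<bar> + sqrt ?e)\<^sup>2" by (simp add: power_mult_distrib)
  also have "\<dots> \<le> L\<^sup>2 * (2 * \<bar>x - y\<bar>\<^sup>2 + 2 * (sqrt ?e)\<^sup>2)"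
    using sum_squares_bound[of "\<bar>x - y\<bar>" "sqrt ?e"] by (intro mult_left_mono) (auto simp: power2_sum)
  finally show ?thesis by (simp add: algebra_simps)
qed

section \<open>Continuous adapted processes with square-integrable suprema\<close>

context complete_filtered_prob_space
begin

lemma space_F: "0 \<le> t \<Longrightarrow> space (F t) = space M"
  using subalgebra by (simp add: subalgebra_def)

lemma sets_F_M: "0 \<le> t \<Longrightarrow> sets (F t) \<subseteq> sets M"
  using subalgebra by (simp add: subalgebra_def)

lemma sets_F_mono: "0 \<le> s \<Longrightarrow> s \<le> t \<Longrightarrow> sets (F s) \<subseteq> sets (F t)"
  using filtration.sets_F_mono[OF filtration, of s t] by (simp add: max_def)

lemma measurable_F_M: "0 \<le> t \<Longrightarrow> f \<in> borel_measurable (F t) \<Longrightarrow> f \<in> borel_measurable M"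
  using subalgebra by (rule measurable_from_subalg)

lemma measurable_F_mono: "0 \<le> s \<Longrightarrow> s \<le> t \<Longrightarrow> f \<in> borel_measurable (F s) \<Longrightarrow> f \<in> borel_measurable (F t)"
  using sets_F_mono[of s t] space_F[of s] space_F[of t]
  by (intro measurable_from_subalg[of "F t" "F s"]) (auto simp: subalgebra_def)

lemma adaptedD: "adapted F X \<Longrightarrow> 0 \<le> s \<Longrightarrow> s \<le> t \<Longrightarrow> X s \<in> borel_measurable (F t)"
  by (rule measurable_F_mono) (auto simp: adapted_def)

lemma adapted_M: "adapted F X \<Longrightarrow> 0 \<le> s \<Longrightarrow> X s \<in> borel_measurable M"
  by (rule measurable_F_M) (auto simp: adapted_def)

definition sup_moment :: "(real \<Rightarrow> 'a \<Rightarrow> real) \<Rightarrow> real \<Rightarrow> ennreal" where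
  "sup_moment X T = (\<integral>\<^sup>+\<omega>. supsq X T \<omega> \<partial>M)"

text \<open>The usual Banach space of processes, but without passing to classes of indistinguishable
  ones; two members are identified when \<open>sup_moment\<close> of their difference
  vanishes.\<close>

definition S2 :: "(real \<Rightarrow> 'a \<Rightarrow> real) \<Rightarrow> bool" where
  "S2 X \<longleftrightarrow> adapted F X \<and> continuous_process M X \<and> (\<forall>T\<ge>0. sup_moment X T < \<infinity>)"

lemma supsq_measurable_M:
  "adapted F X \<Longrightarrow> continuous_process M X \<Longrightarrow> 0 \<le> T \<Longrightarrow> supsq X T \<in> borel_measurable M"
  by (rule supsq_measurable) (auto intro: adapted_M)

lemma adapted_add: "adapted F X \<Longrightarrow> adapted F Y \<Longrightarrow> adapted F (\<lambda>t \<omega>. X t \<omega> + Y t \<omega>)"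
  by (auto simp: adapted_def intro!: borel_measurable_add)

lemma adapted_diff: "adapted F X \<Longrightarrow> adapted F Y \<Longrightarrow> adapted F (\<lambda>t \<omega>. X t \<omega> - Y t \<omega>)"
  by (auto simp: adapted_def intro!: borel_measurable_diff)

lemma continuous_process_add:
  "continuous_process M X \<Longrightarrow> continuous_process M Y \<Longrightarrow> continuous_process M (\<lambda>t \<omega>. X t \<omega> + Y t \<omega>)"
  by (auto simp: continuous_process_def intro: continuous_on_add)

lemma continuous_process_diff:
  "continuous_process M X \<Longrightarrow> continuous_process M Y \<Longrightarrow> continuous_process M (\<lambda>t \<omega>. X t \<omega> - Y t \<omega>)"
  by (auto simp: continuous_process_def intro: continuous_on_diff)

lemma sup_moment_le_combination:
  assumes X: "adapted F X" "continuous_process M X" and Y: "adapted F Y" "continuous_process M Y"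
    and T: "0 \<le> T" and le: "\<And>\<omega>. \<omega> \<in> space M \<Longrightarrow> supsq Z T \<omega> \<le> 2 * supsq X T \<omega> + 2 * supsq Y T \<omega>"
  shows "sup_moment Z T \<le> 2 * sup_moment X T + 2 * sup_moment Y T"
proof -
  note [measurable] = supsq_measurable_M[OF X T] supsq_measurable_M[OF Y T]
  have "sup_moment Z T \<le> (\<integral>\<^sup>+\<omega>. 2 * supsq X T \<omega> + 2 * supsq Y T \<omega> \<partial>M)"
    unfolding sup_moment_def by (rule nn_integral_mono) (rule le)
  also have "\<dots> = 2 * sup_moment X T + 2 * sup_moment Y T"
    unfolding sup_moment_def by (simp add: nn_integral_add nn_integral_cmult)
  finally show ?thesis .
qed

lemmas sup_moment_add = sup_moment_le_combination[OF _ _ _ _ _ supsq_add]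
lemmas sup_moment_diff = sup_moment_le_combination[OF _ _ _ _ _ supsq_diff]

lemma sup_moment_mono: "T \<le> T' \<Longrightarrow> sup_moment X T \<le> sup_moment X T'"
  unfolding sup_moment_def by (intro nn_integral_mono supsq_mono)

lemma sup_moment_cong_AE:
  "(AE \<omega> in M. \<forall>t\<ge>0. X t \<omega> = Y t \<omega>) \<Longrightarrow> sup_moment X T = sup_moment Y T"
  unfolding sup_moment_def by (rule nn_integral_cong_AE) (auto elim!: eventually_mono intro!: supsq_cong)

lemma
  assumes "S2 X" "0 \<le> t"
  shows S2_measurable: "X t \<in> borel_measurable M" and S2_square_integrable: "integrable M (\<lambda>\<omega>. (X t \<omega>)\<^sup>2)"
proof -
  show m: "X t \<in> borel_measurable M" using assms by (auto simp: S2_def intro: adapted_M)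
  have "(\<integral>\<^sup>+\<omega>. ennreal ((X t \<omega>)\<^sup>2) \<partial>M) \<le> sup_moment X t"
    unfolding sup_moment_def using assms by (intro nn_integral_mono supsq_upper) auto
  also have "\<dots> < \<infinity>" using assms by (auto simp: S2_def)
  finally show "integrable M (\<lambda>\<omega>. (X t \<omega>)\<^sup>2)" using m by (simp add: integrable_square_iff)
qed

lemma S2_integrable: "S2 X \<Longrightarrow> 0 \<le> t \<Longrightarrow> integrable M (X t)"
  by (rule square_integrable_imp_integrable) (auto dest: S2_measurable S2_square_integrable)

lemma S2_add:
  assumes "S2 X" "S2 Y"
  shows "S2 (\<lambda>t \<omega>. X t \<omega> + Y t \<omega>)"
  unfolding S2_def
proof (intro conjI allI impI)
  fix T :: real assume T: "0 \<le> T"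
  have "sup_moment (\<lambda>t \<omega>. X t \<omega> + Y t \<omega>) T \<le> 2 * sup_moment X T + 2 * sup_moment Y T"
    using assms T by (intro sup_moment_add) (auto simp: S2_def)
  also have "\<dots> < \<infinity>"
    using assms T by (auto simp: S2_def ennreal_mult_less_top)
  finally show "sup_moment (\<lambda>t \<omega>. X t \<omega> + Y t \<omega>) T < \<infinity>" .
qed (use assms in \<open>auto simp: S2_def intro: adapted_add continuous_process_add\<close>)

lemma S2_diff:
  assumes "S2 X" "S2 Y"
  shows "S2 (\<lambda>t \<omega>. X t \<omega> - Y t \<omega>)"
  unfolding S2_def
proof (intro conjI allI impI)
  fix T :: real assume T: "0 \<le> T"
  have "sup_moment (\<lambda>t \<omega>. X t \<omega> - Y t \<omega>) T \<le> 2 * sup_moment X T + 2 * sup_moment Y T"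
    using assms T by (intro sup_moment_diff) (auto simp: S2_def)
  also have "\<dots> < \<infinity>"
    using assms T by (auto simp: S2_def ennreal_mult_less_top)
  finally show "sup_moment (\<lambda>t \<omega>. X t \<omega> - Y t \<omega>) T < \<infinity>" .
qed (use assms in \<open>auto simp: S2_def intro: adapted_diff continuous_process_diff\<close>)

lemma square_moment_le_sup_moment:
  assumes "S2 X" "0 \<le> t" "t \<le> T"
  shows "ennreal (\<integral>\<omega>. (X t \<omega>)\<^sup>2 \<partial>M) \<le> sup_moment X T"
  using S2_square_integrable[OF assms(1,2)] assms
  by (subst nn_integral_square[symmetric]) (auto simp: sup_moment_def intro!: nn_integral_mono supsq_upper)

lemma sup_moment_finite_AE:
  assumes "S2 X" "0 \<le> T"
  shows "AE \<omega> in M. supsq X T \<omega> < \<infinity>"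
  using nn_integral_noteq_infinite[of "supsq X T" M] assms supsq_measurable_M[of X T]
  by (auto simp: S2_def sup_moment_def less_top)

text \<open>Dominated convergence: paths are continuous, and \<open>4 * supsq X T\<close> dominates
  the squared differences. With \<open>wasserstein_law_le\<close> it makes the law of
  \<open>X t\<close> continuous in time.\<close>

lemma S2_mean_square_continuous:
  assumes X: "S2 X" and t: "0 \<le> t" and u0: "\<And>n. 0 \<le> u n" and ut: "u \<longlonglongrightarrow> t"
  shows "(\<lambda>n. \<integral>\<omega>. (X (u n) \<omega> - X t \<omega>)\<^sup>2 \<partial>M) \<longlonglongrightarrow> 0"
proof -
  obtain C where C: "\<And>n. norm (u n) \<le> C"
    using convergent_imp_Bseq[of u] ut by (auto simp: convergent_def Bseq_def)
  \<comment> \<open>A convergent sequence is bounded, so one horizon contains t and all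
    \<open>u n\<close>.\<close>
  define T where "T = max C t"
  have T: "0 \<le> T" "t \<le> T" using t by (auto simp: T_def)
  have uT: "u n \<le> T" for n using C[of n] by (auto simp: T_def)
  have [measurable]: "supsq X T \<in> borel_measurable M"
    using X T by (auto simp: S2_def intro: supsq_measurable_M)
  have [measurable]: "X t \<in> borel_measurable M" "\<And>n. X (u n) \<in> borel_measurable M"
    using X t u0 by (auto intro: S2_measurable)
  have "(\<lambda>n. \<integral>\<omega>. (X (u n) \<omega> - X t \<omega>)\<^sup>2 \<partial>M) \<longlonglongrightarrow> (\<integral>\<omega>. 0 \<partial>M)"
  proof (rule integral_dominated_convergence[where w="\<lambda>\<omega>. 4 * enn2real (supsq X T \<omega>)"])
    have "(\<integral>\<^sup>+\<omega>. ennreal (norm (enn2real (supsq X T \<omega>))) \<partial>M) = sup_moment X T"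
      unfolding sup_moment_def using sup_moment_finite_AE[OF X T(1)]
      by (intro nn_integral_cong_AE) (auto elim!: eventually_mono)
    also have "\<dots> < \<infinity>" using X T by (auto simp: S2_def)
    finally have "integrable M (\<lambda>\<omega>. enn2real (supsq X T \<omega>))"
      by (intro integrableI_bounded) auto
    then show "integrable M (\<lambda>\<omega>. 4 * enn2real (supsq X T \<omega>))" by simp
    show "AE \<omega> in M. (\<lambda>n. (X (u n) \<omega> - X t \<omega>)\<^sup>2) \<longlonglongrightarrow> 0"
    proof (rule AE_I2)
      fix \<omega> assume "\<omega> \<in> space M"
      then have "continuous_on {0..} (\<lambda>t. X t \<omega>)" using X by (auto simp: S2_def continuous_process_def)
      then have "(\<lambda>n. X (u n) \<omega>) \<longlonglongrightarrow> X t \<omega>"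
        by (rule continuous_on_tendsto_compose[OF _ ut]) (use t u0 in auto)
      then have "(\<lambda>n. (X (u n) \<omega> - X t \<omega>)\<^sup>2) \<longlonglongrightarrow> (X t \<omega> - X t \<omega>)\<^sup>2" by (intro tendsto_intros)
      then show "(\<lambda>n. (X (u n) \<omega> - X t \<omega>)\<^sup>2) \<longlonglongrightarrow> 0" by simp
    qed
    fix n
    show "AE \<omega> in M. norm ((X (u n) \<omega> - X t \<omega>)\<^sup>2) \<le> 4 * enn2real (supsq X T \<omega>)"
      using sup_moment_finite_AE[OF X T(1)]
    proof eventually_elim
      fix \<omega> assume fin: "supsq X T \<omega> < \<infinity>"
      have le: "(X v \<omega>)\<^sup>2 \<le> enn2real (supsq X T \<omega>)" if "0 \<le> v" "v \<le> T" for v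
        using enn2real_mono[OF supsq_upper[OF that, of X \<omega>]] fin by simp
      have "(X (u n) \<omega> - X t \<omega>)\<^sup>2 \<le> 2 * (X (u n) \<omega>)\<^sup>2 + 2 * (X t \<omega>)\<^sup>2"
        using sum_squares_bound[of "X (u n) \<omega>" "- X t \<omega>"] by (simp add: power2_diff)
      then show "norm ((X (u n) \<omega> - X t \<omega>)\<^sup>2) \<le> 4 * enn2real (supsq X T \<omega>)"
        using le[OF u0 uT, of n] le[OF t T(2)] by simp
    qed
  qed auto
  then show ?thesis by simp
qed

text \<open>Along a path both arguments of \<open>f\<close> vary with time. Continuity therefore
  combines continuity of the path with mean-square continuity of \<open>X\<close>, and the size is
  controlled by comparison with one fixed value of \<open>f\<close>.\<close>

lemma S2_coeff:
  assumes f: "lipschitz_coeff L f" and X: "S2 X"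
  shows "S2 (\<lambda>t \<omega>. f (X t \<omega>) (law M (X t)))"
proof -
  let ?H = "\<lambda>t \<omega>. f (X t \<omega>) (law M (X t))"
  note m = S2_measurable[OF X] and i = S2_square_integrable[OF X]
  note diff = lipschitz_coeff_diff[OF f m m i i]
  have "adapted F ?H" unfolding adapted_def
  proof (intro allI impI)
    fix t :: real assume t: "0 \<le> t"
    \<comment> \<open>For a frozen law the Lipschitz bound makes \<open>f\<close> continuous, hence
      Borel, in the state.\<close>
    have "continuous_on UNIV (\<lambda>x. f x (law M (X t)))"
      unfolding continuous_on_sequentially
    proof (intro allI ballI impI)
      fix u and x :: real assume "(\<forall>n. u n \<in> UNIV) \<and> u \<longlonglongrightarrow> x"
      then have "(\<lambda>n. 2 * L\<^sup>2 * ((u n - x)\<^sup>2 + 0)) \<longlonglongrightarrow> 2 * L\<^sup>2 * ((x - x)\<^sup>2 + 0)"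
        by (intro tendsto_intros) auto
      then have lim: "(\<lambda>n. 2 * L\<^sup>2 * ((u n - x)\<^sup>2 + 0)) \<longlonglongrightarrow> 0" by simp
      have "(f (u n) (law M (X t)) - f x (law M (X t)))\<^sup>2 \<le> 2 * L\<^sup>2 * ((u n - x)\<^sup>2 + 0)" for n
        using diff[OF t t t t, of "u n" x] by simp
      from tendsto_square_le[OF this lim]
      show "((\<lambda>x. f x (law M (X t))) \<circ> u) \<longlonglongrightarrow> f x (law M (X t))"
        by (simp add: comp_def)
    qed
    then have [measurable]: "(\<lambda>x. f x (law M (X t))) \<in> borel_measurable borel"
      by (rule borel_measurable_continuous_onI)
    have [measurable]: "X t \<in> borel_measurable (F t)" using X t by (auto simp: S2_def adapted_def)
    show "?H t \<in> borel_measurable (F t)" by simp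
  qed
  moreover have "continuous_process M ?H"
    unfolding continuous_process_def continuous_on_sequentially
  proof (intro ballI allI impI)
    fix \<omega> and u :: "nat \<Rightarrow> real" and t :: real
    assume w: "\<omega> \<in> space M" and t: "t \<in> {0..}" and u: "(\<forall>n. u n \<in> {0..}) \<and> u \<longlonglongrightarrow> t"
    have "continuous_on {0..} (\<lambda>t. X t \<omega>)" using X w by (auto simp: S2_def continuous_process_def)
    then have "(\<lambda>n. X (u n) \<omega>) \<longlonglongrightarrow> X t \<omega>"
      by (rule continuous_on_tendsto_compose) (use t u in auto)
    moreover have "(\<lambda>n. \<integral>\<omega>. (X (u n) \<omega> - X t \<omega>)\<^sup>2 \<partial>M) \<longlonglongrightarrow> 0"
      using t u by (intro S2_mean_square_continuous[OF X]) auto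
    ultimately have "(\<lambda>n. 2 * L\<^sup>2 * ((X (u n) \<omega> - X t \<omega>)\<^sup>2 + (\<integral>\<omega>. (X (u n) \<omega> - X t \<omega>)\<^sup>2 \<partial>M)))
       \<longlonglongrightarrow> 2 * L\<^sup>2 * ((X t \<omega> - X t \<omega>)\<^sup>2 + 0)" by (intro tendsto_intros)
    then have lim: "(\<lambda>n. 2 * L\<^sup>2 * ((X (u n) \<omega> - X t \<omega>)\<^sup>2 + (\<integral>\<omega>. (X (u n) \<omega> - X t \<omega>)\<^sup>2 \<partial>M)))
       \<longlonglongrightarrow> 0" by simp
    have "(?H (u n) \<omega> - ?H t \<omega>)\<^sup>2 \<le>
        2 * L\<^sup>2 * ((X (u n) \<omega> - X t \<omega>)\<^sup>2 + (\<integral>\<omega>. (X (u n) \<omega> - X t \<omega>)\<^sup>2 \<partial>M))" for n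
      using t u by (intro diff) auto
    from tendsto_square_le[OF this lim]
    show "((\<lambda>t. ?H t \<omega>) \<circ> u) \<longlonglongrightarrow> ?H t \<omega>" by (simp add: comp_def)
  qed
  moreover have "sup_moment ?H T < \<infinity>" if T: "0 \<le> T" for T
  proof -
    \<comment> \<open>The reference value is taken at state 0 and at the point mass at 0, which is
      the law of the zero variable on the same space; the coupling bound then compares
      \<open>X t\<close> with 0.\<close>
    define c where "c = f 0 (law M (\<lambda>\<omega>. 0))"
    have b: "supsq ?H T \<omega> \<le> ennreal (2 * c\<^sup>2) + ennreal (4 * L\<^sup>2) * (supsq X T \<omega> + sup_moment X T)"
      for \<omega>
    proof (rule supsq_least)
      fix t :: real assume t: "0 \<le> t" "t \<le> T"
      have d: "(?H t \<omega> - c)\<^sup>2 \<le> 2 * L\<^sup>2 * ((X t \<omega> - 0)\<^sup>2 + (\<integral>\<omega>. (X t \<omega> - 0)\<^sup>2 \<partial>M))"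
        unfolding c_def by (rule lipschitz_coeff_diff[OF f]) (use m[OF t(1)] i[OF t(1)] in auto)
      have "(?H t \<omega>)\<^sup>2 \<le> 2 * c\<^sup>2 + 2 * (?H t \<omega> - c)\<^sup>2"
        using sum_squares_bound[of "?H t \<omega> - c" c] power2_sum[of "?H t \<omega> - c" c] by simp
      also have "\<dots> \<le> 2 * c\<^sup>2 + 4 * L\<^sup>2 * ((X t \<omega>)\<^sup>2 + (\<integral>\<omega>. (X t \<omega>)\<^sup>2 \<partial>M))"
        using d by simp
      finally have "ennreal ((?H t \<omega>)\<^sup>2) \<le> ennreal (2 * c\<^sup>2 + 4 * L\<^sup>2 * ((X t \<omega>)\<^sup>2 + (\<integral>\<omega>. (X t \<omega>)\<^sup>2 \<partial>M)))"
        by (rule ennreal_leI)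
      also have "\<dots> = ennreal (2 * c\<^sup>2) + ennreal (4 * L\<^sup>2) * (ennreal ((X t \<omega>)\<^sup>2) + ennreal (\<integral>\<omega>. (X t \<omega>)\<^sup>2 \<partial>M))"
        by (subst ennreal_plus, simp, simp, subst ennreal_mult, simp, simp, subst ennreal_plus) auto
      also have "\<dots> \<le> ennreal (2 * c\<^sup>2) + ennreal (4 * L\<^sup>2) * (supsq X T \<omega> + sup_moment X T)"
        by (intro add_mono mult_left_mono order_refl supsq_upper square_moment_le_sup_moment t X) auto
      finally show "ennreal ((?H t \<omega>)\<^sup>2) \<le> ennreal (2 * c\<^sup>2) + ennreal (4 * L\<^sup>2) * (supsq X T \<omega> + sup_moment X T)" .
    qed
    have [measurable]: "supsq X T \<in> borel_measurable M"
      using X T by (auto simp: S2_def intro: supsq_measurable_M)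
    have "sup_moment ?H T \<le> (\<integral>\<^sup>+\<omega>. ennreal (2 * c\<^sup>2) + ennreal (4 * L\<^sup>2) * (supsq X T \<omega> + sup_moment X T) \<partial>M)"
      unfolding sup_moment_def[of ?H] by (intro nn_integral_mono b)
    also have "\<dots> = ennreal (2 * c\<^sup>2) + ennreal (4 * L\<^sup>2) * (sup_moment X T + sup_moment X T)"
      by (simp add: nn_integral_add nn_integral_cmult sup_moment_def emeasure_space_1)
    also have "\<dots> < \<infinity>" using X T by (auto simp: S2_def ennreal_mult_less_top)
    finally show ?thesis .
  qed
  ultimately show ?thesis by (auto simp: S2_def)
qed

end

section \<open>Square-integrable martingales and Doob's inequality\<close>

text \<open>The recursive form lets adaptedness and integrability of the maximum be proved by
  induction.\<close>

fun running_max :: "(nat \<Rightarrow> real) \<Rightarrow> nat \<Rightarrow> real" where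
  "running_max f 0 = f 0"
| "running_max f (Suc n) = max (running_max f n) (f (Suc n))"

lemma running_max_upper: "j \<le> n \<Longrightarrow> f j \<le> running_max f n"
  by (induction n) (auto simp: le_Suc_eq)

lemma running_max_nonneg: "(\<And>j. 0 \<le> f j) \<Longrightarrow> 0 \<le> running_max f n"
  using running_max_upper[of 0 n f] by (meson le0 order_trans)

text \<open>A pathwise form of Doob's \<open>L\<^sup>2\<close> inequality: the sum is the terminal value of a discrete
  stochastic integral, so it vanishes in expectation when \<open>x\<close> is a martingale.\<close>

lemma pathwise_doob:
  fixes x :: "nat \<Rightarrow> real"
  defines "r \<equiv> running_max (\<lambda>i. \<bar>x i\<bar>)"
  shows "(r n)\<^sup>2 + 4 * (\<Sum>i<n. (r i * sgn (x i)) * (x (Suc i) - x i)) \<le> 4 * (x n)\<^sup>2"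
proof -
  have r0: "0 \<le> r i" for i unfolding r_def by (rule running_max_nonneg) simp
  \<comment> \<open>\<open>sgn (x i)\<close> is a subgradient of the absolute value, so the sum is
    at most the integral of the running maximum against the increments of \<open>|x|\<close>. The
    maximum moves only to the current value of \<open>|x|\<close>, and summation by parts suggests
    the right-hand side.\<close>
  have "(\<Sum>i<n. (r i * sgn (x i)) * (x (Suc i) - x i)) \<le> r n * \<bar>x n\<bar> - (r n)\<^sup>2 / 2"
  proof (induction n)
    case 0 then show ?case by (simp add: r_def power2_eq_square)
  next
    case (Suc n)
    have "sgn (x n) * x (Suc n) \<le> \<bar>x (Suc n)\<bar>" by (auto simp: sgn_if)
    then have "r n * (sgn (x n) * (x (Suc n) - x n)) \<le> r n * (\<bar>x (Suc n)\<bar> - \<bar>x n\<bar>)"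
      by (intro mult_left_mono r0) (simp add: algebra_simps sgn_mult_self_eq abs_sgn)
    then have "(\<Sum>i<Suc n. (r i * sgn (x i)) * (x (Suc i) - x i)) \<le> r n * \<bar>x (Suc n)\<bar> - (r n)\<^sup>2 / 2"
      using Suc by (simp add: algebra_simps)
    also have "\<dots> \<le> r (Suc n) * \<bar>x (Suc n)\<bar> - (r (Suc n))\<^sup>2 / 2"
    proof (cases "\<bar>x (Suc n)\<bar> \<le> r n")
      case True then show ?thesis by (simp add: r_def)
    next
      case False
      then have "r (Suc n) = \<bar>x (Suc n)\<bar>" by (simp add: r_def)
      then show ?thesis
        using zero_le_power2[of "\<bar>x (Suc n)\<bar> - r n"] by (simp add: power2_eq_square algebra_simps)
    qed
    finally show ?case .
  qed
  \<comment> \<open>Young's inequality with weight 1/4 absorbs half of the term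
    \<open>(r n)^2 / 2\<close>; multiplying by 4 gives Doob's constant.\<close>
  moreover have "r n * \<bar>x n\<bar> \<le> (r n)\<^sup>2 / 4 + (x n)\<^sup>2"
    using zero_le_power2[of "r n / 2 - \<bar>x n\<bar>"] by (simp add: power2_diff power_divide)
  ultimately show ?thesis by simp
qed

context complete_filtered_prob_space
begin

text \<open>Orthogonality of increments to all square-integrable variables known at the earlier time
  is the martingale property without conditional expectations. It is exactly what annihilates the
  sum in \<open>pathwise_doob\<close>.\<close>

definition sq_martingale :: "(real \<Rightarrow> 'a \<Rightarrow> real) \<Rightarrow> bool" where
  "sq_martingale N \<longleftrightarrow> adapted F N \<and> (\<forall>t\<ge>0. integrable M (\<lambda>\<omega>. (N t \<omega>)\<^sup>2)) \<and>
     (\<forall>s t Z. 0 \<le> s \<longrightarrow> s \<le> t \<longrightarrow> Z \<in> borel_measurable (F s) \<longrightarrow> integrable M (\<lambda>\<omega>. (Z \<omega>)\<^sup>2) \<longrightarrow>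
        (\<integral>\<omega>. Z \<omega> * (N t \<omega> - N s \<omega>) \<partial>M) = 0)"

lemma sq_martingale_diff:
  assumes N: "sq_martingale N" and N': "sq_martingale N'"
  shows "sq_martingale (\<lambda>t \<omega>. N t \<omega> - N' t \<omega>)"
  unfolding sq_martingale_def
proof (intro conjI allI impI)
  have m: "N t \<in> borel_measurable M" "N' t \<in> borel_measurable M" if "0 \<le> t" for t
    using N N' that by (auto simp: sq_martingale_def intro: adapted_M)
  have i: "integrable M (\<lambda>\<omega>. (N t \<omega>)\<^sup>2)" "integrable M (\<lambda>\<omega>. (N' t \<omega>)\<^sup>2)" if "0 \<le> t" for t
    using N N' that by (auto simp: sq_martingale_def)
  show "adapted F (\<lambda>t \<omega>. N t \<omega> - N' t \<omega>)"
    using N N' by (auto simp: sq_martingale_def intro: adapted_diff)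
  show "integrable M (\<lambda>\<omega>. (N t \<omega> - N' t \<omega>)\<^sup>2)" if "0 \<le> t" for t
    by (intro integrable_square_diff m i that)
  fix s t :: real and Z :: "'a \<Rightarrow> real"
  assume st: "0 \<le> s" "s \<le> t" and Z: "Z \<in> borel_measurable (F s)" "integrable M (\<lambda>\<omega>. (Z \<omega>)\<^sup>2)"
  then have t: "0 \<le> t" by simp
  have ZM: "Z \<in> borel_measurable M" using Z st by (auto intro: measurable_F_M)
  have mi: "integrable M (\<lambda>\<omega>. Z \<omega> * (N t \<omega> - N s \<omega>))" "integrable M (\<lambda>\<omega>. Z \<omega> * (N' t \<omega> - N' s \<omega>))"
    by (intro integrable_mult_square borel_measurable_diff integrable_square_diff ZM m i Z st t)+
  have "(\<integral>\<omega>. Z \<omega> * (N t \<omega> - N' t \<omega> - (N s \<omega> - N' s \<omega>)) \<partial>M)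
     = (\<integral>\<omega>. Z \<omega> * (N t \<omega> - N s \<omega>) - Z \<omega> * (N' t \<omega> - N' s \<omega>) \<partial>M)"
    by (simp add: algebra_simps)
  also have "\<dots> = 0"
    using N N' Z st by (subst Bochner_Integration.integral_diff[OF mi]) (auto simp: sq_martingale_def)
  finally show "(\<integral>\<omega>. Z \<omega> * (N t \<omega> - N' t \<omega> - (N s \<omega> - N' s \<omega>)) \<partial>M) = 0" .
qed

text \<open>The expectation of the pathwise inequality. Its weights are known at the left end of
  each step and are bounded by the running maximum of finitely many square-integrable variables, so
  each summand has mean zero.\<close>

lemma doob_discrete:
  assumes N: "sq_martingale N" and \<tau>: "0 \<le> \<tau> 0" "\<And>i. \<tau> i \<le> \<tau> (Suc i)"
  defines "r \<equiv> \<lambda>i \<omega>. running_max (\<lambda>i. \<bar>N (\<tau> i) \<omega>\<bar>) i"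
  shows "(\<integral>\<^sup>+\<omega>. ennreal ((r n \<omega>)\<^sup>2) \<partial>M) \<le> 4 * (\<integral>\<^sup>+\<omega>. ennreal ((N (\<tau> n) \<omega>)\<^sup>2) \<partial>M)"
proof -
  have inc: "incseq \<tau>" using \<tau>(2) by (rule incseq_SucI)
  have \<tau>0: "0 \<le> \<tau> i" for i using incseqD[OF inc, of 0 i] \<tau>(1) by simp
  have ad: "adapted F N" and i: "\<And>t. 0 \<le> t \<Longrightarrow> integrable M (\<lambda>\<omega>. (N t \<omega>)\<^sup>2)"
    using N by (auto simp: sq_martingale_def)
  have NF: "N (\<tau> i) \<in> borel_measurable (F (\<tau> j))" if "i \<le> j" for i j
    using ad \<tau>0 incseqD[OF inc that] by (auto intro: adaptedD)
  have NM[measurable]: "N (\<tau> i) \<in> borel_measurable M" for i using ad \<tau>0 by (rule adapted_M)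
  have rF: "r k \<in> borel_measurable (F (\<tau> j))" if "k \<le> j" for k j
    using that
  proof (induction k)
    case 0 then show ?case using NF[of 0 j] by (simp add: r_def)
  next
    case (Suc k) then show ?case using NF[of "Suc k" j] by (simp add: r_def)
  qed
  have rM[measurable]: "r k \<in> borel_measurable M" for k
    by (rule measurable_F_M[OF \<tau>0 rF[OF order_refl]])
  have r0: "0 \<le> r k \<omega>" for k \<omega> unfolding r_def by (rule running_max_nonneg) simp
  have ri: "integrable M (\<lambda>\<omega>. (r k \<omega>)\<^sup>2)" for k
  proof (induction k)
    case 0 show ?case using i[OF \<tau>0, of 0] by (simp add: r_def)
  next
    case (Suc k)
    show ?case
    proof (rule Bochner_Integration.integrable_bound)
      show "integrable M (\<lambda>\<omega>. (r k \<omega>)\<^sup>2 + (N (\<tau> (Suc k)) \<omega>)\<^sup>2)" by (intro Bochner_Integration.integrable_add Suc i \<tau>0)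
      show "AE \<omega> in M. norm ((r (Suc k) \<omega>)\<^sup>2) \<le> norm ((r k \<omega>)\<^sup>2 + (N (\<tau> (Suc k)) \<omega>)\<^sup>2)"
        by (auto simp: r_def max_def)
    qed simp
  qed
  define Z where "Z i \<omega> = r i \<omega> * sgn (N (\<tau> i) \<omega>)" for i \<omega>
  have ZF: "Z i \<in> borel_measurable (F (\<tau> i))" for i
    unfolding Z_def by (intro borel_measurable_times rF measurable_compose[OF NF borel_measurable_sgn]) auto
  have ZM: "Z i \<in> borel_measurable M" for i by (rule measurable_F_M[OF \<tau>0 ZF])
  have Zi: "integrable M (\<lambda>\<omega>. (Z i \<omega>)\<^sup>2)" for i
  proof (rule Bochner_Integration.integrable_bound[OF ri[of i]])
    show "AE \<omega> in M. norm ((Z i \<omega>)\<^sup>2) \<le> norm ((r i \<omega>)\<^sup>2)"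
      by (auto simp: Z_def power_mult_distrib sgn_if)
  qed (use ZM in auto)
  have mi: "integrable M (\<lambda>\<omega>. Z i \<omega> * (N (\<tau> (Suc i)) \<omega> - N (\<tau> i) \<omega>))" for i
    by (intro integrable_mult_square borel_measurable_diff integrable_square_diff ZM NM i \<tau>0 Zi)
  have zero: "(\<integral>\<omega>. Z i \<omega> * (N (\<tau> (Suc i)) \<omega> - N (\<tau> i) \<omega>) \<partial>M) = 0" for i
    using N \<tau>0 \<tau>(2) ZF Zi by (auto simp: sq_martingale_def)
  have "(\<integral>\<omega>. (r n \<omega>)\<^sup>2 \<partial>M) =
     (\<integral>\<omega>. (r n \<omega>)\<^sup>2 + 4 * (\<Sum>i<n. Z i \<omega> * (N (\<tau> (Suc i)) \<omega> - N (\<tau> i) \<omega>)) \<partial>M)"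
    using ri mi by (simp add: zero integral_sum)
  also have "\<dots> \<le> (\<integral>\<omega>. 4 * (N (\<tau> n) \<omega>)\<^sup>2 \<partial>M)"
    using ri mi i[OF \<tau>0] pathwise_doob[of "\<lambda>i. N (\<tau> i) _" n]
    by (intro integral_mono) (auto simp: Z_def r_def)
  finally have "(\<integral>\<omega>. (r n \<omega>)\<^sup>2 \<partial>M) \<le> 4 * (\<integral>\<omega>. (N (\<tau> n) \<omega>)\<^sup>2 \<partial>M)" by simp
  then have "ennreal (\<integral>\<omega>. (r n \<omega>)\<^sup>2 \<partial>M) \<le> ennreal (4 * (\<integral>\<omega>. (N (\<tau> n) \<omega>)\<^sup>2 \<partial>M))"
    by (rule ennreal_leI)
  then show ?thesis
    by (simp add: nn_integral_square[OF ri] nn_integral_square[OF i[OF \<tau>0]] ennreal_mult)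
qed

text \<open>The discrete constant 4 does not depend on the mesh, and the suprema over dyadic grids
  increase to the supremum over \<open>[0,T]\<close> for continuous paths, so monotone convergence
  finishes.\<close>

lemma doob:
  assumes N: "sq_martingale N" and c: "continuous_process M N" and T: "0 \<le> T"
  shows "sup_moment N T \<le> 4 * (\<integral>\<^sup>+\<omega>. ennreal ((N T \<omega>)\<^sup>2) \<partial>M)"
proof -
  define g where "g n \<omega> = (SUP j\<in>{..2^n}. ennreal ((N (T * real j / 2^n) \<omega>)\<^sup>2))" for n :: nat and \<omega>
  have ad: "adapted F N" using N by (auto simp: sq_martingale_def)
  have gm: "g n \<in> borel_measurable M" for n
    unfolding g_def using T
    by (intro borel_measurable_SUP)
       (auto intro!: measurable_compose[OF _ measurable_ennreal] borel_measurable_power adapted_M[OF ad])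
  have inc: "incseq g"
  proof (intro incseq_SucI le_funI)
    fix n \<omega>
    show "g n \<omega> \<le> g (Suc n) \<omega>"
      unfolding g_def
    proof (rule SUP_least)
      fix j :: nat assume "j \<in> {..2^n}"
      then show "ennreal ((N (T * real j / 2 ^ n) \<omega>)\<^sup>2)
          \<le> (SUP j\<in>{..2 ^ Suc n}. ennreal ((N (T * real j / 2 ^ Suc n) \<omega>)\<^sup>2))"
        \<comment> \<open>Point j of level n is point \<open>2 * j\<close> of the next
          level.\<close>
        by (intro SUP_upper2[of "2 * j"]) auto
    qed
  qed
  have gle: "(\<integral>\<^sup>+\<omega>. g n \<omega> \<partial>M) \<le> 4 * (\<integral>\<^sup>+\<omega>. ennreal ((N T \<omega>)\<^sup>2) \<partial>M)" for n
  proof -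
    define \<tau> where "\<tau> i = T * real i / 2^n" for i
    let ?r = "\<lambda>\<omega>. running_max (\<lambda>i. \<bar>N (\<tau> i) \<omega>\<bar>) (2^n)"
    have "g n \<omega> \<le> ennreal ((?r \<omega>)\<^sup>2)" for \<omega>
      unfolding g_def
    proof (intro SUP_least ennreal_leI)
      fix j :: nat assume "j \<in> {..2^n}"
      then have "\<bar>N (\<tau> j) \<omega>\<bar> \<le> ?r \<omega>"
        using running_max_upper[of j "2^n" "\<lambda>i. \<bar>N (\<tau> i) \<omega>\<bar>"] by simp
      then have "\<bar>N (\<tau> j) \<omega>\<bar>\<^sup>2 \<le> (?r \<omega>)\<^sup>2" by (intro power_mono) auto
      then show "(N (T * real j / 2 ^ n) \<omega>)\<^sup>2 \<le> (?r \<omega>)\<^sup>2" by (simp add: \<tau>_def)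
    qed
    then have "(\<integral>\<^sup>+\<omega>. g n \<omega> \<partial>M) \<le> (\<integral>\<^sup>+\<omega>. ennreal ((?r \<omega>)\<^sup>2) \<partial>M)"
      by (intro nn_integral_mono)
    also have "\<dots> \<le> 4 * (\<integral>\<^sup>+\<omega>. ennreal ((N (\<tau> (2^n)) \<omega>)\<^sup>2) \<partial>M)"
      using T by (intro doob_discrete[OF N]) (auto simp: \<tau>_def field_simps)
    finally show ?thesis by (simp add: \<tau>_def)
  qed
  have "sup_moment N T = (\<integral>\<^sup>+\<omega>. (SUP n. g n \<omega>) \<partial>M)"
    unfolding sup_moment_def g_def using c T
    by (intro nn_integral_cong supsq_grid) (auto simp: continuous_process_def)
  also have "\<dots> = (SUP n. \<integral>\<^sup>+\<omega>. g n \<omega> \<partial>M)"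
    by (rule nn_integral_monotone_convergence_SUP[OF inc gm])
  also have "\<dots> \<le> 4 * (\<integral>\<^sup>+\<omega>. ennreal ((N T \<omega>)\<^sup>2) \<partial>M)"
    by (rule SUP_least) (rule gle)
  finally show ?thesis .
qed

lemma sq_martingale_S2:
  assumes "sq_martingale N" "continuous_process M N"
  shows "S2 N"
  unfolding S2_def
proof (intro conjI allI impI)
  fix T :: real assume T: "0 \<le> T"
  have "sup_moment N T \<le> 4 * (\<integral>\<^sup>+\<omega>. ennreal ((N T \<omega>)\<^sup>2) \<partial>M)" by (rule doob[OF assms T])
  also have "\<dots> < \<infinity>"
    using assms T by (auto simp: sq_martingale_def nn_integral_square ennreal_mult_less_top)
  finally show "sup_moment N T < \<infinity>" .
qed (use assms in \<open>auto simp: sq_martingale_def\<close>)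

text \<open>For a fixed test variable the orthogonality integral is continuous in \<open>L^2\<close>
  by Cauchy-Schwarz, so it vanishes in the limit too.\<close>

lemma sq_martingale_limit:
  assumes Nk: "\<And>k. sq_martingale (Nk k)" and ad: "adapted F N"
    and lim: "\<And>t. 0 \<le> t \<Longrightarrow> (\<lambda>k. \<integral>\<^sup>+\<omega>. ennreal ((N t \<omega> - Nk k t \<omega>)\<^sup>2) \<partial>M) \<longlonglongrightarrow> 0"
  shows "sq_martingale N"
  unfolding sq_martingale_def
proof (intro conjI allI impI)
  have m: "N t \<in> borel_measurable M" "Nk k t \<in> borel_measurable M" if "0 \<le> t" for t k
    using ad Nk[of k] that by (auto simp: sq_martingale_def intro: adapted_M)
  have ik: "integrable M (\<lambda>\<omega>. (Nk k t \<omega>)\<^sup>2)" if "0 \<le> t" for t k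
    using Nk[of k] that by (auto simp: sq_martingale_def)
  show i: "integrable M (\<lambda>\<omega>. (N t \<omega>)\<^sup>2)" if t: "0 \<le> t" for t
  proof -
    have "eventually (\<lambda>k. (\<integral>\<^sup>+\<omega>. ennreal ((N t \<omega> - Nk k t \<omega>)\<^sup>2) \<partial>M) < 1) sequentially"
      using order_tendstoD(2)[OF lim[OF t], of 1] by simp
    then obtain k where k: "(\<integral>\<^sup>+\<omega>. ennreal ((N t \<omega> - Nk k t \<omega>)\<^sup>2) \<partial>M) < 1"
      by (auto simp: eventually_sequentially)
    note [measurable] = m[OF t]
    have "integrable M (\<lambda>\<omega>. (N t \<omega> - Nk k t \<omega>)\<^sup>2)"
      using k by (subst integrable_square_iff) (auto intro: order.strict_trans)
    then have "integrable M (\<lambda>\<omega>. ((N t \<omega> - Nk k t \<omega>) - (- Nk k t \<omega>))\<^sup>2)"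
      using integrable_square_diff[of "\<lambda>\<omega>. N t \<omega> - Nk k t \<omega>" "\<lambda>\<omega>. - Nk k t \<omega>"] ik[OF t, of k]
      by simp
    then show ?thesis by simp
  qed
  show "adapted F N" by fact
  fix s t :: real and Z :: "'a \<Rightarrow> real"
  assume st: "0 \<le> s" "s \<le> t" and Z: "Z \<in> borel_measurable (F s)" "integrable M (\<lambda>\<omega>. (Z \<omega>)\<^sup>2)"
  then have t: "0 \<le> t" by simp
  have [measurable]: "Z \<in> borel_measurable M" using Z st by (auto intro: measurable_F_M)
  note [measurable] = m[OF t] m[OF st(1)]
  define c where "c = (\<integral>\<^sup>+\<omega>. ennreal ((Z \<omega>)\<^sup>2) \<partial>M)"
  have c: "c < top" unfolding c_def using Z(2) by (simp add: nn_integral_square)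
  \<comment> \<open>Subtracting the vanishing integral of \<open>Nk k\<close> leaves the test
    variable against this error alone, which tends to 0 in mean square.\<close>
  define D where "D k \<omega> = (N t \<omega> - Nk k t \<omega>) - (N s \<omega> - Nk k s \<omega>)" for k \<omega>
  let ?x = "\<integral>\<omega>. Z \<omega> * (N t \<omega> - N s \<omega>) \<partial>M"
  have le: "ennreal (\<bar>?x\<bar>\<^sup>2) \<le> c * (2 * (\<integral>\<^sup>+\<omega>. ennreal ((N t \<omega> - Nk k t \<omega>)\<^sup>2) \<partial>M)
      + 2 * (\<integral>\<^sup>+\<omega>. ennreal ((N s \<omega> - Nk k s \<omega>)\<^sup>2) \<partial>M))" for k
  proof -
    have [measurable]: "D k \<in> borel_measurable M" unfolding D_def by measurable
    have iD: "integrable M (\<lambda>\<omega>. (D k \<omega>)\<^sup>2)"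
      unfolding D_def by (intro integrable_square_diff borel_measurable_diff m i ik t st)
    have iZD: "integrable M (\<lambda>\<omega>. Z \<omega> * D k \<omega>)" by (intro integrable_mult_square Z iD) auto
    have "?x = ?x - (\<integral>\<omega>. Z \<omega> * (Nk k t \<omega> - Nk k s \<omega>) \<partial>M)"
      using Nk[of k] st Z by (auto simp: sq_martingale_def)
    also have "\<dots> = (\<integral>\<omega>. Z \<omega> * (N t \<omega> - N s \<omega>) - Z \<omega> * (Nk k t \<omega> - Nk k s \<omega>) \<partial>M)"
      by (intro Bochner_Integration.integral_diff[symmetric] integrable_mult_square
           borel_measurable_diff m integrable_square_diff i ik Z t st) auto
    also have "\<dots> = (\<integral>\<omega>. Z \<omega> * D k \<omega> \<partial>M)" by (simp add: D_def algebra_simps)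
    finally have "\<bar>?x\<bar> \<le> (\<integral>\<omega>. \<bar>Z \<omega> * D k \<omega>\<bar> \<partial>M)" by (metis integral_abs_bound)
    then have "ennreal \<bar>?x\<bar> \<le> (\<integral>\<^sup>+\<omega>. ennreal \<bar>Z \<omega> * D k \<omega>\<bar> \<partial>M)"
      using iZD by (subst nn_integral_eq_integral) (auto intro: ennreal_leI)
    also have "\<dots> = (\<integral>\<^sup>+\<omega>. ennreal \<bar>Z \<omega>\<bar> * ennreal \<bar>D k \<omega>\<bar> \<partial>M)"
      by (simp add: abs_mult ennreal_mult)
    finally have "(ennreal \<bar>?x\<bar>)\<^sup>2 \<le> (\<integral>\<^sup>+\<omega>. ennreal \<bar>Z \<omega>\<bar> * ennreal \<bar>D k \<omega>\<bar> \<partial>M)\<^sup>2"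
      by (intro power_mono) auto
    also have "\<dots> \<le> (\<integral>\<^sup>+\<omega>. (ennreal \<bar>Z \<omega>\<bar>)\<^sup>2 \<partial>M) * (\<integral>\<^sup>+\<omega>. (ennreal \<bar>D k \<omega>\<bar>)\<^sup>2 \<partial>M)"
      by (rule Cauchy_Schwarz_nn_integral) auto
    also have "\<dots> = c * (\<integral>\<^sup>+\<omega>. ennreal ((D k \<omega>)\<^sup>2) \<partial>M)"
      unfolding c_def by (simp add: ennreal_power)
    also have "\<dots> \<le> c * (\<integral>\<^sup>+\<omega>. 2 * ennreal ((N t \<omega> - Nk k t \<omega>)\<^sup>2) + 2 * ennreal ((N s \<omega> - Nk k s \<omega>)\<^sup>2) \<partial>M)"
      unfolding D_def by (intro mult_left_mono nn_integral_mono ennreal_square_diff_le) auto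
    also have "\<dots> = c * (2 * (\<integral>\<^sup>+\<omega>. ennreal ((N t \<omega> - Nk k t \<omega>)\<^sup>2) \<partial>M)
      + 2 * (\<integral>\<^sup>+\<omega>. ennreal ((N s \<omega> - Nk k s \<omega>)\<^sup>2) \<partial>M))"
      by (simp add: nn_integral_add nn_integral_cmult)
    finally show ?thesis by (simp add: ennreal_power)
  qed
  have "(\<lambda>k. c * (2 * (\<integral>\<^sup>+\<omega>. ennreal ((N t \<omega> - Nk k t \<omega>)\<^sup>2) \<partial>M)
      + 2 * (\<integral>\<^sup>+\<omega>. ennreal ((N s \<omega> - Nk k s \<omega>)\<^sup>2) \<partial>M))) \<longlonglongrightarrow> c * (2 * 0 + 2 * 0)"
    using c by (intro tendsto_add ennreal_tendsto_cmult lim t st) auto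
  then have "ennreal (\<bar>?x\<bar>\<^sup>2) \<le> c * (2 * 0 + 2 * 0)"
    by (rule LIMSEQ_le_const) (use le in auto)
  then have "ennreal (\<bar>?x\<bar>\<^sup>2) = 0" by simp
  then show "?x = 0" by simp
qed

end

section \<open>Integrals of elementary processes\<close>

lemma integral_double_sum:
  fixes f :: "'i \<Rightarrow> 'i \<Rightarrow> 'b \<Rightarrow> real"
  assumes "\<And>i j. i \<in> J \<Longrightarrow> j \<in> J \<Longrightarrow> integrable N (f i j)"
  shows "integrable N (\<lambda>x. \<Sum>i\<in>J. \<Sum>j\<in>J. f i j x)"
    "(\<integral>x. (\<Sum>i\<in>J. \<Sum>j\<in>J. f i j x) \<partial>N) = (\<Sum>i\<in>J. \<Sum>j\<in>J. \<integral>x. f i j x \<partial>N)"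
  using assms by (simp_all add: Bochner_Integration.integral_sum Bochner_Integration.integrable_sum)

text \<open>Written with \<open>max a (min t b)\<close>, the stopped increment starts at \<open>a\<close> for every \<open>t\<close>, so that a
  weight known at time \<open>a\<close> is admissible even when \<open>t < a\<close>.\<close>

lemma stopped_increment:
  fixes f :: "real \<Rightarrow> real"
  shows "a \<le> b \<Longrightarrow> f (min t b) - f (min t a) = f (max a (min t b)) - f a"
  by (auto simp: min_def max_def)

locale brownian_filtration = complete_filtered_prob_space M F for M :: "'a measure" and F +
  fixes B :: "real \<Rightarrow> 'a \<Rightarrow> real"
  assumes brownian: "brownian_motion M F B"
begin

lemma B_F: "0 \<le> s \<Longrightarrow> s \<le> t \<Longrightarrow> B s \<in> borel_measurable (F t)"
  using brownian by (auto simp: brownian_motion_def intro: adaptedD)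

lemma B_M: "0 \<le> s \<Longrightarrow> B s \<in> borel_measurable M"
  using B_F[of s s] by (auto intro: measurable_F_M)

lemma increment_moments:
  assumes "0 \<le> s" "s < t"
  shows "integrable M (\<lambda>\<omega>. (B t \<omega> - B s \<omega>)\<^sup>2)" "(\<integral>\<omega>. B t \<omega> - B s \<omega> \<partial>M) = 0"
    "(\<integral>\<omega>. (B t \<omega> - B s \<omega>)\<^sup>2 \<partial>M) = t - s"
proof -
  have D: "distributed M lborel (\<lambda>\<omega>. B t \<omega> - B s \<omega>) (normal_density 0 (sqrt (t - s)))"
    using brownian assms by (auto simp: brownian_motion_def)
  have p: "0 < sqrt (t - s)" using assms by simp
  show "integrable M (\<lambda>\<omega>. (B t \<omega> - B s \<omega>)\<^sup>2)"
    using distributed_integrable[OF D, of "\<lambda>x. x\<^sup>2"] integrable_normal_moment[OF p, of 0 2] by simp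
  show e: "(\<integral>\<omega>. B t \<omega> - B s \<omega> \<partial>M) = 0"
    by (rule normal_distributed_expectation[OF p D])
  show "(\<integral>\<omega>. (B t \<omega> - B s \<omega>)\<^sup>2 \<partial>M) = t - s"
    using normal_distributed_variance[OF p D] assms by (simp add: e)
qed

lemma increment_indep:
  fixes Z :: "'a \<Rightarrow> real"
  assumes "0 \<le> s" "s < t" and Z: "Z \<in> borel_measurable (F s)"
  shows "indep_var borel Z borel (\<lambda>\<omega>. B t \<omega> - B s \<omega>)"
proof -
  let ?D = "\<lambda>\<omega>. B t \<omega> - B s \<omega>"
  have ind: "indep_set (sets (F s)) (sets (vimage_algebra (space M) ?D borel))"
    using brownian assms by (auto simp: brownian_motion_def)
  have sub: "sigma_sets (space M) {Z -` A \<inter> space M |A. A \<in> sets borel} \<subseteq> sets (F s)"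
    unfolding space_F[OF assms(1), symmetric]
    by (rule sets.sigma_sets_subset) (auto intro: measurable_sets[OF Z])
  have m: "Z \<in> borel_measurable M" "?D \<in> borel_measurable M"
    using assms by (auto intro: measurable_F_M intro!: borel_measurable_diff B_M)
  show ?thesis
    unfolding indep_var_eq using ind sub m by (auto simp: indep_sets2_eq sets_vimage_algebra)
qed

text \<open>Independence of the past factors both expectations. The degenerate case
  \<open>s = t\<close>, in which the increment has no density, is included because stopping can
  collapse an interval to a point.\<close>

lemma increment_product:
  fixes Z :: "'a \<Rightarrow> real"
  assumes s: "0 \<le> s" "s \<le> t" and Z: "Z \<in> borel_measurable (F s)" "integrable M Z"
  shows "integrable M (\<lambda>\<omega>. Z \<omega> * (B t \<omega> - B s \<omega>))" "(\<integral>\<omega>. Z \<omega> * (B t \<omega> - B s \<omega>) \<partial>M) = 0"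
    "integrable M (\<lambda>\<omega>. Z \<omega> * (B t \<omega> - B s \<omega>)\<^sup>2)"
    "(\<integral>\<omega>. Z \<omega> * (B t \<omega> - B s \<omega>)\<^sup>2 \<partial>M) = (\<integral>\<omega>. Z \<omega> \<partial>M) * (t - s)"
proof -
  let ?D = "\<lambda>\<omega>. B t \<omega> - B s \<omega>"
  have "integrable M (\<lambda>\<omega>. Z \<omega> * ?D \<omega>) \<and> (\<integral>\<omega>. Z \<omega> * ?D \<omega> \<partial>M) = 0 \<and>
    integrable M (\<lambda>\<omega>. Z \<omega> * (?D \<omega>)\<^sup>2) \<and> (\<integral>\<omega>. Z \<omega> * (?D \<omega>)\<^sup>2 \<partial>M) = (\<integral>\<omega>. Z \<omega> \<partial>M) * (t - s)"
  proof (cases "s = t")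
    case False
    then have st: "s < t" using s by simp
    note mom = increment_moments[OF s(1) st]
    have Di: "integrable M ?D"
      by (rule square_integrable_imp_integrable) (use mom s in \<open>auto intro!: borel_measurable_diff B_M\<close>)
    have ind: "indep_var borel Z borel ?D" by (rule increment_indep[OF s(1) st Z(1)])
    have "indep_var borel ((\<lambda>x. x) \<circ> Z) borel ((\<lambda>x. x\<^sup>2) \<circ> ?D)"
      by (rule indep_var_compose[OF ind]) auto
    then have ind2: "indep_var borel Z borel (\<lambda>\<omega>. (?D \<omega>)\<^sup>2)" by (simp add: comp_def)
    show ?thesis
      using indep_var_lebesgue_integral[OF ind Z(2) Di] indep_var_integrable[OF ind Z(2) Di]
        indep_var_lebesgue_integral[OF ind2 Z(2) mom(1)] indep_var_integrable[OF ind2 Z(2) mom(1)] mom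
      by simp
  qed simp
  then show "integrable M (\<lambda>\<omega>. Z \<omega> * ?D \<omega>)" "(\<integral>\<omega>. Z \<omega> * ?D \<omega> \<partial>M) = 0"
    "integrable M (\<lambda>\<omega>. Z \<omega> * (?D \<omega>)\<^sup>2)" "(\<integral>\<omega>. Z \<omega> * (?D \<omega>)\<^sup>2 \<partial>M) = (\<integral>\<omega>. Z \<omega> \<partial>M) * (t - s)"
    by auto
qed

text \<open>\<open>0 \<le> s\<close> is bundled in because the filtration is unconstrained at
  negative times.\<close>

definition weight :: "real \<Rightarrow> ('a \<Rightarrow> real) \<Rightarrow> bool" where
  "weight s \<eta> \<longleftrightarrow> 0 \<le> s \<and> \<eta> \<in> borel_measurable (F s) \<and> bounded (\<eta> ` space M)"

lemma weight_measurable: "weight s \<eta> \<Longrightarrow> s \<le> t \<Longrightarrow> \<eta> \<in> borel_measurable (F t)"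
  by (rule measurable_F_mono[of s]) (auto simp: weight_def)

lemma weight_measurable_M: "weight s \<eta> \<Longrightarrow> \<eta> \<in> borel_measurable M"
  by (rule measurable_F_M[of s]) (auto simp: weight_def)

lemma weight_mono:
  assumes "weight s \<eta>" "s \<le> t"
  shows "weight t \<eta>"
  using assms weight_measurable[OF assms] unfolding weight_def by linarith

lemma weight_mult:
  assumes "weight s \<eta>" "weight s \<eta>'" shows "weight s (\<lambda>\<omega>. \<eta> \<omega> * \<eta>' \<omega>)"
proof -
  obtain C C' where C: "\<And>\<omega>. \<omega> \<in> space M \<Longrightarrow> \<bar>\<eta> \<omega>\<bar> \<le> C" "\<And>\<omega>. \<omega> \<in> space M \<Longrightarrow> \<bar>\<eta>' \<omega>\<bar> \<le> C'"
    using assms by (auto simp: weight_def bounded_iff)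
  have "\<bar>\<eta> \<omega> * \<eta>' \<omega>\<bar> \<le> C * C'" if "\<omega> \<in> space M" for \<omega>
    using C[OF that] unfolding abs_mult by (intro mult_mono) auto
  then have "bounded ((\<lambda>\<omega>. \<eta> \<omega> * \<eta>' \<omega>) ` space M)" by (auto simp: bounded_iff)
  then show ?thesis using assms by (auto simp: weight_def)
qed

lemma weight_uminus: "weight s \<eta> \<Longrightarrow> weight s (\<lambda>\<omega>. - \<eta> \<omega>)"
  by (auto simp: weight_def bounded_iff)

lemma integrable_weight_mult:
  assumes \<eta>: "weight s \<eta>" and Z: "integrable M Z"
  shows "integrable M (\<lambda>\<omega>. \<eta> \<omega> * Z \<omega>)"
proof -
  obtain C where C: "\<And>\<omega>. \<omega> \<in> space M \<Longrightarrow> \<bar>\<eta> \<omega>\<bar> \<le> C"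
    using assms by (auto simp: weight_def bounded_iff)
  show ?thesis
  proof (rule Bochner_Integration.integrable_bound[of M "\<lambda>\<omega>. C * \<bar>Z \<omega>\<bar>"])
    show "AE \<omega> in M. norm (\<eta> \<omega> * Z \<omega>) \<le> norm (C * \<bar>Z \<omega>\<bar>)"
    proof (rule AE_I2)
      fix \<omega> assume "\<omega> \<in> space M"
      from C[OF this] have "\<bar>\<eta> \<omega>\<bar> \<le> \<bar>C\<bar>" by simp
      then show "norm (\<eta> \<omega> * Z \<omega>) \<le> norm (C * \<bar>Z \<omega>\<bar>)"
        by (auto simp: abs_mult intro: mult_right_mono)
    qed
  qed (use Z weight_measurable_M[OF \<eta>] in \<open>auto\<close>)
qed

lemma integrable_weight: "weight s \<eta> \<Longrightarrow> integrable M \<eta>"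
  using integrable_weight_mult[of s \<eta> "\<lambda>_. 1"] by simp

lemma weighted_increment:
  assumes \<eta>: "weight s \<eta>" and st: "s \<le> t"
  shows "(\<lambda>\<omega>. \<eta> \<omega> * (B t \<omega> - B s \<omega>)) \<in> borel_measurable (F t)"
    "(\<lambda>\<omega>. \<eta> \<omega> * (B t \<omega> - B s \<omega>)) \<in> borel_measurable M"
    "integrable M (\<lambda>\<omega>. (\<eta> \<omega> * (B t \<omega> - B s \<omega>))\<^sup>2)"
    "integrable M (\<lambda>\<omega>. \<eta> \<omega> * (B t \<omega> - B s \<omega>))"
proof -
  have s: "0 \<le> s" using \<eta> by (simp add: weight_def)
  show m: "(\<lambda>\<omega>. \<eta> \<omega> * (B t \<omega> - B s \<omega>)) \<in> borel_measurable (F t)"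
    using s st by (intro borel_measurable_times borel_measurable_diff B_F weight_measurable[OF \<eta> st]) auto
  show "(\<lambda>\<omega>. \<eta> \<omega> * (B t \<omega> - B s \<omega>)) \<in> borel_measurable M"
    using s st by (intro measurable_F_M[OF _ m]) auto
  have "weight s (\<lambda>\<omega>. \<eta> \<omega> * \<eta> \<omega>)" by (rule weight_mult[OF \<eta> \<eta>])
  from increment_product(3)[OF s st weight_measurable[OF this order_refl] integrable_weight[OF this]]
  show "integrable M (\<lambda>\<omega>. (\<eta> \<omega> * (B t \<omega> - B s \<omega>))\<^sup>2)" by (simp add: power2_eq_square mult_ac)
  show "integrable M (\<lambda>\<omega>. \<eta> \<omega> * (B t \<omega> - B s \<omega>))"
    by (rule increment_product(1)[OF s st weight_measurable[OF \<eta> order_refl] integrable_weight[OF \<eta>]])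
qed

text \<open>The covariance of two Brownian increments is the length of the overlap of their
  intervals. When the first interval starts first, both weights are known at the start c of the
  second one, so only the square of the increment over the overlap contributes.\<close>

lemma weighted_increments_product_ordered:
  assumes \<eta>: "weight a \<eta>" and \<eta>': "weight c \<eta>'" and ab: "a \<le> b" and cd: "c \<le> d" and ac: "a \<le> c"
  shows "(\<integral>\<omega>. (\<eta> \<omega> * (B b \<omega> - B a \<omega>)) * (\<eta>' \<omega> * (B d \<omega> - B c \<omega>)) \<partial>M) =
    (\<integral>\<omega>. \<eta> \<omega> * \<eta>' \<omega> \<partial>M) * max 0 (min b d - max a c)"
proof -
  have a0: "0 \<le> a" and c0: "0 \<le> c" using \<eta> \<eta>' by (auto simp: weight_def)
  have w: "weight c (\<lambda>\<omega>. \<eta> \<omega> * \<eta>' \<omega>)" by (intro weight_mult weight_mono[OF \<eta> ac] \<eta>')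
  have past: "(\<lambda>\<omega>. \<eta>' \<omega> * (\<eta> \<omega> * (B u \<omega> - B a \<omega>))) \<in> borel_measurable (F c)"
    "integrable M (\<lambda>\<omega>. \<eta>' \<omega> * (\<eta> \<omega> * (B u \<omega> - B a \<omega>)))" if "a \<le> u" "u \<le> c" for u
  proof -
    show "(\<lambda>\<omega>. \<eta>' \<omega> * (\<eta> \<omega> * (B u \<omega> - B a \<omega>))) \<in> borel_measurable (F c)"
      using a0 that by (intro borel_measurable_times borel_measurable_diff B_F weight_measurable[OF \<eta> ac]
        weight_measurable[OF \<eta>' order_refl]) auto
    show "integrable M (\<lambda>\<omega>. \<eta>' \<omega> * (\<eta> \<omega> * (B u \<omega> - B a \<omega>)))"
      by (rule integrable_weight_mult[OF \<eta>' weighted_increment(4)[OF \<eta> that(1)]])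
  qed
  show ?thesis
  proof (cases "b \<le> c")
    case True
    have "(\<integral>\<omega>. (\<eta> \<omega> * (B b \<omega> - B a \<omega>)) * (\<eta>' \<omega> * (B d \<omega> - B c \<omega>)) \<partial>M) =
      (\<integral>\<omega>. (\<eta>' \<omega> * (\<eta> \<omega> * (B b \<omega> - B a \<omega>))) * (B d \<omega> - B c \<omega>) \<partial>M)"
      by (simp add: mult_ac)
    also have "\<dots> = 0"
      by (rule increment_product(2)[OF c0 cd past[OF ab True]])
    finally show ?thesis using True by (auto simp: max_def min_def)
  next
    case False
    define e where "e = min b d"
    have e: "c \<le> e" "e \<le> b" "e \<le> d" "e = b \<or> e = d" using False cd by (auto simp: e_def min_def)
    have e0: "0 \<le> e" using c0 e by simp
    note W = increment_product[OF c0 e(1) weight_measurable[OF w order_refl] integrable_weight[OF w]]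
    note we = weighted_increment[OF w e(1)]
    let ?I = "\<lambda>u v \<omega>. B v \<omega> - B u \<omega>"
    let ?w = "\<lambda>\<omega>. \<eta> \<omega> * \<eta>' \<omega>"
    \<comment> \<open>Both increments are cut at c and at the end e of the overlap. One of the two
      remainders after e is empty, so their product drops out; the three mixed terms are known
      factors times later increments and have mean zero.\<close>
    have eq: "(\<eta> \<omega> * (B b \<omega> - B a \<omega>)) * (\<eta>' \<omega> * (B d \<omega> - B c \<omega>)) =
       (\<eta>' \<omega> * (\<eta> \<omega> * (B c \<omega> - B a \<omega>))) * ?I c d \<omega> + ?w \<omega> * (?I c e \<omega>)\<^sup>2
        + (?w \<omega> * ?I c e \<omega>) * ?I e b \<omega> + (?w \<omega> * ?I c e \<omega>) * ?I e d \<omega>" for \<omega>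
    proof -
      have "?I e b \<omega> * ?I e d \<omega> = 0" using e(4) by auto
      then have "?w \<omega> * (?I e b \<omega> * ?I e d \<omega>) = 0" by simp
      then show ?thesis by (simp add: algebra_simps power2_eq_square)
    qed
    note P = increment_product[OF c0 cd past[OF ac order_refl]]
    note Q = increment_product[OF e0 e(2) we(1) we(4)]
    note R = increment_product[OF e0 e(3) we(1) we(4)]
    have "(\<integral>\<omega>. (\<eta> \<omega> * (B b \<omega> - B a \<omega>)) * (\<eta>' \<omega> * (B d \<omega> - B c \<omega>)) \<partial>M) = (\<integral>\<omega>. ?w \<omega> \<partial>M) * (e - c)"
      unfolding eq using P(1) P(2) W(3) W(4) Q(1) Q(2) R(1) R(2) by simp
    then show ?thesis using ac e(1) by (simp add: e_def max_def)
  qed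
qed

lemma weighted_increments_product:
  assumes \<eta>: "weight a \<eta>" and \<eta>': "weight c \<eta>'" and ab: "a \<le> b" and cd: "c \<le> d"
  shows "integrable M (\<lambda>\<omega>. (\<eta> \<omega> * (B b \<omega> - B a \<omega>)) * (\<eta>' \<omega> * (B d \<omega> - B c \<omega>)))"
    "(\<integral>\<omega>. (\<eta> \<omega> * (B b \<omega> - B a \<omega>)) * (\<eta>' \<omega> * (B d \<omega> - B c \<omega>)) \<partial>M) =
    (\<integral>\<omega>. \<eta> \<omega> * \<eta>' \<omega> \<partial>M) * max 0 (min b d - max a c)"
proof -
  show "integrable M (\<lambda>\<omega>. (\<eta> \<omega> * (B b \<omega> - B a \<omega>)) * (\<eta>' \<omega> * (B d \<omega> - B c \<omega>)))"
    by (intro integrable_mult_square weighted_increment[OF \<eta> ab] weighted_increment[OF \<eta>' cd])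
  show "(\<integral>\<omega>. (\<eta> \<omega> * (B b \<omega> - B a \<omega>)) * (\<eta>' \<omega> * (B d \<omega> - B c \<omega>)) \<partial>M) =
    (\<integral>\<omega>. \<eta> \<omega> * \<eta>' \<omega> \<partial>M) * max 0 (min b d - max a c)"
  proof (cases "a \<le> c")
    case True then show ?thesis by (rule weighted_increments_product_ordered[OF assms])
  next
    case False
    then show ?thesis
      using weighted_increments_product_ordered[OF \<eta>' \<eta> cd ab]
      by (simp add: mult.commute min.commute max.commute)
  qed
qed

text \<open>The intervals are indexed by an arbitrary finite set and may overlap. A difference of
  two simple processes over different partitions is then again of this form, over the disjoint union
  of the index sets, and no common refinement is needed.\<close>

definition elementary_integral ::
  "'j set \<Rightarrow> ('j \<Rightarrow> real) \<Rightarrow> ('j \<Rightarrow> real) \<Rightarrow> ('j \<Rightarrow> 'a \<Rightarrow> real) \<Rightarrow> real \<Rightarrow> 'a \<Rightarrow> real" where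
  "elementary_integral J a b \<eta> t \<omega> = (\<Sum>j\<in>J. \<eta> j \<omega> * (B (min t (b j)) \<omega> - B (min t (a j)) \<omega>))"

definition elementary_process ::
  "'j set \<Rightarrow> ('j \<Rightarrow> real) \<Rightarrow> ('j \<Rightarrow> real) \<Rightarrow> ('j \<Rightarrow> 'a \<Rightarrow> real) \<Rightarrow> real \<Rightarrow> 'a \<Rightarrow> real" where
  "elementary_process J a b \<eta> t \<omega> = (\<Sum>j\<in>J. \<eta> j \<omega> * indicator {a j<..b j} t)"

text \<open>Expanding the square gives a double sum in which each pair of intervals contributes the
  mean of the product of its weights times the length of their overlap before t. Integrating the
  squared process over time produces the same double sum, path by path.\<close>

lemma elementary_isometry:
  assumes J: "finite J" and w: "\<And>j. j \<in> J \<Longrightarrow> weight (a j) (\<eta> j)" and ab: "\<And>j. j \<in> J \<Longrightarrow> a j \<le> b j"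
    and t: "0 \<le> t"
  shows "integrable M (\<lambda>\<omega>. (elementary_integral J a b \<eta> t \<omega>)\<^sup>2)"
    "(\<integral>\<^sup>+\<omega>. ennreal ((elementary_integral J a b \<eta> t \<omega>)\<^sup>2) \<partial>M) =
     (\<integral>\<^sup>+\<omega>. (\<integral>\<^sup>+s\<in>{0..t}. ennreal ((elementary_process J a b \<eta> s \<omega>)\<^sup>2) \<partial>lborel) \<partial>M)"
proof -
  define b' where "b' j = max (a j) (min t (b j))" for j
  define len where "len i j = max 0 (min (b' i) (b' j) - max (a i) (a j))" for i j
  have ab': "a j \<le> b' j" for j by (simp add: b'_def)
  have sq: "(elementary_integral J a b \<eta> t \<omega>)\<^sup>2 =
    (\<Sum>i\<in>J. \<Sum>j\<in>J. (\<eta> i \<omega> * (B (b' i) \<omega> - B (a i) \<omega>)) * (\<eta> j \<omega> * (B (b' j) \<omega> - B (a j) \<omega>)))" for \<omega>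
  proof -
    have "elementary_integral J a b \<eta> t \<omega> = (\<Sum>j\<in>J. \<eta> j \<omega> * (B (b' j) \<omega> - B (a j) \<omega>))"
      unfolding elementary_integral_def b'_def
      by (intro sum.cong refl) (use ab stopped_increment[of _ _ "\<lambda>s. B s \<omega>"] in auto)
    then show ?thesis by (simp add: power2_eq_square sum_product)
  qed
  note prod = weighted_increments_product[OF w w ab' ab']
  show i: "integrable M (\<lambda>\<omega>. (elementary_integral J a b \<eta> t \<omega>)\<^sup>2)"
    unfolding sq by (intro Bochner_Integration.integrable_sum prod)
  have e: "(\<integral>\<omega>. (elementary_integral J a b \<eta> t \<omega>)\<^sup>2 \<partial>M) = (\<Sum>i\<in>J. \<Sum>j\<in>J. (\<integral>\<omega>. \<eta> i \<omega> * \<eta> j \<omega> \<partial>M) * len i j)"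
    unfolding sq by (subst integral_double_sum(2)) (auto intro!: sum.cong simp: prod len_def)
  have wi: "integrable M (\<lambda>\<omega>. \<eta> i \<omega> * \<eta> j \<omega>)" if "i \<in> J" "j \<in> J" for i j
    by (rule integrable_weight_mult[OF w[OF that(1)] integrable_weight[OF w[OF that(2)]]])
  define Q where "Q \<omega> = (\<Sum>i\<in>J. \<Sum>j\<in>J. (\<eta> i \<omega> * \<eta> j \<omega>) * len i j)" for \<omega>
  have Qi: "integrable M Q" unfolding Q_def by (intro Bochner_Integration.integrable_sum integrable_mult_left wi)
  have Qe: "(\<integral>\<omega>. Q \<omega> \<partial>M) = (\<integral>\<omega>. (elementary_integral J a b \<eta> t \<omega>)\<^sup>2 \<partial>M)"
    unfolding e Q_def by (subst integral_double_sum(2)) (auto intro!: sum.cong integrable_mult_left wi)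
  have inner: "0 \<le> Q \<omega> \<and> (\<integral>\<^sup>+s\<in>{0..t}. ennreal ((elementary_process J a b \<eta> s \<omega>)\<^sup>2) \<partial>lborel) = ennreal (Q \<omega>)" for \<omega>
  proof -
    define A where "A i j = {max (a i) (a j)<..min (b' i) (b' j)}" for i j
    let ?f = "\<lambda>s. (elementary_process J a b \<eta> s \<omega>)\<^sup>2 * indicator {0..t} s"
    \<comment> \<open>Weights live at non-negative times, so each interval cut at t lies in
      \<open>[0,t]\<close>; if \<open>a j\<close> exceeds t, then \<open>b' j = a j\<close> and the
      interval is empty.\<close>
    have ind: "indicator {a i<..b i} s * indicator {a j<..b j} s * indicator {0..t} s = (indicator (A i j) s :: real)"
      if "i \<in> J" "j \<in> J" for i j s
      using w[OF that(1)] by (auto simp: A_def b'_def weight_def indicator_def)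
    have f: "?f s = (\<Sum>i\<in>J. \<Sum>j\<in>J. (\<eta> i \<omega> * \<eta> j \<omega>) * indicator (A i j) s)" for s
    proof -
      have "?f s = (\<Sum>i\<in>J. \<Sum>j\<in>J. (\<eta> i \<omega> * \<eta> j \<omega>) * (indicator {a i<..b i} s * indicator {a j<..b j} s * indicator {0..t} s))"
        unfolding elementary_process_def power2_eq_square sum_distrib_right sum_distrib_left
        by (intro sum.cong refl) (simp add: mult_ac)
      also have "\<dots> = (\<Sum>i\<in>J. \<Sum>j\<in>J. (\<eta> i \<omega> * \<eta> j \<omega>) * indicator (A i j) s)"
        by (intro sum.cong refl arg_cong2[where f="(*)"] ind)
      finally show ?thesis .
    qed
    have Ai: "integrable lborel (indicator (A i j) :: real \<Rightarrow> real)" for i j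
      by (cases "max (a i) (a j) \<le> min (b' i) (b' j)") (auto simp: A_def intro!: integrable_real_indicator)
    have Am: "measure lborel (A i j) = len i j" for i j
      by (auto simp: A_def len_def max_def)
    have fi: "integrable lborel ?f"
      unfolding f by (intro Bochner_Integration.integrable_sum integrable_mult_right Ai)
    have fe: "(\<integral>s. ?f s \<partial>lborel) = Q \<omega>"
      unfolding f Q_def
      by (subst integral_double_sum(2)) (auto intro!: sum.cong integrable_mult_right Ai simp: Am)
    have "(\<integral>\<^sup>+s\<in>{0..t}. ennreal ((elementary_process J a b \<eta> s \<omega>)\<^sup>2) \<partial>lborel) = (\<integral>\<^sup>+s. ennreal (?f s) \<partial>lborel)"
      by (intro nn_integral_cong) (auto simp: indicator_def)
    also have "\<dots> = ennreal (Q \<omega>)"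
      using fi by (subst nn_integral_eq_integral) (auto simp: fe)
    moreover have "0 \<le> Q \<omega>" unfolding fe[symmetric] by (intro integral_nonneg_AE) auto
    ultimately show ?thesis by simp
  qed
  have "(\<integral>\<^sup>+\<omega>. ennreal ((elementary_integral J a b \<eta> t \<omega>)\<^sup>2) \<partial>M) = ennreal (\<integral>\<omega>. Q \<omega> \<partial>M)"
    by (simp add: nn_integral_square[OF i] Qe)
  also have "\<dots> = (\<integral>\<^sup>+\<omega>. ennreal (Q \<omega>) \<partial>M)"
    using Qi inner by (subst nn_integral_eq_integral) auto
  finally show "(\<integral>\<^sup>+\<omega>. ennreal ((elementary_integral J a b \<eta> t \<omega>)\<^sup>2) \<partial>M) =
     (\<integral>\<^sup>+\<omega>. (\<integral>\<^sup>+s\<in>{0..t}. ennreal ((elementary_process J a b \<eta> s \<omega>)\<^sup>2) \<partial>lborel) \<partial>M)"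
    using inner by simp
qed

lemma simple_integrand_weight:
  assumes "simple_integrand M F n \<tau> \<eta>" "i < n"
  shows "weight (\<tau> i) (\<eta> i)" "\<tau> i \<le> \<tau> (Suc i)"
proof -
  have "0 \<le> \<tau> j" if "j \<le> n" for j
    using that assms by (induction j) (auto simp: simple_integrand_def intro: order_trans)
  then show "weight (\<tau> i) (\<eta> i)" "\<tau> i \<le> \<tau> (Suc i)"
    using assms by (auto simp: weight_def simple_integrand_def)
qed

lemma simple_ito_diff_isometry:
  assumes \<eta>: "simple_integrand M F n \<tau> \<eta>" and \<eta>': "simple_integrand M F n' \<tau>' \<eta>'" and t: "0 \<le> t"
  shows "(\<integral>\<^sup>+\<omega>. ennreal ((simple_ito_integral B n \<tau> \<eta> t \<omega> - simple_ito_integral B n' \<tau>' \<eta>' t \<omega>)\<^sup>2) \<partial>M) =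
     (\<integral>\<^sup>+\<omega>. (\<integral>\<^sup>+s\<in>{0..t}. ennreal ((simple_process n \<tau> \<eta> s \<omega> - simple_process n' \<tau>' \<eta>' s \<omega>)\<^sup>2) \<partial>lborel) \<partial>M)"
proof -
  let ?J = "{..<n} <+> {..<n'}" and ?a = "case_sum \<tau> \<tau>'"
    and ?b = "case_sum (\<lambda>i. \<tau> (Suc i)) (\<lambda>i. \<tau>' (Suc i))" and ?\<eta> = "case_sum \<eta> (\<lambda>i \<omega>. - \<eta>' i \<omega>)"
  have "elementary_integral ?J ?a ?b ?\<eta> t \<omega> = simple_ito_integral B n \<tau> \<eta> t \<omega> - simple_ito_integral B n' \<tau>' \<eta>' t \<omega>" for \<omega>
    by (simp add: elementary_integral_def simple_ito_integral_def sum.Plus sum_negf)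
  moreover have "elementary_process ?J ?a ?b ?\<eta> s \<omega> = simple_process n \<tau> \<eta> s \<omega> - simple_process n' \<tau>' \<eta>' s \<omega>" for s \<omega>
    unfolding elementary_process_def simple_process_def
    by (subst sum.Plus) (simp_all add: sum_negf[symmetric] del: sum_mult_indicator)
  moreover have "(\<integral>\<^sup>+\<omega>. ennreal ((elementary_integral ?J ?a ?b ?\<eta> t \<omega>)\<^sup>2) \<partial>M) =
     (\<integral>\<^sup>+\<omega>. (\<integral>\<^sup>+s\<in>{0..t}. ennreal ((elementary_process ?J ?a ?b ?\<eta> s \<omega>)\<^sup>2) \<partial>lborel) \<partial>M)"
    using simple_integrand_weight[OF \<eta>] simple_integrand_weight(2)[OF \<eta>']
      weight_uminus[OF simple_integrand_weight(1)[OF \<eta>']] t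
    by (intro elementary_isometry) auto
  ultimately show ?thesis by simp
qed

text \<open>Each summand contributes a stretch of one partition interval between s and t. Multiplied
  by the test variable it is still a known factor times a later Brownian increment.\<close>

lemma simple_ito_martingale:
  assumes \<eta>: "simple_integrand M F n \<tau> \<eta>"
  shows "sq_martingale (simple_ito_integral B n \<tau> \<eta>)"
  unfolding sq_martingale_def
proof (intro conjI allI impI)
  note w = simple_integrand_weight[OF \<eta>]
  show "adapted F (simple_ito_integral B n \<tau> \<eta>)"
    unfolding adapted_def
  proof (intro allI impI)
    fix t :: real assume t: "0 \<le> t"
    have "(\<lambda>\<omega>. \<eta> i \<omega> * (B (min t (\<tau> (Suc i))) \<omega> - B (min t (\<tau> i)) \<omega>)) \<in> borel_measurable (F t)"
      if i: "i < n" for i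
    proof (cases "\<tau> i \<le> t")
      case True
      then show ?thesis using w[OF i] t
        by (intro borel_measurable_times borel_measurable_diff B_F weight_measurable[OF w(1)[OF i]])
          (auto simp: weight_def)
    next
      \<comment> \<open>Here the weight is not known at time t, but the increment it multiplies is
        zero.\<close>
      case False
      then have "min t (\<tau> (Suc i)) = t" "min t (\<tau> i) = t" using w(2)[OF i] by auto
      then show ?thesis by simp
    qed
    then show "simple_ito_integral B n \<tau> \<eta> t \<in> borel_measurable (F t)"
      unfolding simple_ito_integral_def by (intro borel_measurable_sum) auto
  qed
  show "integrable M (\<lambda>\<omega>. (simple_ito_integral B n \<tau> \<eta> t \<omega>)\<^sup>2)" if "0 \<le> t" for t
    using elementary_isometry(1)[of "{..<n}" \<tau> \<eta> "\<lambda>i. \<tau> (Suc i)" t] w that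
    by (simp add: elementary_integral_def simple_ito_integral_def)
  fix s t :: real and Z :: "'a \<Rightarrow> real"
  assume st: "0 \<le> s" "s \<le> t" and Z: "Z \<in> borel_measurable (F s)" "integrable M (\<lambda>\<omega>. (Z \<omega>)\<^sup>2)"
  have Zi: "integrable M Z"
    by (rule square_integrable_imp_integrable) (use Z st in \<open>auto intro: measurable_F_M\<close>)
  have tm: "integrable M (\<lambda>\<omega>. Z \<omega> * (\<eta> i \<omega> * (B (v i) \<omega> - B (u i) \<omega>))) \<and>
      (\<integral>\<omega>. Z \<omega> * (\<eta> i \<omega> * (B (v i) \<omega> - B (u i) \<omega>)) \<partial>M) = 0"
    if i: "i < n" and u: "u i = max (\<tau> i) (min s (\<tau> (Suc i)))" and v: "v i = max (\<tau> i) (min t (\<tau> (Suc i)))"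
    for i u v
  proof (cases "u i = v i")
    case False
    \<comment> \<open>A stretch that does not collapse begins no earlier than s, so both the test
      variable and the weight are known at its left end.\<close>
    then have suc: "s \<le> u i" using u v st w(2)[OF i] by (auto simp: min_def max_def split: if_splits)
    have \<tau>u: "\<tau> i \<le> u i" and uv: "u i \<le> v i" using u v st by (auto simp: min_def max_def)
    have u0: "0 \<le> u i" using suc st by simp
    have m: "(\<lambda>\<omega>. \<eta> i \<omega> * Z \<omega>) \<in> borel_measurable (F (u i))"
      by (intro borel_measurable_times weight_measurable[OF w(1)[OF i] \<tau>u] measurable_F_mono[OF st(1) suc Z(1)])
    have "integrable M (\<lambda>\<omega>. \<eta> i \<omega> * Z \<omega>)" by (rule integrable_weight_mult[OF w(1)[OF i] Zi])
    from increment_product(1,2)[OF u0 uv m this] show ?thesis by (simp add: mult_ac)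
  qed simp
  define u where "u i = max (\<tau> i) (min s (\<tau> (Suc i)))" for i
  define v where "v i = max (\<tau> i) (min t (\<tau> (Suc i)))" for i
  have "Z \<omega> * (simple_ito_integral B n \<tau> \<eta> t \<omega> - simple_ito_integral B n \<tau> \<eta> s \<omega>) =
     (\<Sum>i<n. Z \<omega> * (\<eta> i \<omega> * (B (v i) \<omega> - B (u i) \<omega>)))" for \<omega>
  proof -
    have "simple_ito_integral B n \<tau> \<eta> r \<omega> = (\<Sum>i<n. \<eta> i \<omega> * (B (max (\<tau> i) (min r (\<tau> (Suc i)))) \<omega> - B (\<tau> i) \<omega>))" for r
      unfolding simple_ito_integral_def
      by (intro sum.cong refl) (use w stopped_increment[of _ _ "\<lambda>s. B s \<omega>"] in auto)
    then show ?thesis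
      by (simp add: u_def v_def sum_subtractf[symmetric] sum_distrib_left right_diff_distrib)
  qed
  then show "(\<integral>\<omega>. Z \<omega> * (simple_ito_integral B n \<tau> \<eta> t \<omega> - simple_ito_integral B n \<tau> \<eta> s \<omega>) \<partial>M) = 0"
    using tm[of _ u v] by (simp add: u_def v_def Bochner_Integration.integral_sum)
qed

end

section \<open>Progressive measurability\<close>

text \<open>Restricting the measure, rather than inserting an indicator, gives a finite measure for
  which product measurability and Fubini apply to processes known only up to time t.\<close>

abbreviation lborel_upto :: "real \<Rightarrow> real measure" where
  "lborel_upto t \<equiv> restrict_space lborel {0..t}"

lemma nn_integral_lborel_upto:
  "(\<integral>\<^sup>+s\<in>{0..t}. f s \<partial>lborel) = (\<integral>\<^sup>+s. f s \<partial>lborel_upto t)"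
  by (simp add: nn_integral_restrict_space)

lemma finite_lborel_upto: "finite_measure (lborel_upto t)"
  by (rule finite_measureI)
     (cases "0 \<le> t"; simp add: emeasure_restrict_space space_restrict_space)

lemma sigma_finite_lborel_upto: "sigma_finite_measure (lborel_upto t)"
  using finite_lborel_upto by (rule finite_measure.axioms)

lemma nn_integral_const_upto:
  "0 \<le> t \<Longrightarrow> (\<integral>\<^sup>+s\<in>{0..t}. c \<partial>lborel) = c * ennreal t"
  by (simp add: nn_integral_cmult_indicator)

lemma floor_grid_tendsto:
  fixes t :: real
  assumes "0 \<le> t"
  shows "(\<lambda>n. real (nat \<lfloor>real (Suc n) * t\<rfloor>) / real (Suc n)) \<longlonglongrightarrow> t"
proof -
  have "\<bar>real (nat \<lfloor>real (Suc n) * t\<rfloor>) / real (Suc n) - t\<bar> \<le> inverse (real (Suc n))" for n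
  proof -
    define K where "K = real (Suc n)"
    have K: "0 < K" by (simp add: K_def)
    have "\<bar>real (nat \<lfloor>K * t\<rfloor>) - K * t\<bar> \<le> 1"
      using assms K by (simp add: of_nat_nat) linarith
    then have "\<bar>real (nat \<lfloor>K * t\<rfloor>) - K * t\<bar> / K \<le> 1 / K"
      using K by (intro divide_right_mono) auto
    moreover have "real (nat \<lfloor>K * t\<rfloor>) / K - t = (real (nat \<lfloor>K * t\<rfloor>) - K * t) / K"
      using K by (simp add: field_simps)
    ultimately show ?thesis using K unfolding K_def[symmetric] by (simp add: inverse_eq_divide)
  qed
  then have "(\<lambda>n. real (nat \<lfloor>real (Suc n) * t\<rfloor>) / real (Suc n) - t) \<longlonglongrightarrow> 0"
    by - (rule Lim_null_comparison[OF _ LIMSEQ_inverse_real_of_nat], auto)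
  then show ?thesis by (simp add: LIM_zero_iff)
qed

text \<open>Freezing time at the grid point below it leaves countably many variables, selected by a
  measurable index; continuity of paths gives the limit. With \<open>N = F T\<close> this is
  progressive measurability.\<close>

lemma continuous_process_joint_measurable:
  assumes c: "continuous_process M X" and T: "0 \<le> T" and N: "space N = space M"
    and X: "\<And>t. 0 \<le> t \<Longrightarrow> t \<le> T \<Longrightarrow> X t \<in> borel_measurable N"
  shows "(\<lambda>(t, \<omega>). X t \<omega>) \<in> borel_measurable (restrict_space borel {0..T} \<Otimes>\<^sub>M N)"
proof -
  let ?P = "restrict_space borel {0..T} \<Otimes>\<^sub>M N"
  define g where "g n x = nat \<lfloor>real (Suc n) * fst x\<rfloor>" for n :: nat and x :: "real \<times> 'a"
  \<comment> \<open>Capping at T keeps \<open>f n i\<close> measurable with respect to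
    \<open>N\<close> for every index, including grid points beyond T.\<close>
  define f where "f n i x = X (min T (real i / real (Suc n))) (snd x)" for n i :: nat and x :: "real \<times> 'a"
  show ?thesis
  proof (rule borel_measurable_LIMSEQ_real)
  fix n
  have "(\<lambda>x. f n i x) \<in> borel_measurable ?P" for i
    unfolding f_def by (rule measurable_compose[OF measurable_snd]) (rule X, use T in auto)
  moreover have "g n \<in> measurable ?P (count_space UNIV)"
    unfolding g_def by (intro measurable_compose[OF measurable_fst] measurable_restrict_space1) measurable
  ultimately show "(\<lambda>x. f n (g n x) x) \<in> borel_measurable ?P"
    by (rule measurable_compose_countable)
next
  fix x assume "x \<in> space (restrict_space borel {0..T} \<Otimes>\<^sub>M N)"
  then obtain t \<omega> where x: "x = (t, \<omega>)" "0 \<le> t" "t \<le> T" "\<omega> \<in> space M"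
    using N by (cases x) (auto simp: space_pair_measure space_restrict_space)
  have c': "continuous_on {0..} (\<lambda>t. X t \<omega>)" using c x by (auto simp: continuous_process_def)
  have "(\<lambda>n. min T (real (nat \<lfloor>real (Suc n) * t\<rfloor>) / real (Suc n))) \<longlonglongrightarrow> min T t"
    by (intro tendsto_min tendsto_const floor_grid_tendsto x)
  then have lim: "(\<lambda>n. min T (real (nat \<lfloor>real (Suc n) * t\<rfloor>) / real (Suc n))) \<longlonglongrightarrow> t"
    using x by (simp only: min_absorb2)
  have "(\<lambda>n. X (min T (real (nat \<lfloor>real (Suc n) * t\<rfloor>) / real (Suc n))) \<omega>) \<longlonglongrightarrow> X t \<omega>"
    by (rule continuous_on_tendsto_compose[OF c' lim]) (use T x in auto)
  then show "(\<lambda>n. f n (g n x) x) \<longlonglongrightarrow> (case x of (t, \<omega>) \<Rightarrow> X t \<omega>)"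
    by (simp add: x f_def g_def)
  qed
qed

context complete_filtered_prob_space
begin

text \<open>The coordinates are in the opposite order to \<open>ito_integrand\<close>, because the
  distances below integrate over time first.\<close>

definition time_measurable :: "real \<Rightarrow> (real \<Rightarrow> 'a \<Rightarrow> real) \<Rightarrow> bool" where
  "time_measurable t H \<longleftrightarrow> (\<lambda>(\<omega>, s). H s \<omega>) \<in> borel_measurable (M \<Otimes>\<^sub>M lborel_upto t)"

lemma time_measurable_progressive:
  assumes t: "0 \<le> t"
    and H: "(\<lambda>(s, \<omega>). H s \<omega>) \<in> borel_measurable (restrict_space borel {0..t} \<Otimes>\<^sub>M F t)"
  shows "time_measurable t H"
proof -
  have 1: "(\<lambda>s. s) \<in> measurable (lborel_upto t) (restrict_space borel {0..t})"
    by (rule measurable_ident_sets) (rule sets_restrict_space_cong, simp)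
  have 2: "(\<lambda>\<omega>. \<omega>) \<in> measurable M (F t)"
    using space_F[OF t] sets_F_M[OF t] sets.sets_into_space[of _ "F t"]
    by (intro measurableI) (auto simp: vimage_def Int_def inf_absorb1 dest!: subsetD)
  have "(\<lambda>x. (snd x, fst x)) \<in> measurable (M \<Otimes>\<^sub>M lborel_upto t) (restrict_space borel {0..t} \<Otimes>\<^sub>M F t)"
    by (intro measurable_Pair measurable_compose[OF measurable_snd 1] measurable_compose[OF measurable_fst 2])
  from measurable_compose[OF this H] show ?thesis
    by (simp add: time_measurable_def split_beta')
qed

lemma time_measurable_continuous:
  assumes "adapted F X" "continuous_process M X" "0 \<le> t"
  shows "time_measurable t X"
  by (rule time_measurable_progressive[OF assms(3)], rule continuous_process_joint_measurable[OF assms(2,3)])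
     (use assms space_F adaptedD in auto)

lemma time_measurable_simple:
  assumes "simple_integrand M F n \<tau> \<eta>"
  shows "time_measurable t (simple_process n \<tau> \<eta>)"
proof -
  have \<tau>: "0 \<le> \<tau> j" if "j \<le> n" for j
    using that assms by (induction j) (auto simp: simple_integrand_def intro: order_trans)
  have m: "\<eta> i \<in> borel_measurable M" if "i < n" for i
    using assms that by (intro measurable_F_M[OF \<tau>[of i]]) (auto simp: simple_integrand_def)
  have ind: "(\<lambda>x. indicator {a<..b} (snd x) :: real) \<in> borel_measurable (M \<Otimes>\<^sub>M lborel_upto t)" for a b
    by (rule measurable_compose[OF measurable_snd]) (rule measurable_restrict_space1, simp)
  show ?thesis
    unfolding time_measurable_def simple_process_def split_beta'
    by (intro borel_measurable_sum borel_measurable_times ind measurable_compose[OF measurable_fst m]) auto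
qed

definition sq_dist :: "real \<Rightarrow> (real \<Rightarrow> 'a \<Rightarrow> real) \<Rightarrow> (real \<Rightarrow> 'a \<Rightarrow> real) \<Rightarrow> ennreal" where
  "sq_dist t H H' = (\<integral>\<^sup>+\<omega>. (\<integral>\<^sup>+s\<in>{0..t}. ennreal ((H s \<omega> - H' s \<omega>)\<^sup>2) \<partial>lborel) \<partial>M)"

lemma sq_dist_commute: "sq_dist t H H' = sq_dist t H' H"
  by (simp add: sq_dist_def power2_commute)

lemma sq_dist_mono: "t \<le> t' \<Longrightarrow> sq_dist t H H' \<le> sq_dist t' H H'"
  unfolding sq_dist_def by (intro nn_integral_mono) (auto simp: indicator_def)

lemma time_measurable_path:
  assumes "time_measurable t H" "\<omega> \<in> space M"
  shows "(\<lambda>s. H s \<omega>) \<in> borel_measurable (lborel_upto t)"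
  using measurable_Pair2[OF assms(1)[unfolded time_measurable_def] assms(2)] by simp

lemma time_measurable_inner:
  assumes "time_measurable t H" "time_measurable t H'"
  shows "(\<lambda>x. ennreal ((H (snd x) (fst x) - H' (snd x) (fst x))\<^sup>2)) \<in> borel_measurable (M \<Otimes>\<^sub>M lborel_upto t)"
    "(\<lambda>\<omega>. \<integral>\<^sup>+s. ennreal ((H s \<omega> - H' s \<omega>)\<^sup>2) \<partial>lborel_upto t) \<in> borel_measurable M"
proof -
  have [measurable]: "(\<lambda>x. H (snd x) (fst x)) \<in> borel_measurable (M \<Otimes>\<^sub>M lborel_upto t)"
     "(\<lambda>x. H' (snd x) (fst x)) \<in> borel_measurable (M \<Otimes>\<^sub>M lborel_upto t)"
    using assms by (auto simp: time_measurable_def split_beta')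
  show m: "(\<lambda>x. ennreal ((H (snd x) (fst x) - H' (snd x) (fst x))\<^sup>2)) \<in> borel_measurable (M \<Otimes>\<^sub>M lborel_upto t)"
    by measurable
  show "(\<lambda>\<omega>. \<integral>\<^sup>+s. ennreal ((H s \<omega> - H' s \<omega>)\<^sup>2) \<partial>lborel_upto t) \<in> borel_measurable M"
    using sigma_finite_measure.borel_measurable_nn_integral_fst[OF sigma_finite_lborel_upto m] by simp
qed

lemma sq_dist_triangle:
  assumes H: "time_measurable t H" "time_measurable t H'" "time_measurable t H''"
  shows "sq_dist t H H'' \<le> 2 * sq_dist t H H' + 2 * sq_dist t H' H''"
proof -
  note m = time_measurable_inner[OF H(1,2)] time_measurable_inner[OF H(2,3)]
  have "sq_dist t H H'' \<le> (\<integral>\<^sup>+\<omega>. (\<integral>\<^sup>+s. 2 * ennreal ((H s \<omega> - H' s \<omega>)\<^sup>2)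
      + 2 * ennreal ((H' s \<omega> - H'' s \<omega>)\<^sup>2) \<partial>lborel_upto t) \<partial>M)"
    unfolding sq_dist_def nn_integral_lborel_upto
  proof (intro nn_integral_mono)
    fix \<omega> s show "ennreal ((H s \<omega> - H'' s \<omega>)\<^sup>2)
      \<le> 2 * ennreal ((H s \<omega> - H' s \<omega>)\<^sup>2) + 2 * ennreal ((H' s \<omega> - H'' s \<omega>)\<^sup>2)"
      using ennreal_square_add_le[of "H s \<omega> - H' s \<omega>" "H' s \<omega> - H'' s \<omega>"] by simp
  qed
  also have "\<dots> = (\<integral>\<^sup>+\<omega>. 2 * (\<integral>\<^sup>+s. ennreal ((H s \<omega> - H' s \<omega>)\<^sup>2) \<partial>lborel_upto t)
      + 2 * (\<integral>\<^sup>+s. ennreal ((H' s \<omega> - H'' s \<omega>)\<^sup>2) \<partial>lborel_upto t) \<partial>M)"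
  proof (rule nn_integral_cong)
    fix \<omega> assume w: "\<omega> \<in> space M"
    note [measurable] = time_measurable_path[OF H(1) w] time_measurable_path[OF H(2) w] time_measurable_path[OF H(3) w]
    show "(\<integral>\<^sup>+s. 2 * ennreal ((H s \<omega> - H' s \<omega>)\<^sup>2) + 2 * ennreal ((H' s \<omega> - H'' s \<omega>)\<^sup>2) \<partial>lborel_upto t)
      = 2 * (\<integral>\<^sup>+s. ennreal ((H s \<omega> - H' s \<omega>)\<^sup>2) \<partial>lborel_upto t)
      + 2 * (\<integral>\<^sup>+s. ennreal ((H' s \<omega> - H'' s \<omega>)\<^sup>2) \<partial>lborel_upto t)"
      by (simp add: nn_integral_add nn_integral_cmult)
  qed
  also have "\<dots> = 2 * sq_dist t H H' + 2 * sq_dist t H' H''"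
    unfolding sq_dist_def nn_integral_lborel_upto using m(2,4) by (simp add: nn_integral_add nn_integral_cmult)
  finally show ?thesis .
qed

lemma nn_square_triangle:
  assumes [measurable]: "Z \<in> borel_measurable M" "Z' \<in> borel_measurable M" "Z'' \<in> borel_measurable M"
  shows "(\<integral>\<^sup>+\<omega>. ennreal ((Z \<omega> - Z'' \<omega>)\<^sup>2) \<partial>M)
    \<le> 2 * (\<integral>\<^sup>+\<omega>. ennreal ((Z \<omega> - Z' \<omega>)\<^sup>2) \<partial>M) + 2 * (\<integral>\<^sup>+\<omega>. ennreal ((Z' \<omega> - Z'' \<omega>)\<^sup>2) \<partial>M)"
proof -
  have "(\<integral>\<^sup>+\<omega>. ennreal ((Z \<omega> - Z'' \<omega>)\<^sup>2) \<partial>M)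
    \<le> (\<integral>\<^sup>+\<omega>. 2 * ennreal ((Z \<omega> - Z' \<omega>)\<^sup>2) + 2 * ennreal ((Z' \<omega> - Z'' \<omega>)\<^sup>2) \<partial>M)"
  proof (intro nn_integral_mono)
    fix \<omega> show "ennreal ((Z \<omega> - Z'' \<omega>)\<^sup>2) \<le> 2 * ennreal ((Z \<omega> - Z' \<omega>)\<^sup>2) + 2 * ennreal ((Z' \<omega> - Z'' \<omega>)\<^sup>2)"
      using ennreal_square_add_le[of "Z \<omega> - Z' \<omega>" "Z' \<omega> - Z'' \<omega>"] by simp
  qed
  also have "\<dots> = 2 * (\<integral>\<^sup>+\<omega>. ennreal ((Z \<omega> - Z' \<omega>)\<^sup>2) \<partial>M) + 2 * (\<integral>\<^sup>+\<omega>. ennreal ((Z' \<omega> - Z'' \<omega>)\<^sup>2) \<partial>M)"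
    by (simp add: nn_integral_add nn_integral_cmult)
  finally show ?thesis .
qed

lemma S2_ito_integrand:
  assumes X: "S2 X"
  shows "ito_integrand M F X"
  unfolding ito_integrand_def
proof (intro conjI allI impI)
  fix T :: real assume T: "0 \<le> T"
  show "(\<lambda>(t, \<omega>). X t \<omega>) \<in> borel_measurable (restrict_space borel {0..T} \<Otimes>\<^sub>M F T)"
    using X T space_F by (intro continuous_process_joint_measurable[of M]) (auto simp: S2_def intro: adaptedD)
  have "(\<integral>\<^sup>+\<omega>. (\<integral>\<^sup>+t\<in>{0..T}. ennreal ((X t \<omega>)\<^sup>2) \<partial>lborel) \<partial>M)
    \<le> (\<integral>\<^sup>+\<omega>. (\<integral>\<^sup>+t\<in>{0..T}. supsq X T \<omega> \<partial>lborel) \<partial>M)"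
    by (intro nn_integral_mono) (auto simp: indicator_def intro: supsq_upper)
  also have "\<dots> = sup_moment X T * ennreal T"
    using X T supsq_measurable_M[of X T]
    by (simp add: nn_integral_const_upto sup_moment_def nn_integral_multc S2_def)
  also have "\<dots> < \<infinity>" using X T by (simp add: S2_def ennreal_mult_less_top)
  finally show "(\<integral>\<^sup>+\<omega>. (\<integral>\<^sup>+t\<in>{0..T}. ennreal ((X t \<omega>)\<^sup>2) \<partial>lborel) \<partial>M) < \<infinity>" .
qed

end

section \<open>Completeness\<close>

text \<open>The rate is part of the conclusion: it does not depend on time when applied along paths,
  and so gives uniform convergence.\<close>

lemma geometric_cauchy:
  fixes x :: "nat \<Rightarrow> real"
  assumes d: "\<And>n. N \<le> n \<Longrightarrow> \<bar>x (Suc n) - x n\<bar> \<le> c * (1/2)^n" and c: "0 \<le> c"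
  shows "x \<longlonglongrightarrow> lim x" "N \<le> n \<Longrightarrow> \<bar>x n - lim x\<bar> \<le> 2 * c * (1/2)^n"
proof -
  \<comment> \<open>The exact partial sum of the geometric series is carried along, since the cruder
    bound by the full series would not pass through the induction.\<close>
  have le: "\<bar>x (n + p) - x n\<bar> \<le> 2 * c * ((1/2)^n - (1/2)^(n+p))" if "N \<le> n" for n p
  proof (induction p)
    case (Suc p)
    have "\<bar>x (n + Suc p) - x n\<bar> \<le> \<bar>x (Suc (n + p)) - x (n + p)\<bar> + \<bar>x (n + p) - x n\<bar>" by simp
    also have "\<dots> \<le> c * (1/2)^(n+p) + 2 * c * ((1/2)^n - (1/2)^(n+p))"
      using that by (intro add_mono d Suc) auto
    finally show ?case by (simp add: algebra_simps)
  qed simp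
  have le': "\<bar>x (n + p) - x n\<bar> \<le> 2 * c * (1/2)^n" if "N \<le> n" for n p
  proof -
    have "0 \<le> 2 * c * (1/2)^(n+p)" using c by simp
    then show ?thesis using le[OF that, of p] by (simp only: right_diff_distrib)
  qed
  have lim0: "(\<lambda>n. 2 * c * (1/2)^n) \<longlonglongrightarrow> 2 * c * 0" by (intro tendsto_intros) auto
  have "Cauchy x"
  proof (rule CauchyI')
    fix e :: real assume "0 < e"
    then have "eventually (\<lambda>n. 2 * c * (1/2)^n < e) sequentially"
      using order_tendstoD(2)[OF lim0, of e] by simp
    then obtain m where m: "\<And>n. m \<le> n \<Longrightarrow> 2 * c * (1/2)^n < e" by (auto simp: eventually_sequentially)
    show "\<exists>M. \<forall>m\<ge>M. \<forall>n>m. dist (x m) (x n) < e"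
    proof (intro exI[of _ "max m N"] allI impI)
      fix k n assume k: "max m N \<le> k" "k < n"
      then have "\<bar>x (k + (n - k)) - x k\<bar> \<le> 2 * c * (1/2)^k" by (intro le') auto
      also have "\<dots> < e" using k by (intro m) auto
      finally show "dist (x k) (x n) < e" using k by (simp add: dist_real_def abs_minus_commute)
    qed
  qed
  then show l: "x \<longlonglongrightarrow> lim x" by (simp add: Cauchy_convergent_iff convergent_LIMSEQ_iff)
  show "\<bar>x n - lim x\<bar> \<le> 2 * c * (1/2)^n" if n: "N \<le> n"
  proof (rule LIMSEQ_le_const2)
    show "(\<lambda>p. \<bar>x n - x p\<bar>) \<longlonglongrightarrow> \<bar>x n - lim x\<bar>" by (intro tendsto_intros l)
    show "\<exists>m. \<forall>p\<ge>m. \<bar>x n - x p\<bar> \<le> 2 * c * (1/2)^n"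
    proof (intro exI[of _ n] allI impI)
      fix p assume "n \<le> p"
      then show "\<bar>x n - x p\<bar> \<le> 2 * c * (1/2)^n"
        using le'[OF n, of "p - n"] by (simp add: abs_minus_commute)
    qed
  qed
qed

context complete_filtered_prob_space
begin

text \<open>Completeness for sequences with a geometric rate. One random series per integer horizon
  dominates all increments at once, giving uniform convergence of paths on its finiteness set and
  convergence in \<open>sup_moment\<close> with the same bound.\<close>

lemma sup_moment_complete:
  assumes ad: "\<And>n. adapted F (X n)" and co: "\<And>n. continuous_process M (X n)"
    and cauchy: "\<And>T. 0 \<le> T \<Longrightarrow> \<exists>N A. A < \<infinity> \<and>
      (\<forall>n\<ge>N. sup_moment (\<lambda>t \<omega>. X (Suc n) t \<omega> - X n t \<omega>) T \<le> A * ennreal ((1/16)^n))"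
  obtains Y where "adapted F Y" "continuous_process M Y"
    "\<And>T. 0 \<le> T \<Longrightarrow> (\<lambda>n. sup_moment (\<lambda>t \<omega>. X n t \<omega> - Y t \<omega>) T) \<longlonglongrightarrow> 0"
proof -
  define D where "D n = (\<lambda>t \<omega>. X (Suc n) t \<omega> - X n t \<omega>)" for n
  have "\<exists>N A. A < \<infinity> \<and> (\<forall>n\<ge>N. sup_moment (D n) (real m) \<le> A * ennreal ((1/16)^n))" for m
    using cauchy[of "real m"] by (simp add: D_def)
  then obtain N A where A: "\<And>m. A m < (\<infinity>::ennreal)"
    and le: "\<And>m n. N m \<le> n \<Longrightarrow> sup_moment (D n) (real m) \<le> A m * ennreal ((1/16)^n)"
    by metis
  have Dm[measurable]: "supsq (D n) (real m) \<in> borel_measurable M" for n m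
    unfolding D_def by (intro supsq_measurable_M adapted_diff continuous_process_diff ad co) simp
  \<comment> \<open>The weights \<open>4^n\<close> are affordable because the moments decay like
    \<open>16^-n\<close>; finiteness of \<open>W\<close> then bounds increment n by
    \<open>sqrt W\<close> times \<open>2^-n\<close>. The series starts at \<open>N m\<close>, from
    where the rate holds on \<open>[0,m]\<close>.\<close>
  define W where "W m \<omega> = (\<Sum>i. ennreal (4^(N m + i)) * supsq (D (N m + i)) (real m) \<omega>)" for m \<omega>
  have Wm[measurable]: "W m \<in> borel_measurable M" for m unfolding W_def by measurable
  have EW: "(\<integral>\<^sup>+\<omega>. W m \<omega> \<partial>M) < \<infinity>" for m
  proof -
    have "(\<integral>\<^sup>+\<omega>. W m \<omega> \<partial>M) = (\<Sum>i. ennreal (4^(N m + i)) * sup_moment (D (N m + i)) (real m))"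
      unfolding W_def sup_moment_def by (subst nn_integral_suminf) (auto simp: nn_integral_cmult)
    also have "\<dots> \<le> (\<Sum>i. A m * ennreal ((1/4)^i))"
    proof (intro suminf_le allI summableI)
      fix i
      have "ennreal (4^(N m + i)) * sup_moment (D (N m + i)) (real m) \<le> ennreal (4^(N m + i)) * (A m * ennreal ((1/16)^(N m + i)))"
        by (intro mult_left_mono le) auto
      also have "\<dots> = A m * (ennreal (4^(N m + i)) * ennreal ((1/16)^(N m + i)))" by (simp add: mult_ac)
      also have "ennreal (4^(N m + i)) * ennreal ((1/16)^(N m + i)) = ennreal ((1/4)^(N m + i))"
        by (simp add: ennreal_mult[symmetric] power_mult_distrib[symmetric])
      also have "A m * ennreal ((1/4)^(N m + i)) \<le> A m * ennreal ((1/4)^i)"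
        by (intro mult_left_mono ennreal_leI power_decreasing) auto
      finally show "ennreal (4^(N m + i)) * sup_moment (D (N m + i)) (real m) \<le> A m * ennreal ((1/4)^i)" .
    qed
    also have "\<dots> = A m * ennreal (\<Sum>i. (1/4)^i)"
      by (subst ennreal_suminf_cmult, subst suminf_ennreal2) auto
    also have "\<dots> < \<infinity>" using A[of m] by (simp add: ennreal_mult_less_top)
    finally show ?thesis .
  qed
  define G where "G = {\<omega>\<in>space M. \<forall>m. W m \<omega> < \<infinity>}"
  have GM: "G \<in> sets M" unfolding G_def by measurable
  have "AE \<omega> in M. \<forall>m. W m \<omega> < \<infinity>"
    unfolding AE_all_countable using EW nn_integral_noteq_infinite[of "W _" M] by (auto simp: less_top)
  then have AEG: "AE \<omega> in M. \<omega> \<in> G" unfolding G_def by (auto elim!: eventually_mono)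
  then obtain N0 where "{\<omega>\<in>space M. \<not> \<omega> \<in> G} \<subseteq> N0" "emeasure M N0 = 0" "N0 \<in> sets M" by (rule AE_E)
  then have "space M - G \<in> null_sets M"
    using GM by (intro null_sets_subset[of N0 M "space M - G"]) auto
  \<comment> \<open>Completeness of the filtration: the exceptional set belongs to
    \<open>F 0\<close>, so setting processes to 0 there preserves adaptedness at every time.\<close>
  then have "space M - (space M - G) \<in> sets (F 0)"
    using null_sets_F0 space_F[of 0] sets.compl_sets[of "space M - G" "F 0"] by auto
  then have GF: "G \<in> sets (F t)" if "0 \<le> t" for t
    using sets_F_mono[of 0 t] that sets.sets_into_space[OF GM] by (auto simp: double_diff)
  \<comment> \<open>The indicator inside makes the sequence converge at every sample point for each
    \<open>t \<ge> 0\<close>, so all paths of the limit are continuous and not merely almost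
    all.\<close>
  define Y where "Y t \<omega> = lim (\<lambda>n. indicator G \<omega> * X n t \<omega>)" for t \<omega>
  define c where "c m \<omega> = sqrt (enn2real (W m \<omega>))" for m \<omega>
  have c0: "0 \<le> c m \<omega>" for m \<omega> by (simp add: c_def)
  have step: "\<bar>X (Suc n) t \<omega> - X n t \<omega>\<bar> \<le> c m \<omega> * (1/2)^n"
    if w: "\<omega> \<in> G" and n: "N m \<le> n" and t: "0 \<le> t" "t \<le> real m" for \<omega> n t m
  proof -
    have fin: "W m \<omega> < \<infinity>" using w by (simp add: G_def)
    have "ennreal (4^n * (D n t \<omega>)\<^sup>2) = ennreal (4^n) * ennreal ((D n t \<omega>)\<^sup>2)" by (simp add: ennreal_mult)
    also have "\<dots> \<le> ennreal (4^n) * supsq (D n) (real m) \<omega>" by (intro mult_left_mono supsq_upper t) auto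
    also have "\<dots> = (\<Sum>i\<in>{n - N m}. ennreal (4^(N m + i)) * supsq (D (N m + i)) (real m) \<omega>)" using n by simp
    also have "\<dots> \<le> W m \<omega>" unfolding W_def by (intro sum_le_suminf summableI) auto
    finally have "4^n * (D n t \<omega>)\<^sup>2 \<le> enn2real (W m \<omega>)"
      using fin enn2real_mono[of "ennreal (4^n * (D n t \<omega>)\<^sup>2)" "W m \<omega>"] by simp
    then have "(2^n * \<bar>D n t \<omega>\<bar>)\<^sup>2 \<le> enn2real (W m \<omega>)"
      by (simp add: power_mult_distrib power_mult[symmetric] mult.commute[of n 2] power_mult)
    then have "2^n * \<bar>D n t \<omega>\<bar> \<le> c m \<omega>" unfolding c_def by (rule real_le_rsqrt)
    then show ?thesis by (simp add: D_def field_simps power_divide)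
  qed
  have YG: "Y t \<omega> = lim (\<lambda>n. X n t \<omega>)" if "\<omega> \<in> G" for t \<omega> using that by (simp add: Y_def)
  have YnG: "Y t \<omega> = 0" if "\<omega> \<notin> G" for t \<omega> using that by (simp add: Y_def)
  have conv: "(\<lambda>n. X n t \<omega>) \<longlonglongrightarrow> Y t \<omega>" "\<bar>X n t \<omega> - Y t \<omega>\<bar> \<le> 2 * c m \<omega> * (1/2)^n"
    if w: "\<omega> \<in> G" and n: "N m \<le> n" and t: "0 \<le> t" "t \<le> real m" for \<omega> n t m
    using geometric_cauchy(1)[of "N m" "\<lambda>n. X n t \<omega>" "c m \<omega>"]
      geometric_cauchy(2)[of "N m" "\<lambda>n. X n t \<omega>" "c m \<omega>" n] step[OF w _ t] c0 n by (auto simp: YG[OF w])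
  have "adapted F Y" unfolding adapted_def
  proof (intro allI impI)
    fix t :: real assume t: "0 \<le> t"
    obtain m where m: "t \<le> real m" using real_arch_simple by blast
    show "Y t \<in> borel_measurable (F t)"
    proof (rule borel_measurable_LIMSEQ_real)
      show "(\<lambda>\<omega>. indicator G \<omega> * X n t \<omega>) \<in> borel_measurable (F t)" for n
        using ad[of n] t GF[OF t] by (auto simp: adapted_def)
      fix \<omega>
      show "(\<lambda>n. indicator G \<omega> * X n t \<omega>) \<longlonglongrightarrow> Y t \<omega>"
        using conv(1)[of \<omega> m "N m" t] t m by (cases "\<omega> \<in> G") (auto simp: YnG)
    qed
  qed
  moreover have "continuous_process M Y"
    unfolding continuous_process_def
  proof (intro ballI continuous_on_atLeast_I)
    fix \<omega> and T :: real assume w: "\<omega> \<in> space M" and T: "0 \<le> T"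
    show "continuous_on {0..T} (\<lambda>t. Y t \<omega>)"
    proof (cases "\<omega> \<in> G")
      case True
      obtain m where m: "T \<le> real m" using real_arch_simple by blast
      show ?thesis
      proof (rule uniform_limit_theorem[where F=sequentially])
        show "\<forall>\<^sub>F n in sequentially. continuous_on {0..T} (\<lambda>t. X n t \<omega>)"
          using co w
          by (auto simp: continuous_process_def intro!: always_eventually continuous_on_subset[where s="{0..}" and t="{0..T}"])
        show "uniform_limit {0..T} (\<lambda>n t. X n t \<omega>) (\<lambda>t. Y t \<omega>) sequentially"
        proof (rule uniform_limitI)
          fix e :: real assume e: "0 < e"
          have "(\<lambda>n. 2 * c m \<omega> * (1/2)^n) \<longlonglongrightarrow> 2 * c m \<omega> * 0" by (intro tendsto_intros) auto
          then have "eventually (\<lambda>n. 2 * c m \<omega> * (1/2)^n < e) sequentially"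
            using order_tendstoD(2)[of _ "2 * c m \<omega> * 0" sequentially e] e by simp
          then show "\<forall>\<^sub>F n in sequentially. \<forall>t\<in>{0..T}. dist (X n t \<omega>) (Y t \<omega>) < e"
            using eventually_ge_at_top[of "N m"]
          proof eventually_elim
            case (elim n)
            then show ?case using conv(2)[OF True, of m n] m by (fastforce simp: dist_real_def intro: order.strict_trans1)
          qed
        qed
      qed simp
    qed (simp add: YnG)
  qed
  moreover have "(\<lambda>n. sup_moment (\<lambda>t \<omega>. X n t \<omega> - Y t \<omega>) T) \<longlonglongrightarrow> 0" if T: "0 \<le> T" for T
  proof -
    obtain m where m: "T \<le> real m" using real_arch_simple by blast
    \<comment> \<open>The pathwise rate, squared and integrated, so the expectation of
      \<open>W\<close> also controls the distance to the limit.\<close>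
    have b: "sup_moment (\<lambda>t \<omega>. X n t \<omega> - Y t \<omega>) T \<le> ennreal (4 * (1/4)^n) * (\<integral>\<^sup>+\<omega>. W m \<omega> \<partial>M)" if n: "N m \<le> n" for n
    proof -
      have "sup_moment (\<lambda>t \<omega>. X n t \<omega> - Y t \<omega>) T \<le> (\<integral>\<^sup>+\<omega>. ennreal (4 * (1/4)^n) * W m \<omega> \<partial>M)"
        unfolding sup_moment_def
      proof (rule nn_integral_mono_AE)
        show "AE \<omega> in M. supsq (\<lambda>t \<omega>. X n t \<omega> - Y t \<omega>) T \<omega> \<le> ennreal (4 * (1/4)^n) * W m \<omega>"
          using AEG
        proof eventually_elim
          fix \<omega> assume w: "\<omega> \<in> G"
          have fin: "W m \<omega> < \<infinity>" using w by (simp add: G_def)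
          show "supsq (\<lambda>t \<omega>. X n t \<omega> - Y t \<omega>) T \<omega> \<le> ennreal (4 * (1/4)^n) * W m \<omega>"
          proof (rule supsq_least)
            fix t assume "0 \<le> t" "t \<le> T"
            then have "\<bar>X n t \<omega> - Y t \<omega>\<bar> \<le> 2 * c m \<omega> * (1/2)^n" using m by (intro conv w n) auto
            then have "\<bar>X n t \<omega> - Y t \<omega>\<bar>\<^sup>2 \<le> (2 * c m \<omega> * (1/2)^n)\<^sup>2" by (intro power_mono) auto
            also have "\<dots> = 4 * ((1/2)\<^sup>2)^n * (c m \<omega>)\<^sup>2"
              by (simp add: power_mult_distrib power_mult[symmetric] mult.commute)
            also have "\<dots> = 4 * (1/4)^n * enn2real (W m \<omega>)" by (simp add: c_def power2_eq_square)
            finally have "ennreal ((X n t \<omega> - Y t \<omega>)\<^sup>2) \<le> ennreal (4 * (1/4)^n * enn2real (W m \<omega>))"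
              by (intro ennreal_leI) simp
            also have "\<dots> = ennreal (4 * (1/4)^n) * W m \<omega>" using fin by (simp add: ennreal_mult)
            finally show "ennreal ((X n t \<omega> - Y t \<omega>)\<^sup>2) \<le> ennreal (4 * (1/4)^n) * W m \<omega>" .
          qed
        qed
      qed
      then show ?thesis by (simp add: nn_integral_cmult)
    qed
    have "(\<lambda>n. (\<integral>\<^sup>+\<omega>. W m \<omega> \<partial>M) * ennreal (4 * (1/4)^n)) \<longlonglongrightarrow> (\<integral>\<^sup>+\<omega>. W m \<omega> \<partial>M) * ennreal (4 * 0)"
      using EW[of m] by (intro ennreal_tendsto_cmult tendsto_ennrealI tendsto_intros) auto
    then have lim: "(\<lambda>n. ennreal (4 * (1/4)^n) * (\<integral>\<^sup>+\<omega>. W m \<omega> \<partial>M)) \<longlonglongrightarrow> 0" by (simp add: mult.commute)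
    show ?thesis
      by (rule tendsto_sandwich[OF _ _ tendsto_const lim])
         (auto intro!: eventually_mono[OF eventually_ge_at_top[of "N m"]] b)
  qed
  ultimately show thesis by (rule that)
qed

end

section \<open>The Ito integral\<close>

context brownian_filtration
begin

lemma ito_martingale:
  assumes "is_ito_integral M F B H I"
  shows "sq_martingale I"
proof -
  obtain n \<tau> \<eta> where \<eta>: "\<And>k. simple_integrand M F (n k) (\<tau> k) (\<eta> k)"
    and lim: "\<And>t. 0 \<le> t \<Longrightarrow> (\<lambda>k. \<integral>\<^sup>+\<omega>. ennreal ((I t \<omega> - simple_ito_integral B (n k) (\<tau> k) (\<eta> k) t \<omega>)\<^sup>2) \<partial>M) \<longlonglongrightarrow> 0"
    and ad: "adapted F I"
    using assms unfolding is_ito_integral_def by blast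
  show ?thesis by (rule sq_martingale_limit[OF simple_ito_martingale[OF \<eta>] ad lim])
qed

lemma ito_S2: "is_ito_integral M F B H I \<Longrightarrow> S2 I"
  by (rule sq_martingale_S2[OF ito_martingale]) (auto simp: is_ito_integral_def)

lemma ito_time_measurable: "is_ito_integral M F B H I \<Longrightarrow> 0 \<le> t \<Longrightarrow> time_measurable t H"
  by (rule time_measurable_progressive) (auto simp: is_ito_integral_def ito_integrand_def)

text \<open>The sharp constant is 1, with equality. The cruder one follows from
  \<open>(x + y)\<^sup>2 \<le> 2x\<^sup>2 + 2y\<^sup>2\<close> alone.\<close>

lemma ito_isometry_le:
  assumes H: "is_ito_integral M F B H I" and H': "is_ito_integral M F B H' I'" and t: "0 \<le> t"
  shows "(\<integral>\<^sup>+\<omega>. ennreal ((I t \<omega> - I' t \<omega>)\<^sup>2) \<partial>M) \<le> 16 * sq_dist t H H'"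
proof -
  obtain n \<tau> \<eta> where \<eta>: "\<And>k. simple_integrand M F (n k) (\<tau> k) (\<eta> k)"
    and lim: "(\<lambda>k. sq_dist t H (simple_process (n k) (\<tau> k) (\<eta> k))) \<longlonglongrightarrow> 0"
      "(\<lambda>k. \<integral>\<^sup>+\<omega>. ennreal ((I t \<omega> - simple_ito_integral B (n k) (\<tau> k) (\<eta> k) t \<omega>)\<^sup>2) \<partial>M) \<longlonglongrightarrow> 0"
    using H t unfolding is_ito_integral_def sq_dist_def by blast
  obtain n' \<tau>' \<eta>' where \<eta>': "\<And>k. simple_integrand M F (n' k) (\<tau>' k) (\<eta>' k)"
    and lim': "(\<lambda>k. sq_dist t H' (simple_process (n' k) (\<tau>' k) (\<eta>' k))) \<longlonglongrightarrow> 0"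
      "(\<lambda>k. \<integral>\<^sup>+\<omega>. ennreal ((I' t \<omega> - simple_ito_integral B (n' k) (\<tau>' k) (\<eta>' k) t \<omega>)\<^sup>2) \<partial>M) \<longlonglongrightarrow> 0"
    using H' t unfolding is_ito_integral_def sq_dist_def by blast
  define P where "P k = simple_process (n k) (\<tau> k) (\<eta> k)" for k
  define P' where "P' k = simple_process (n' k) (\<tau>' k) (\<eta>' k)" for k
  define S where "S k = simple_ito_integral B (n k) (\<tau> k) (\<eta> k)" for k
  define S' where "S' k = simple_ito_integral B (n' k) (\<tau>' k) (\<eta>' k)" for k
  have m: "I t \<in> borel_measurable M" "I' t \<in> borel_measurable M" "S k t \<in> borel_measurable M" "S' k t \<in> borel_measurable M" for k
    using H H' simple_ito_martingale[OF \<eta>, of k] simple_ito_martingale[OF \<eta>', of k] t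
    by (auto simp: is_ito_integral_def sq_martingale_def S_def S'_def intro: adapted_M)
  have tm: "time_measurable t H" "time_measurable t H'" "time_measurable t (P k)" "time_measurable t (P' k)" for k
    using ito_time_measurable[OF H t] ito_time_measurable[OF H' t] time_measurable_simple[OF \<eta>] time_measurable_simple[OF \<eta>']
    by (auto simp: P_def P'_def)
  let ?d = "\<lambda>Z Z'. \<integral>\<^sup>+\<omega>. ennreal ((Z t \<omega> - Z' t \<omega>)\<^sup>2) \<partial>M"
  \<comment> \<open>The comparison passes from \<open>I\<close> through \<open>S k\<close> and
    \<open>S' k\<close> to \<open>I'\<close>, and from \<open>P k\<close> through \<open>H\<close>
    and \<open>H'\<close> to \<open>P' k\<close>. Four triangle inequalities double the term that
    stays, whence 16; all other terms vanish in the limit.\<close>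
  have le: "?d I I' \<le> 2 * ?d I (S k) + 2 * (2 * (2 * sq_dist t H (P k) + 2 * (2 * sq_dist t H H' + 2 * sq_dist t H' (P' k))) + 2 * ?d I' (S' k))" for k
  proof -
    have 1: "?d I I' \<le> 2 * ?d I (S k) + 2 * ?d (S k) I'" by (rule nn_square_triangle[OF m(1) m(3) m(2)])
    have 2: "?d (S k) I' \<le> 2 * ?d (S k) (S' k) + 2 * ?d I' (S' k)"
      using nn_square_triangle[OF m(3) m(4) m(2), of k k] by (simp add: power2_commute[of "S' k t _"])
    have "?d (S k) (S' k) = sq_dist t (P k) (P' k)"
      unfolding S_def S'_def P_def P'_def sq_dist_def by (rule simple_ito_diff_isometry[OF \<eta> \<eta>' t])
    also have "\<dots> \<le> 2 * sq_dist t H (P k) + 2 * sq_dist t H (P' k)"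
      using sq_dist_triangle[OF tm(3)[of k] tm(1) tm(4)[of k]] by (simp add: sq_dist_commute[of t "P k" H])
    finally have 3: "?d (S k) (S' k) \<le> 2 * sq_dist t H (P k) + 2 * sq_dist t H (P' k)" .
    have 4: "sq_dist t H (P' k) \<le> 2 * sq_dist t H H' + 2 * sq_dist t H' (P' k)"
      by (rule sq_dist_triangle[OF tm(1) tm(2) tm(4)])
    show ?thesis
      by (intro order_trans[OF 1] add_mono mult_left_mono order_refl order_trans[OF 2] order_trans[OF 3] 4) auto
  qed
  have "(\<lambda>k. 2 * ?d I (S k) + 2 * (2 * (2 * sq_dist t H (P k) + 2 * (2 * sq_dist t H H' + 2 * sq_dist t H' (P' k))) + 2 * ?d I' (S' k)))
    \<longlonglongrightarrow> 2 * 0 + 2 * (2 * (2 * 0 + 2 * (2 * sq_dist t H H' + 2 * 0)) + 2 * 0)"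
    unfolding S_def S'_def P_def P'_def
    by (intro tendsto_add ennreal_tendsto_cmult lim lim' tendsto_const) auto
  then have "?d I I' \<le> 2 * 0 + 2 * (2 * (2 * 0 + 2 * (2 * sq_dist t H H' + 2 * 0)) + 2 * 0)"
    by (rule LIMSEQ_le_const) (use le in auto)
  also have "\<dots> = 16 * sq_dist t H H'" by (simp add: mult.assoc[symmetric])
  finally show ?thesis .
qed

text \<open>Doob's 4 times the 16 of the isometry estimate. For \<open>H = H'\<close> it says that
  two versions of the integral are indistinguishable.\<close>

lemma ito_sup_moment_diff:
  assumes H: "is_ito_integral M F B H I" and H': "is_ito_integral M F B H' I'" and t: "0 \<le> t"
  shows "sup_moment (\<lambda>t \<omega>. I t \<omega> - I' t \<omega>) t \<le> 64 * sq_dist t H H'"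
proof -
  have "sup_moment (\<lambda>t \<omega>. I t \<omega> - I' t \<omega>) t \<le> 4 * (\<integral>\<^sup>+\<omega>. ennreal ((I t \<omega> - I' t \<omega>)\<^sup>2) \<partial>M)"
    using H H' by (intro doob sq_martingale_diff ito_martingale[OF H] ito_martingale[OF H'] continuous_process_diff t)
      (auto simp: is_ito_integral_def)
  also have "\<dots> \<le> 4 * (16 * sq_dist t H H')"
    by (intro mult_left_mono ito_isometry_le assms) auto
  finally show ?thesis by (simp add: mult.assoc[symmetric])
qed

end

section \<open>Approximation of continuous integrands by sampling on a grid\<close>

definition clip :: "real \<Rightarrow> real \<Rightarrow> real" where
  "clip r x = max (- r) (min r x)"

lemma clip_square_le: "0 \<le> r \<Longrightarrow> (clip r x)\<^sup>2 \<le> x\<^sup>2"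
  by (rule abs_le_square_iff[THEN iffD1]) (auto simp: clip_def)

text \<open>\<open>K * K\<close> cells of width \<open>1 / K\<close> fill \<open>(0,K]\<close>.
  Cells are open on the left, so the one containing s has index
  \<open>\<lceil>K * s\<rceil> - 1\<close>, and time 0 lies in no cell.\<close>

lemma simple_process_grid:
  assumes K: "0 < K"
  shows "simple_process (K * K) (\<lambda>i. real i / real K) \<eta> s \<omega> =
    (if 0 < s \<and> s \<le> real K then \<eta> (nat (\<lceil>real K * s\<rceil> - 1)) \<omega> else 0)"
proof -
  define i0 where "i0 = nat (\<lceil>real K * s\<rceil> - 1)"
  have K0: "0 < real K" using K by simp
  have ind: "indicator {real i / real K<..real (Suc i) / real K} s = (if 0 < s \<and> i = i0 then 1 else (0::real))" for i
  proof -
    have "s \<in> {real i / real K<..real (Suc i) / real K} \<longleftrightarrow> real i < real K * s \<and> real K * s \<le> real i + 1"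
      using K0 by (auto simp: field_simps)
    also have "\<dots> \<longleftrightarrow> \<lceil>real K * s\<rceil> = int i + 1" by (auto simp: ceiling_eq_iff)
    also have "\<dots> \<longleftrightarrow> 0 < s \<and> i = i0"
    proof
      assume a: "\<lceil>real K * s\<rceil> = int i + 1"
      then have "0 < \<lceil>real K * s\<rceil>" by simp
      then have "0 < real K * s" by simp
      then show "0 < s \<and> i = i0" using a K0 by (simp add: i0_def zero_less_mult_iff)
    next
      assume a: "0 < s \<and> i = i0"
      then have "0 < real K * s" using K0 by simp
      then have "0 < \<lceil>real K * s\<rceil>" by simp
      then show "\<lceil>real K * s\<rceil> = int i + 1" using a by (simp add: i0_def)
    qed
    finally show ?thesis by (simp add: indicator_def)
  qed
  have i0: "i0 < K * K \<longleftrightarrow> s \<le> real K" if s: "0 < s"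
  proof -
    have "0 < real K * s" using K0 s by simp
    then have "0 < \<lceil>real K * s\<rceil>" by simp
    then have "i0 < K * K \<longleftrightarrow> \<lceil>real K * s\<rceil> \<le> int (K * K)" by (simp add: i0_def nat_less_iff) linarith
    also have "\<dots> \<longleftrightarrow> real K * s \<le> real K * real K" by (simp add: ceiling_le_iff)
    finally show ?thesis using K0 by simp
  qed
  have "simple_process (K * K) (\<lambda>i. real i / real K) \<eta> s \<omega> = (\<Sum>i<K * K. if i = i0 then (if 0 < s then \<eta> i \<omega> else 0) else 0)"
    unfolding simple_process_def ind by (intro sum.cong) auto
  also have "\<dots> = (if i0 < K * K then (if 0 < s then \<eta> i0 \<omega> else 0) else 0)"
    by (simp add: sum.delta)
  finally show ?thesis using i0 by (auto simp: i0_def)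
qed

context complete_filtered_prob_space
begin

text \<open>Weights of simple integrands must be bounded, whereas \<open>H\<close> at a grid point
  is only square-integrable; hence the clipping. Mesh, horizon and clipping level are all tied to
  \<open>Suc k\<close>, so that a single index drives all three limits.\<close>

definition grid_weight :: "(real \<Rightarrow> 'a \<Rightarrow> real) \<Rightarrow> nat \<Rightarrow> nat \<Rightarrow> 'a \<Rightarrow> real" where
  "grid_weight H k i \<omega> = clip (real (Suc k)) (H (real i / real (Suc k)) \<omega>)"

definition grid_process :: "(real \<Rightarrow> 'a \<Rightarrow> real) \<Rightarrow> nat \<Rightarrow> real \<Rightarrow> 'a \<Rightarrow> real" where
  "grid_process H k = simple_process (Suc k * Suc k) (\<lambda>i. real i / real (Suc k)) (grid_weight H k)"

lemma grid_integrand: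
  assumes H: "adapted F H"
  shows "simple_integrand M F (Suc k * Suc k) (\<lambda>i. real i / real (Suc k)) (grid_weight H k)"
  unfolding simple_integrand_def
proof (intro conjI allI impI)
  fix i
  have "H (real i / real (Suc k)) \<in> borel_measurable (F (real i / real (Suc k)))"
    using H by (simp add: adapted_def)
  then show "grid_weight H k i \<in> borel_measurable (F (real i / real (Suc k)))"
    unfolding grid_weight_def clip_def by (intro borel_measurable_max borel_measurable_min borel_measurable_const)
  have "\<bar>grid_weight H k i \<omega>\<bar> \<le> real (Suc k)" for \<omega> by (auto simp: grid_weight_def clip_def)
  then show "bounded (grid_weight H k i ` space M)" unfolding bounded_iff by (intro exI[of _ "real (Suc k)"]) auto
qed (auto simp: divide_right_mono)

lemma grid_process_eq:
  assumes s: "0 < s" "s \<le> real (Suc k)"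
  obtains u where "grid_process H k s \<omega> = clip (real (Suc k)) (H u \<omega>)" "0 \<le> u" "u \<le> s" "s - u \<le> 1 / real (Suc k)"
proof -
  define K where "K = real (Suc k)"
  have K: "0 < K" by (simp add: K_def)
  define i where "i = nat (\<lceil>K * s\<rceil> - 1)"
  have "0 < K * s" using K s by simp
  then have "0 < \<lceil>K * s\<rceil>" by simp
  then have i: "real i = of_int \<lceil>K * s\<rceil> - 1" by (simp add: i_def)
  then have "real i \<le> K * s" "K * s - real i \<le> 1" by linarith+
  then have "real i / K \<le> s" "(K * s - real i) / K \<le> 1 / K"
    using K by (simp_all add: divide_le_eq mult.commute divide_right_mono)
  moreover have "(K * s - real i) / K = s - real i / K" using K by (simp add: diff_divide_distrib)
  moreover have "grid_process H k s \<omega> = clip (real (Suc k)) (H (real i / K) \<omega>)"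
    using s by (simp only: grid_process_def simple_process_grid[of "Suc k"] grid_weight_def zero_less_Suc
      i_def K_def simp_thms if_True)
  ultimately show thesis by (intro that[of "real i / K"]) (auto simp: K_def)
qed

lemma grid_process_le_supsq:
  assumes "0 \<le> s" "s \<le> T"
  shows "ennreal ((grid_process H k s \<omega>)\<^sup>2) \<le> supsq H T \<omega>"
proof (cases "0 < s \<and> s \<le> real (Suc k)")
  case True
  then obtain u where u: "grid_process H k s \<omega> = clip (real (Suc k)) (H u \<omega>)" "0 \<le> u" "u \<le> s"
    by (metis grid_process_eq)
  have "ennreal ((grid_process H k s \<omega>)\<^sup>2) \<le> ennreal ((H u \<omega>)\<^sup>2)"
    unfolding u by (intro ennreal_leI clip_square_le) simp
  also have "\<dots> \<le> supsq H T \<omega>" using u assms by (intro supsq_upper) auto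
  finally show ?thesis .
next
  case False
  then have "grid_process H k s \<omega> = 0"
    unfolding grid_process_def simple_process_grid[OF zero_less_Suc] by (simp only: if_False)
  then show ?thesis by simp
qed

lemma grid_process_tendsto:
  assumes H: "continuous_process M H" "\<omega> \<in> space M" and s: "0 < s"
  shows "(\<lambda>k. grid_process H k s \<omega>) \<longlonglongrightarrow> H s \<omega>"
proof -
  \<comment> \<open>The offset \<open>k0\<close> puts s inside the horizon of all processes
    considered.\<close>
  obtain k0 where k0: "s \<le> real k0" using real_arch_simple by blast
  have "\<exists>u. grid_process H (k + k0) s \<omega> = clip (real (Suc (k + k0))) (H u \<omega>) \<and> 0 \<le> u \<and> \<bar>u - s\<bar> \<le> 1 / real (Suc (k + k0))" for k
  proof -
    obtain u where "grid_process H (k + k0) s \<omega> = clip (real (Suc (k + k0))) (H u \<omega>)" "0 \<le> u" "u \<le> s" "s - u \<le> 1 / real (Suc (k + k0))"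
      by (rule grid_process_eq[of s "k + k0" H \<omega>]) (use s k0 in auto)
    then show ?thesis by auto
  qed
  then obtain u where u: "\<And>k. grid_process H (k + k0) s \<omega> = clip (real (Suc (k + k0))) (H (u k) \<omega>)"
      "\<And>k. 0 \<le> u k" "\<And>k. \<bar>u k - s\<bar> \<le> 1 / real (Suc (k + k0))" by metis
  have "(\<lambda>k. 1 / real (Suc (k + k0))) \<longlonglongrightarrow> 0"
    using LIMSEQ_ignore_initial_segment[OF LIMSEQ_inverse_real_of_nat, of k0] by (simp add: inverse_eq_divide)
  then have "(\<lambda>k. u k - s) \<longlonglongrightarrow> 0"
    by (rule Lim_null_comparison[rotated]) (use u(3) in auto)
  then have us: "u \<longlonglongrightarrow> s" by (simp add: LIM_zero_iff)
  have "continuous_on {0..} (\<lambda>t. H t \<omega>)" using H by (auto simp: continuous_process_def)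
  then have Hu: "(\<lambda>k. H (u k) \<omega>) \<longlonglongrightarrow> H s \<omega>"
    by (rule continuous_on_tendsto_compose[OF _ us]) (use s u(2) in auto)
  \<comment> \<open>The sampled values converge and are therefore bounded, so clipping is eventually
    inactive.\<close>
  obtain C where C: "\<And>k. \<bar>H (u k) \<omega>\<bar> \<le> C"
    using convergent_imp_Bseq[of "\<lambda>k. H (u k) \<omega>"] Hu by (auto simp: convergent_def Bseq_def)
  obtain k1 where k1: "C \<le> real k1" using real_arch_simple by blast
  have "grid_process H (k + k0) s \<omega> = H (u k) \<omega>" if "k1 \<le> k" for k
  proof -
    have "\<bar>H (u k) \<omega>\<bar> \<le> real (Suc (k + k0))" using C[of k] k1 that by simp
    then show ?thesis unfolding u(1) clip_def by (simp add: abs_le_iff max_def min_def)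
  qed
  then have "eventually (\<lambda>k. H (u k) \<omega> = grid_process H (k + k0) s \<omega>) sequentially"
    by (intro eventually_sequentiallyI[of k1]) simp
  from Lim_transform_eventually[OF Hu this]
  have "(\<lambda>k. grid_process H (k + k0) s \<omega>) \<longlonglongrightarrow> H s \<omega>" .
  then show ?thesis by (rule LIMSEQ_offset)
qed

text \<open>Dominated convergence twice, first in time along a fixed path and then over the sample
  space. Sampling and clipping never exceed the running supremum, so its square dominates both
  times.\<close>

lemma grid_process_sq_dist:
  assumes H: "S2 H" and T: "0 \<le> T"
  shows "(\<lambda>k. sq_dist T H (grid_process H k)) \<longlonglongrightarrow> 0"
proof -
  have ad: "adapted F H" and co: "continuous_process M H" using H by (auto simp: S2_def)
  have tmH: "time_measurable T H" by (rule time_measurable_continuous[OF ad co T])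
  have tmP: "time_measurable T (grid_process H k)" for k
    unfolding grid_process_def by (rule time_measurable_simple[OF grid_integrand[OF ad]])
  note m = time_measurable_inner[OF tmH tmP]
  have [measurable]: "supsq H T \<in> borel_measurable M" by (rule supsq_measurable_M[OF ad co T])
  let ?D = "\<lambda>k \<omega> s. ennreal ((H s \<omega> - grid_process H k s \<omega>)\<^sup>2)"
  have D: "?D k \<omega> s \<le> 4 * supsq H T \<omega>" if "0 \<le> s" "s \<le> T" for k \<omega> s
  proof -
    have "?D k \<omega> s \<le> 2 * ennreal ((H s \<omega>)\<^sup>2) + 2 * ennreal ((grid_process H k s \<omega>)\<^sup>2)"
      by (rule ennreal_square_diff_le)
    also have "\<dots> \<le> 2 * supsq H T \<omega> + 2 * supsq H T \<omega>"
      by (intro add_mono mult_left_mono supsq_upper grid_process_le_supsq that) auto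
    finally show ?thesis by (simp add: distrib_right[symmetric])
  qed
  have "(\<lambda>k. \<integral>\<^sup>+\<omega>. (\<integral>\<^sup>+s. ?D k \<omega> s \<partial>lborel_upto T) \<partial>M) \<longlonglongrightarrow> (\<integral>\<^sup>+\<omega>. 0 \<partial>M)"
  proof (rule nn_integral_dominated_convergence[where w="\<lambda>\<omega>. 4 * supsq H T \<omega> * ennreal T"])
    show "(\<lambda>\<omega>. \<integral>\<^sup>+s. ?D k \<omega> s \<partial>lborel_upto T) \<in> borel_measurable M" for k by (rule m(2))
    show "AE \<omega> in M. (\<integral>\<^sup>+s. ?D k \<omega> s \<partial>lborel_upto T) \<le> 4 * supsq H T \<omega> * ennreal T" for k
    proof (rule AE_I2)
      fix \<omega>
      have "(\<integral>\<^sup>+s. ?D k \<omega> s \<partial>lborel_upto T) \<le> (\<integral>\<^sup>+s\<in>{0..T}. 4 * supsq H T \<omega> \<partial>lborel)"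
        unfolding nn_integral_lborel_upto[symmetric]
        by (intro nn_integral_mono) (auto simp: indicator_def intro: D)
      then show "(\<integral>\<^sup>+s. ?D k \<omega> s \<partial>lborel_upto T) \<le> 4 * supsq H T \<omega> * ennreal T"
        by (simp add: nn_integral_const_upto[OF T])
    qed
    show "(\<integral>\<^sup>+\<omega>. 4 * supsq H T \<omega> * ennreal T \<partial>M) < \<infinity>"
      using H T by (simp add: nn_integral_multc nn_integral_cmult S2_def sup_moment_def ennreal_mult_less_top)
    show "AE \<omega> in M. (\<lambda>k. \<integral>\<^sup>+s. ?D k \<omega> s \<partial>lborel_upto T) \<longlonglongrightarrow> 0"
      using sup_moment_finite_AE[OF H T] AE_space
    proof eventually_elim
      fix \<omega> assume fin: "supsq H T \<omega> < \<infinity>" and w: "\<omega> \<in> space M"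
      have pm[measurable]: "(\<lambda>s. H s \<omega>) \<in> borel_measurable (lborel_upto T)"
        "(\<lambda>s. grid_process H k s \<omega>) \<in> borel_measurable (lborel_upto T)" for k
        using time_measurable_path[OF tmH w] time_measurable_path[OF tmP w] by auto
      have "(\<lambda>k. \<integral>\<^sup>+s. ?D k \<omega> s \<partial>lborel_upto T) \<longlonglongrightarrow> (\<integral>\<^sup>+s. 0 \<partial>lborel_upto T)"
      proof (rule nn_integral_dominated_convergence[where w="\<lambda>s. 4 * supsq H T \<omega>"])
        show "AE s in lborel_upto T. ?D k \<omega> s \<le> 4 * supsq H T \<omega>" for k
          by (rule AE_I2) (auto simp: space_restrict_space intro: D)
        have "(\<integral>\<^sup>+s. 4 * supsq H T \<omega> \<partial>lborel_upto T) = 4 * supsq H T \<omega> * ennreal T"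
          unfolding nn_integral_lborel_upto[symmetric] by (rule nn_integral_const_upto[OF T])
        then show "(\<integral>\<^sup>+s. 4 * supsq H T \<omega> \<partial>lborel_upto T) < \<infinity>"
          using fin by (simp add: ennreal_mult_less_top)
        \<comment> \<open>At time 0 the grid processes vanish whatever \<open>H\<close> is, but a
          single time is a null set.\<close>
        have "AE s in lborel. s \<in> {0..T} \<longrightarrow> (\<lambda>k. ?D k \<omega> s) \<longlonglongrightarrow> 0"
          using AE_lborel_singleton[of 0]
        proof eventually_elim
          fix s :: real assume s0: "s \<noteq> 0"
          show "s \<in> {0..T} \<longrightarrow> (\<lambda>k. ?D k \<omega> s) \<longlonglongrightarrow> 0"
          proof
            assume "s \<in> {0..T}"
            then have "0 < s" using s0 by simp
            then have "(\<lambda>k. ennreal ((H s \<omega> - grid_process H k s \<omega>)\<^sup>2)) \<longlonglongrightarrow> ennreal ((H s \<omega> - H s \<omega>)\<^sup>2)"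
              by (intro tendsto_ennrealI tendsto_intros grid_process_tendsto[OF co w])
            then show "(\<lambda>k. ?D k \<omega> s) \<longlonglongrightarrow> 0" by simp
          qed
        qed
        then show "AE s in lborel_upto T. (\<lambda>k. ?D k \<omega> s) \<longlonglongrightarrow> 0"
          by (subst AE_restrict_space_iff) auto
      qed auto
      then show "(\<lambda>k. \<integral>\<^sup>+s. ?D k \<omega> s \<partial>lborel_upto T) \<longlonglongrightarrow> 0" by simp
    qed
  qed auto
  then show ?thesis by (simp add: sq_dist_def nn_integral_lborel_upto)
qed

text \<open>Allows the integrals to be modified where Brownian paths are discontinuous; equality at
  each fixed time is enough.\<close>

lemma sq_martingale_cong_AE:
  assumes N: "sq_martingale N" and ad: "adapted F N'" and eq: "\<And>t. 0 \<le> t \<Longrightarrow> AE \<omega> in M. N' t \<omega> = N t \<omega>"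
  shows "sq_martingale N'"
  unfolding sq_martingale_def
proof (intro conjI allI impI)
  have m: "N t \<in> borel_measurable M" "N' t \<in> borel_measurable M" if "0 \<le> t" for t
    using N ad that by (auto simp: sq_martingale_def intro: adapted_M)
  show "adapted F N'" by fact
  show "integrable M (\<lambda>\<omega>. (N' t \<omega>)\<^sup>2)" if t: "0 \<le> t" for t
  proof -
    have "integrable M (\<lambda>\<omega>. (N t \<omega>)\<^sup>2)" using N t by (simp add: sq_martingale_def)
    then show ?thesis
      by (rule integrable_cong_AE_imp) (use m[OF t] eq[OF t] in \<open>auto elim: eventually_mono\<close>)
  qed
  fix s t :: real and Z :: "'a \<Rightarrow> real"
  assume st: "0 \<le> s" "s \<le> t" and Z: "Z \<in> borel_measurable (F s)" "integrable M (\<lambda>\<omega>. (Z \<omega>)\<^sup>2)"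
  then have t: "0 \<le> t" by simp
  have [measurable]: "Z \<in> borel_measurable M" using Z st by (auto intro: measurable_F_M)
  note [measurable] = m[OF t] m[OF st(1)]
  have "(\<integral>\<omega>. Z \<omega> * (N' t \<omega> - N' s \<omega>) \<partial>M) = (\<integral>\<omega>. Z \<omega> * (N t \<omega> - N s \<omega>) \<partial>M)"
    by (rule integral_cong_AE) (use eq[OF t] eq[OF st(1)] in auto)
  then show "(\<integral>\<omega>. Z \<omega> * (N' t \<omega> - N' s \<omega>) \<partial>M) = 0"
    using N st Z by (simp add: sq_martingale_def)
qed

end

section \<open>Existence of the Ito integral of a continuous integrand\<close>

context brownian_filtration
begin

text \<open>By isometry and Doob a fast approximation of the integrand is a fast approximation of
  the integrals in \<open>sup_moment\<close>, and completeness yields a continuous adapted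
  limit.\<close>

lemma ito_exists:
  assumes H: "S2 H"
  obtains I where "is_ito_integral M F B H I"
proof -
  have ad: "adapted F H" and co: "continuous_process M H" using H by (auto simp: S2_def)
  have "AE \<omega> in M. continuous_on {0..} (\<lambda>t. B t \<omega>)" using brownian by (simp add: brownian_motion_def)
  then obtain N where N: "{\<omega>\<in>space M. \<not> continuous_on {0..} (\<lambda>t. B t \<omega>)} \<subseteq> N" "emeasure M N = 0" "N \<in> sets M"
    by (rule AE_E)
  \<comment> \<open>The paths of \<open>B\<close> are continuous only almost surely; completeness puts the exceptional set
    into \<open>F 0\<close>, so the integrals may be set to 0 there without losing adaptedness.\<close>
  define G where "G = space M - N"
  have "N \<in> null_sets M" using N by auto
  then have NF: "N \<in> sets (F 0)" using null_sets_F0 by auto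
  have GF: "G \<in> sets (F t)" if "0 \<le> t" for t
    using NF sets_F_mono[of 0 t] that space_F[of 0] sets.compl_sets[of N "F 0"] by (auto simp: G_def)
  have AEG: "AE \<omega> in M. \<omega> \<in> G"
    using \<open>N \<in> null_sets M\<close> by (auto intro!: AE_I'[of N] simp: G_def)
  \<comment> \<open>The horizon grows along with the precision, so one subsequence is fast on every
    bounded time interval.\<close>
  have "\<exists>k. sq_dist (real j) H (grid_process H k) < ennreal ((1/16)^j)" for j
  proof -
    have "eventually (\<lambda>k. sq_dist (real j) H (grid_process H k) < ennreal ((1/16)^j)) sequentially"
      by (rule order_tendstoD(2)[OF grid_process_sq_dist[OF H]]) auto
    then show ?thesis by (auto simp: eventually_sequentially)
  qed
  then obtain \<kappa> where \<kappa>: "\<And>j. sq_dist (real j) H (grid_process H (\<kappa> j)) < ennreal ((1/16)^j)" by metis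
  define P where "P j = grid_process H (\<kappa> j)" for j
  define n where "n j = Suc (\<kappa> j) * Suc (\<kappa> j)" for j
  define \<tau> where "\<tau> j i = real i / real (Suc (\<kappa> j))" for j i
  define \<eta> where "\<eta> j = grid_weight H (\<kappa> j)" for j
  have simple: "simple_integrand M F (n j) (\<tau> j) (\<eta> j)" for j
    unfolding n_def \<tau>_def \<eta>_def by (rule grid_integrand[OF ad])
  have P: "P j = simple_process (n j) (\<tau> j) (\<eta> j)" for j
    unfolding P_def n_def \<tau>_def \<eta>_def grid_process_def by (rule refl)
  have dP: "sq_dist T H (P j) \<le> ennreal ((1/16)^j)" if "T \<le> real j" for T j
    unfolding P_def by (rule order_trans[OF sq_dist_mono[OF that] less_imp_le[OF \<kappa>]])
  define S where "S j = simple_ito_integral B (n j) (\<tau> j) (\<eta> j)" for j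
  define S' where "S' j t = (\<lambda>\<omega>. indicator G \<omega> * S j t \<omega>)" for j t
  have mart: "sq_martingale (S j)" for j unfolding S_def by (rule simple_ito_martingale[OF simple])
  have ad': "adapted F (S' j)" for j
    using mart[of j] GF by (auto simp: adapted_def sq_martingale_def S'_def intro!: borel_measurable_times)
  have eq: "AE \<omega> in M. S' j t \<omega> = S j t \<omega>" for j t using AEG by eventually_elim (simp add: S'_def)
  have mart': "sq_martingale (S' j)" for j by (rule sq_martingale_cong_AE[OF mart ad' eq])
  have co': "continuous_process M (S' j)" for j
    unfolding continuous_process_def
  proof
    fix \<omega> assume w: "\<omega> \<in> space M"
    show "continuous_on {0..} (\<lambda>t. S' j t \<omega>)"
    proof (cases "\<omega> \<in> G")
      case True
      then have c: "continuous_on {0..} (\<lambda>t. B t \<omega>)" using N w by (auto simp: G_def)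
      have c': "continuous_on {0..} (\<lambda>t. B (min t r) \<omega>)" if "0 \<le> r" for r
        by (rule continuous_on_compose2[OF c]) (use that in \<open>auto intro!: continuous_intros\<close>)
      have "0 \<le> \<tau> j i" for i by (simp add: \<tau>_def)
      then show ?thesis using True
        unfolding S'_def S_def simple_ito_integral_def by (auto intro!: continuous_intros c')
    qed (simp add: S'_def)
  qed
  have tm: "time_measurable T H" "time_measurable T (P j)" if "0 \<le> T" for T j
    using time_measurable_continuous[OF ad co that] time_measurable_simple[OF simple] by (auto simp: P)
  \<comment> \<open>\<open>A = 16\<close> is Doob's 4 times the 2 + 2 from the triangle inequality
    through \<open>H\<close>.\<close>
  have cauchy: "\<exists>N A. A < \<infinity> \<and> (\<forall>j\<ge>N. sup_moment (\<lambda>t \<omega>. S' (Suc j) t \<omega> - S' j t \<omega>) T \<le> A * ennreal ((1/16)^j))"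
    if T: "0 \<le> T" for T
  proof -
    obtain N where N: "T \<le> real N" using real_arch_simple by blast
    have "sup_moment (\<lambda>t \<omega>. S' (Suc j) t \<omega> - S' j t \<omega>) T \<le> 16 * ennreal ((1/16)^j)" if j: "N \<le> j" for j
    proof -
      have "sup_moment (\<lambda>t \<omega>. S' (Suc j) t \<omega> - S' j t \<omega>) T
        \<le> 4 * (\<integral>\<^sup>+\<omega>. ennreal ((S' (Suc j) T \<omega> - S' j T \<omega>)\<^sup>2) \<partial>M)"
        by (intro doob sq_martingale_diff mart' continuous_process_diff co' T)
      also have "(\<integral>\<^sup>+\<omega>. ennreal ((S' (Suc j) T \<omega> - S' j T \<omega>)\<^sup>2) \<partial>M) = (\<integral>\<^sup>+\<omega>. ennreal ((S (Suc j) T \<omega> - S j T \<omega>)\<^sup>2) \<partial>M)"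
        by (rule nn_integral_cong_AE) (use eq[of "Suc j" T] eq[of j T] in \<open>eventually_elim, simp\<close>)
      also have "\<dots> = sq_dist T (P (Suc j)) (P j)"
        unfolding S_def P sq_dist_def by (rule simple_ito_diff_isometry[OF simple simple T])
      also have "\<dots> \<le> 2 * sq_dist T H (P (Suc j)) + 2 * sq_dist T H (P j)"
        using sq_dist_triangle[OF tm(2)[OF T, of "Suc j"] tm(1)[OF T] tm(2)[OF T, of j]]
        by (simp add: sq_dist_commute[of T "P (Suc j)" H])
      also have "\<dots> \<le> 2 * ennreal ((1/16)^j) + 2 * ennreal ((1/16)^j)"
      proof (intro add_mono mult_left_mono)
        show "sq_dist T H (P j) \<le> ennreal ((1/16)^j)" using N j by (intro dP) simp
        have "sq_dist T H (P (Suc j)) \<le> ennreal ((1/16)^Suc j)" using N j by (intro dP) simp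
        also have "\<dots> \<le> ennreal ((1/16)^j)" by (intro ennreal_leI power_decreasing) auto
        finally show "sq_dist T H (P (Suc j)) \<le> ennreal ((1/16)^j)" .
      qed auto
      finally show ?thesis by (simp add: distrib_right[symmetric] mult.assoc[symmetric] mult_left_mono)
    qed
    then show ?thesis by (intro exI[of _ N] exI[of _ "16::ennreal"]) auto
  qed
  obtain I where I: "adapted F I" "continuous_process M I"
    and limI: "\<And>T. 0 \<le> T \<Longrightarrow> (\<lambda>j. sup_moment (\<lambda>t \<omega>. S' j t \<omega> - I t \<omega>) T) \<longlonglongrightarrow> 0"
    using sup_moment_complete[OF ad' co' cauchy] by blast
  have lim1: "(\<lambda>j. sq_dist T H (P j)) \<longlonglongrightarrow> 0" if T: "0 \<le> T" for T
  proof (rule tendsto_sandwich[OF _ _ tendsto_const])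
    have "(\<lambda>j. ennreal ((1/16)^j)) \<longlonglongrightarrow> ennreal 0" by (intro tendsto_ennrealI LIMSEQ_power_zero) auto
    then show "(\<lambda>j. ennreal ((1/16)^j)) \<longlonglongrightarrow> 0" by simp
    obtain N where N: "T \<le> real N" using real_arch_simple by blast
    show "\<forall>\<^sub>F j in sequentially. sq_dist T H (P j) \<le> ennreal ((1/16)^j)"
      by (rule eventually_sequentiallyI[of N], rule dP) (use N in simp)
  qed auto
  have lim2: "(\<lambda>j. \<integral>\<^sup>+\<omega>. ennreal ((I t \<omega> - S j t \<omega>)\<^sup>2) \<partial>M) \<longlonglongrightarrow> 0" if t: "0 \<le> t" for t
  proof (rule tendsto_sandwich[OF _ _ tendsto_const limI[OF t]])
    have "(\<integral>\<^sup>+\<omega>. ennreal ((I t \<omega> - S j t \<omega>)\<^sup>2) \<partial>M) \<le> sup_moment (\<lambda>t \<omega>. S' j t \<omega> - I t \<omega>) t" for j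
      unfolding sup_moment_def
    proof (rule nn_integral_mono_AE)
      show "AE \<omega> in M. ennreal ((I t \<omega> - S j t \<omega>)\<^sup>2) \<le> supsq (\<lambda>t \<omega>. S' j t \<omega> - I t \<omega>) t \<omega>"
        using eq[of j t]
      proof eventually_elim
        fix \<omega> assume "S' j t \<omega> = S j t \<omega>"
        then show "ennreal ((I t \<omega> - S j t \<omega>)\<^sup>2) \<le> supsq (\<lambda>t \<omega>. S' j t \<omega> - I t \<omega>) t \<omega>"
          using supsq_upper[of t t "\<lambda>t \<omega>. S' j t \<omega> - I t \<omega>" \<omega>] t by (simp add: power2_commute[of "I t \<omega>"])
      qed
    qed
    then show "\<forall>\<^sub>F j in sequentially. (\<integral>\<^sup>+\<omega>. ennreal ((I t \<omega> - S j t \<omega>)\<^sup>2) \<partial>M) \<le> sup_moment (\<lambda>t \<omega>. S' j t \<omega> - I t \<omega>) t"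
      by simp
  qed auto
  have "is_ito_integral M F B H I"
    unfolding is_ito_integral_def
    using S2_ito_integrand[OF H] I simple lim1 lim2
    unfolding P S_def sq_dist_def by blast
  then show thesis by (rule that)
qed

end

section \<open>The drift\<close>

lemma continuous_set_integrable:
  fixes f :: "real \<Rightarrow> real"
  assumes "continuous_on {0..} f"
  shows "set_integrable lborel {0..t} f"
  by (rule borel_integrable_atLeastAtMost') (use assms in \<open>auto intro: continuous_on_subset\<close>)

text \<open>Cauchy-Schwarz against the indicator of \<open>[0,r]\<close>. The bound is the same for
  all \<open>r \<le> t\<close>, so the supremum over r may be taken on the left.\<close>

lemma set_integral_square_le:
  fixes f :: "real \<Rightarrow> real"
  assumes f: "continuous_on {0..} f" and r: "0 \<le> r" "r \<le> t"
  shows "ennreal ((LINT s:{0..r}|lborel. f s)\<^sup>2) \<le> ennreal t * (\<integral>\<^sup>+s\<in>{0..t}. ennreal ((f s)\<^sup>2) \<partial>lborel)"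
proof -
  have i: "integrable lborel (\<lambda>s. indicator {0..r} s *\<^sub>R f s)"
    using continuous_set_integrable[OF f, of r] by (simp add: set_integrable_def)
  have [measurable]: "(\<lambda>s. indicator {0..r} s * f s) \<in> borel_measurable borel"
    using borel_measurable_integrable[OF i] by simp
  let ?x = "LINT s:{0..r}|lborel. f s"
  have "ennreal \<bar>?x\<bar> \<le> (\<integral>\<^sup>+s. ennreal (norm (indicator {0..r} s *\<^sub>R f s)) \<partial>lborel)"
    unfolding set_lebesgue_integral_def using integral_norm_bound_ennreal[OF i] by simp
  also have "\<dots> = (\<integral>\<^sup>+s. indicator {0..r} s * ennreal \<bar>indicator {0..r} s * f s\<bar> \<partial>lborel)"
    by (intro nn_integral_cong) (auto simp: indicator_def)
  finally have "(ennreal \<bar>?x\<bar>)\<^sup>2 \<le> (\<integral>\<^sup>+s. indicator {0..r} s * ennreal \<bar>indicator {0..r} s * f s\<bar> \<partial>lborel)\<^sup>2"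
    by (intro power_mono) auto
  also have "\<dots> \<le> (\<integral>\<^sup>+s. (indicator {0..r} s)\<^sup>2 \<partial>lborel) * (\<integral>\<^sup>+s. (ennreal \<bar>indicator {0..r} s * f s\<bar>)\<^sup>2 \<partial>lborel)"
    by (rule Cauchy_Schwarz_nn_integral) auto
  also have "\<dots> \<le> ennreal t * (\<integral>\<^sup>+s\<in>{0..t}. ennreal ((f s)\<^sup>2) \<partial>lborel)"
  proof (intro mult_mono nn_integral_mono)
    have "(\<integral>\<^sup>+s. (indicator {0..r} s)\<^sup>2 \<partial>lborel) = (\<integral>\<^sup>+s. indicator {0..r} s \<partial>lborel)"
      by (intro nn_integral_cong) (auto simp: indicator_def)
    then show "(\<integral>\<^sup>+s. (indicator {0..r} s)\<^sup>2 \<partial>lborel) \<le> ennreal t" using r by (simp add: ennreal_leI)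
    fix s show "(ennreal \<bar>indicator {0..r} s * f s\<bar>)\<^sup>2 \<le> ennreal ((f s)\<^sup>2) * indicator {0..t} s"
      using r by (auto simp: indicator_def ennreal_power)
  qed auto
  finally show ?thesis by (simp add: ennreal_power)
qed

context complete_filtered_prob_space
begin

lemma drift_S2:
  assumes H: "S2 H"
  shows "S2 (\<lambda>t \<omega>. LINT s:{0..t}|lborel. H s \<omega>)"
  unfolding S2_def
proof (intro conjI allI impI)
  have ad: "adapted F H" and co: "continuous_process M H" using H by (auto simp: S2_def)
  have c: "continuous_on {0..} (\<lambda>s. H s \<omega>)" if "\<omega> \<in> space M" for \<omega> using co that by (auto simp: continuous_process_def)
  show "adapted F (\<lambda>t \<omega>. LINT s:{0..t}|lborel. H s \<omega>)"
    unfolding adapted_def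
  proof (intro allI impI)
    fix t :: real assume t: "0 \<le> t"
    have 1: "(\<lambda>(s, \<omega>). H s \<omega>) \<in> borel_measurable (restrict_space borel {0..t} \<Otimes>\<^sub>M F t)"
      by (rule continuous_process_joint_measurable[OF co t]) (use ad space_F adaptedD t in auto)
    have 2: "(\<lambda>x. (snd x, fst x)) \<in> measurable (F t \<Otimes>\<^sub>M lborel_upto t) (restrict_space borel {0..t} \<Otimes>\<^sub>M F t)"
      by (intro measurable_Pair measurable_fst measurable_compose[OF measurable_snd] measurable_ident_sets
          sets_restrict_space_cong) simp
    have "(\<lambda>(\<omega>, s). H s \<omega>) \<in> borel_measurable (F t \<Otimes>\<^sub>M lborel_upto t)"
      using measurable_compose[OF 2 1] by (simp add: split_beta')
    then have "(\<lambda>\<omega>. \<integral>s. H s \<omega> \<partial>lborel_upto t) \<in> borel_measurable (F t)"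
      using sigma_finite_measure.borel_measurable_lebesgue_integral[OF sigma_finite_lborel_upto] by blast
    then show "(\<lambda>\<omega>. LINT s:{0..t}|lborel. H s \<omega>) \<in> borel_measurable (F t)"
      by (simp add: integral_restrict_space set_lebesgue_integral_def)
  qed
  show "continuous_process M (\<lambda>t \<omega>. LINT s:{0..t}|lborel. H s \<omega>)"
    unfolding continuous_process_def
  proof (intro ballI continuous_on_atLeast_I)
    fix \<omega> and T :: real assume w: "\<omega> \<in> space M"
    have "continuous_on {0..T} (\<lambda>t. integral {0..t} (\<lambda>s. H s \<omega>))"
      by (intro indefinite_integral_continuous_1 integrable_continuous_real continuous_on_subset[OF c[OF w]]) auto
    then show "continuous_on {0..T} (\<lambda>t. LINT s:{0..t}|lborel. H s \<omega>)"
      by (simp add: set_borel_integral_eq_integral(2)[OF continuous_set_integrable[OF c[OF w]]])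
  qed
  fix T :: real assume T: "0 \<le> T"
  have "sup_moment (\<lambda>t \<omega>. LINT s:{0..t}|lborel. H s \<omega>) T
      \<le> (\<integral>\<^sup>+\<omega>. ennreal T * (\<integral>\<^sup>+s\<in>{0..T}. ennreal ((H s \<omega>)\<^sup>2) \<partial>lborel) \<partial>M)"
    unfolding sup_moment_def by (intro nn_integral_mono supsq_least set_integral_square_le c)
  also have "\<dots> \<le> (\<integral>\<^sup>+\<omega>. ennreal T * (supsq H T \<omega> * ennreal T) \<partial>M)"
  proof (intro nn_integral_mono mult_left_mono)
    fix \<omega>
    have "(\<integral>\<^sup>+s\<in>{0..T}. ennreal ((H s \<omega>)\<^sup>2) \<partial>lborel) \<le> (\<integral>\<^sup>+s\<in>{0..T}. supsq H T \<omega> \<partial>lborel)"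
      by (intro nn_integral_mono) (auto simp: indicator_def intro: supsq_upper)
    then show "(\<integral>\<^sup>+s\<in>{0..T}. ennreal ((H s \<omega>)\<^sup>2) \<partial>lborel) \<le> supsq H T \<omega> * ennreal T"
      by (simp add: nn_integral_const_upto[OF T])
  qed auto
  also have "\<dots> = ennreal T * (sup_moment H T * ennreal T)"
    using supsq_measurable_M[OF ad co T] by (simp add: nn_integral_cmult nn_integral_multc sup_moment_def)
  also have "\<dots> < \<infinity>" using H T by (simp add: S2_def ennreal_mult_less_top)
  finally show "sup_moment (\<lambda>t \<omega>. LINT s:{0..t}|lborel. H s \<omega>) T < \<infinity>" .
qed

lemma drift_sup_moment_diff:
  assumes H: "S2 H" and H': "S2 H'" and t: "0 \<le> t"
  shows "sup_moment (\<lambda>t \<omega>. (LINT s:{0..t}|lborel. H s \<omega>) - (LINT s:{0..t}|lborel. H' s \<omega>)) t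
    \<le> ennreal t * sq_dist t H H'"
proof -
  have tm: "time_measurable t H" "time_measurable t H'"
    using H H' t by (auto simp: S2_def intro: time_measurable_continuous)
  have "sup_moment (\<lambda>t \<omega>. (LINT s:{0..t}|lborel. H s \<omega>) - (LINT s:{0..t}|lborel. H' s \<omega>)) t
    \<le> (\<integral>\<^sup>+\<omega>. ennreal t * (\<integral>\<^sup>+s\<in>{0..t}. ennreal ((H s \<omega> - H' s \<omega>)\<^sup>2) \<partial>lborel) \<partial>M)"
    unfolding sup_moment_def
  proof (intro nn_integral_mono supsq_least)
    fix \<omega> r assume w: "\<omega> \<in> space M" and r: "0 \<le> r" "r \<le> t"
    have c: "continuous_on {0..} (\<lambda>s. H s \<omega>)" "continuous_on {0..} (\<lambda>s. H' s \<omega>)"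
      using H H' w by (auto simp: S2_def continuous_process_def)
    have "(LINT s:{0..r}|lborel. H s \<omega>) - (LINT s:{0..r}|lborel. H' s \<omega>) = (LINT s:{0..r}|lborel. H s \<omega> - H' s \<omega>)"
      by (rule set_integral_diff(2)[symmetric]) (intro continuous_set_integrable c)+
    then show "ennreal (((LINT s:{0..r}|lborel. H s \<omega>) - (LINT s:{0..r}|lborel. H' s \<omega>))\<^sup>2)
       \<le> ennreal t * (\<integral>\<^sup>+s\<in>{0..t}. ennreal ((H s \<omega> - H' s \<omega>)\<^sup>2) \<partial>lborel)"
      using set_integral_square_le[OF continuous_on_diff[OF c] r] by simp
  qed
  also have "\<dots> = ennreal t * sq_dist t H H'"
    unfolding sq_dist_def nn_integral_lborel_upto using time_measurable_inner(2)[OF tm] by (rule nn_integral_cmult)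
  finally show ?thesis .
qed

end

section \<open>The mean constraint\<close>

lemma running_sup_upper:
  fixes f :: "real \<Rightarrow> real"
  assumes "continuous_on {0..} f" "0 \<le> s" "s \<le> t"
  shows "f s \<le> (SUP s\<in>{0..t}. f s)"
proof (rule cSUP_upper)
  have "compact (f ` {0..t})"
    using assms by (intro compact_continuous_image) (auto intro: continuous_on_subset)
  then show "bdd_above (f ` {0..t})" by (intro bounded_imp_bdd_above compact_imp_bounded)
qed (use assms in auto)

text \<open>Between two times near \<open>t0\<close> the running supremum can grow by no more than
  the oscillation of \<open>f\<close> there, since any new value is compared with the value of
  \<open>f\<close> at the earlier time.\<close>

lemma running_sup_continuous:
  fixes f :: "real \<Rightarrow> real"
  assumes f: "continuous_on {0..} f"
  shows "continuous_on {0..} (\<lambda>t. SUP s\<in>{0..t}. f s)"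
  unfolding continuous_on_iff
proof (intro ballI allI impI)
  define S where "S t = (SUP s\<in>{0..t}. f s)" for t
  have up: "f s \<le> S t" if "0 \<le> s" "s \<le> t" for s t unfolding S_def by (rule running_sup_upper[OF f that])
  have least: "S t \<le> C" if "0 \<le> t" "\<And>s. 0 \<le> s \<Longrightarrow> s \<le> t \<Longrightarrow> f s \<le> C" for t C
    unfolding S_def by (rule cSUP_least) (use that in auto)
  fix t0 e :: real assume t0: "t0 \<in> {0..}" and e: "0 < e"
  obtain d where d: "0 < d" "\<And>s. 0 \<le> s \<Longrightarrow> \<bar>s - t0\<bar> < d \<Longrightarrow> \<bar>f s - f t0\<bar> < e / 4"
    using f t0 e unfolding continuous_on_iff dist_real_def
    by (metis atLeast_iff zero_less_divide_iff zero_less_numeral)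
  have step: "S v \<le> S u + e / 2" if "0 \<le> u" "u \<le> v" "\<bar>u - t0\<bar> < d" "\<bar>v - t0\<bar> < d" for u v
  proof (rule least)
    fix s assume s: "0 \<le> s" "s \<le> v"
    show "f s \<le> S u + e / 2"
    proof (cases "s \<le> u")
      case True then show ?thesis using up[of s u] s e by simp
    next
      case False
      then have "\<bar>s - t0\<bar> < d" using s that by linarith
      then have "\<bar>f s - f t0\<bar> < e / 4" "\<bar>f u - f t0\<bar> < e / 4" using d(2) s that by auto
      then show ?thesis using up[of u u] that by linarith
    qed
  qed (use that in auto)
  show "\<exists>d>0. \<forall>x'\<in>{0..}. dist x' t0 < d \<longrightarrow> dist (SUP s\<in>{0..x'}. f s) (SUP s\<in>{0..t0}. f s) < e"
  proof (intro exI[of _ d] conjI ballI impI)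
    fix t :: real assume t: "t \<in> {0..}" "dist t t0 < d"
    have mono: "S u \<le> S v" if "0 \<le> u" "u \<le> v" for u v
      by (rule least) (use that up in auto)
    have "\<bar>S t - S t0\<bar> \<le> e / 2"
      using step[of t t0] step[of t0 t] mono[of t t0] mono[of t0 t] t t0 d(1)
      by (cases "t \<le> t0") (auto simp: dist_real_def abs_le_iff)
    then show "dist (SUP s\<in>{0..t}. f s) (SUP s\<in>{0..t0}. f s) < e"
      using e unfolding S_def[symmetric] dist_real_def by linarith
  qed (rule d(1))
qed

text \<open>The side conditions of \<open>interval_measure\<close> for the extension used in
  \<open>flat_solution\<close>. Continuity at 0 also means that the starting time carries no
  mass.\<close>

lemma extended_by_constant:
  fixes K :: "real \<Rightarrow> real"
  assumes "mono_on {0..} K" "continuous_on {0..} K"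
  shows "\<And>x y. x \<le> y \<Longrightarrow> K (max 0 x) \<le> K (max 0 y)" "continuous_on UNIV (\<lambda>s. K (max 0 s))"
    "\<And>a. continuous (at_right a) (\<lambda>s. K (max 0 s))"
proof -
  show "K (max 0 x) \<le> K (max 0 y)" if "x \<le> y" for x y
    using that by (intro mono_onD[OF assms(1)]) auto
  show c: "continuous_on UNIV (\<lambda>s. K (max 0 s))"
    by (rule continuous_on_compose2[OF assms(2)]) (auto intro!: continuous_intros)
  show "continuous (at_right a) (\<lambda>s. K (max 0 s))" for a
    using c by (auto simp: continuous_on_eq_continuous_at intro: continuous_at_imp_continuous_at_within)
qed

section \<open>The critical level of the mean constraint\<close>

locale mean_reflection = complete_filtered_prob_space M F for M :: "'a measure" and F +
  fixes h :: "real \<Rightarrow> real" and m m' :: real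
  assumes mono_h: "mono h" and m_pos: "0 < m"
    and h_bilipschitz: "\<And>x y. m * \<bar>x - y\<bar> \<le> \<bar>h x - h y\<bar> \<and> \<bar>h x - h y\<bar> \<le> m' * \<bar>x - y\<bar>"
begin

lemma m'_pos: "0 < m'"
  using h_bilipschitz[of 1 0] m_pos by simp

lemma h_measurable[measurable]: "h \<in> borel_measurable borel"
  using mono_h by (rule borel_measurable_mono)

lemma h_integrable:
  assumes "integrable M Z"
  shows "integrable M (\<lambda>\<omega>. h (x + Z \<omega>))"
proof (rule Bochner_Integration.integrable_bound[of M "\<lambda>\<omega>. \<bar>h 0\<bar> + m' * (\<bar>x\<bar> + \<bar>Z \<omega>\<bar>)"])
  have [measurable]: "Z \<in> borel_measurable M" using assms by auto
  show "(\<lambda>\<omega>. h (x + Z \<omega>)) \<in> borel_measurable M" by measurable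
  show "AE \<omega> in M. norm (h (x + Z \<omega>)) \<le> norm (\<bar>h 0\<bar> + m' * (\<bar>x\<bar> + \<bar>Z \<omega>\<bar>))"
  proof (rule AE_I2)
    fix \<omega>
    have "\<bar>h (x + Z \<omega>) - h 0\<bar> \<le> m' * \<bar>x + Z \<omega>\<bar>" using h_bilipschitz[of "x + Z \<omega>" 0] by simp
    also have "\<dots> \<le> m' * (\<bar>x\<bar> + \<bar>Z \<omega>\<bar>)" using m'_pos by (intro mult_left_mono) auto
    finally show "norm (h (x + Z \<omega>)) \<le> norm (\<bar>h 0\<bar> + m' * (\<bar>x\<bar> + \<bar>Z \<omega>\<bar>))" by simp
  qed
qed (use assms in auto)

definition mean :: "real \<Rightarrow> ('a \<Rightarrow> real) \<Rightarrow> real" where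
  "mean x Z = (\<integral>\<omega>. h (x + Z \<omega>) \<partial>M)"

lemma mean_increasing:
  assumes Z: "integrable M Z" and xy: "x \<le> y"
  shows "m * (y - x) \<le> mean y Z - mean x Z"
proof -
  have "m * (y - x) \<le> h (y + z) - h (x + z)" for z
    using h_bilipschitz[of "y + z" "x + z"] monoD[OF mono_h, of "x + z" "y + z"] xy by simp
  then have "(\<integral>\<omega>. m * (y - x) \<partial>M) \<le> (\<integral>\<omega>. h (y + Z \<omega>) - h (x + Z \<omega>) \<partial>M)"
    by (intro integral_mono Bochner_Integration.integrable_diff h_integrable Z) auto
  also have "\<dots> = mean y Z - mean x Z"
    unfolding mean_def by (intro Bochner_Integration.integral_diff h_integrable Z)
  finally show ?thesis by (simp add: prob_space)
qed

lemma mean_lipschitz: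
  assumes Z: "integrable M Z" "integrable M Z'"
  shows "\<bar>mean x Z - mean y Z'\<bar> \<le> m' * (\<bar>x - y\<bar> + (\<integral>\<omega>. \<bar>Z \<omega> - Z' \<omega>\<bar> \<partial>M))"
proof -
  have "\<bar>h (x + z) - h (y + z')\<bar> \<le> m' * (\<bar>x - y\<bar> + \<bar>z - z'\<bar>)" for z z'
  proof -
    have "\<bar>h (x + z) - h (y + z')\<bar> \<le> m' * \<bar>(x + z) - (y + z')\<bar>" using h_bilipschitz by blast
    also have "\<dots> \<le> m' * (\<bar>x - y\<bar> + \<bar>z - z'\<bar>)" using m'_pos by (intro mult_left_mono) auto
    finally show ?thesis .
  qed
  then have "(\<integral>\<omega>. \<bar>h (x + Z \<omega>) - h (y + Z' \<omega>)\<bar> \<partial>M) \<le> (\<integral>\<omega>. m' * (\<bar>x - y\<bar> + \<bar>Z \<omega> - Z' \<omega>\<bar>) \<partial>M)"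
    using Z by (intro integral_mono) (auto intro!: h_integrable)
  also have "\<dots> = m' * (\<bar>x - y\<bar> + (\<integral>\<omega>. \<bar>Z \<omega> - Z' \<omega>\<bar> \<partial>M))"
    using Z by (simp add: prob_space)
  finally have *: "(\<integral>\<omega>. \<bar>h (x + Z \<omega>) - h (y + Z' \<omega>)\<bar> \<partial>M) \<le> m' * (\<bar>x - y\<bar> + (\<integral>\<omega>. \<bar>Z \<omega> - Z' \<omega>\<bar> \<partial>M))" .
  have "mean x Z - mean y Z' = (\<integral>\<omega>. h (x + Z \<omega>) - h (y + Z' \<omega>) \<partial>M)"
    unfolding mean_def by (intro Bochner_Integration.integral_diff[symmetric] h_integrable Z)
  then show ?thesis using order_trans[OF integral_abs_bound *] by simp
qed

lemma mean_critical_exists: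
  assumes Z: "integrable M Z"
  shows "\<exists>x. mean x Z = 0"
proof -
  \<comment> \<open>The mean grows at least with slope m, so it changes sign within this distance of
    0.\<close>
  define c where "c = \<bar>mean 0 Z\<bar> / m"
  have c: "0 \<le> c" "m * c = \<bar>mean 0 Z\<bar>" using m_pos by (auto simp: c_def)
  have 1: "mean (- c) Z \<le> 0" using mean_increasing[OF Z, of "-c" 0] c by simp
  have 2: "0 \<le> mean c Z" using mean_increasing[OF Z, of 0 c] c by simp
  have "continuous_on {-c..c} (\<lambda>x. mean x Z)"
    unfolding continuous_on_iff
  proof (intro ballI allI impI)
    fix x e :: real assume e: "0 < e"
    have "dist (mean y Z) (mean x Z) < e" if "dist y x < e / m'" for y
      using mean_lipschitz[OF Z Z, of y x] that m'_pos by (simp add: dist_real_def field_simps)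
    then show "\<exists>d>0. \<forall>y\<in>{-c..c}. dist y x < d \<longrightarrow> dist (mean y Z) (mean x Z) < e"
      using e m'_pos by (intro exI[of _ "e / m'"]) auto
  qed
  then obtain x where "mean x Z = 0" using IVT'[of "\<lambda>x. mean x Z" "-c" 0 c] 1 2 c by auto
  then show ?thesis by blast
qed

text \<open>The signed level: it is negative when the constraint holds with slack, and
  \<open>G0\<close> of the law is its positive part.\<close>

definition critical :: "('a \<Rightarrow> real) \<Rightarrow> real" where
  "critical Z = (SOME x. mean x Z = 0)"

lemma mean_critical: "integrable M Z \<Longrightarrow> mean (critical Z) Z = 0"
  unfolding critical_def by (rule someI_ex[OF mean_critical_exists])

text \<open>Strict monotonicity in the shift turns the constraint on means into a comparison of real
  numbers. Reflection in mean thus becomes the one-dimensional deterministic problem of keeping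
  \<open>K\<close> above the curve of critical levels.\<close>

lemma mean_nonneg_iff:
  assumes Z: "integrable M Z"
  shows "0 \<le> mean x Z \<longleftrightarrow> critical Z \<le> x" and "0 < mean x Z \<longleftrightarrow> critical Z < x"
proof -
  have "mean x Z < 0" if "x < critical Z"
    using mean_increasing[OF Z, of x "critical Z"] mean_critical[OF Z] mult_pos_pos[OF m_pos, of "critical Z - x"] that
    by simp
  moreover have "0 < mean x Z" if "critical Z < x"
    using mean_increasing[OF Z, of "critical Z" x] mean_critical[OF Z] mult_pos_pos[OF m_pos, of "x - critical Z"] that
    by simp
  moreover note mean_critical[OF Z]
  ultimately show "0 \<le> mean x Z \<longleftrightarrow> critical Z \<le> x" "0 < mean x Z \<longleftrightarrow> critical Z < x"
    by (cases x "critical Z" rule: linorder_cases; auto)+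
qed

lemma Inf_mean_nonneg:
  assumes Z: "integrable M Z"
  shows "Inf {x. 0 \<le> x \<and> 0 \<le> (\<integral>\<omega>. h (x + Z \<omega>) \<partial>M)} = max 0 (critical Z)"
proof -
  have "{x. 0 \<le> x \<and> 0 \<le> mean x Z} = {max 0 (critical Z)..}"
    unfolding mean_nonneg_iff(1)[OF Z] by auto
  then show ?thesis unfolding mean_def by simp
qed

lemma G0_law:
  assumes Z: "integrable M Z"
  shows "G0 h (law M Z) = max 0 (critical Z)"
proof -
  have [measurable]: "Z \<in> borel_measurable M" using Z by auto
  have "(\<integral>z. h (x + z) \<partial>law M Z) = (\<integral>\<omega>. h (x + Z \<omega>) \<partial>M)" for x
    by (subst integral_distr) auto
  then show ?thesis by (simp add: G0_def Inf_mean_nonneg[OF Z])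
qed

text \<open>Both critical levels are inserted into the mean for \<open>Z\<close>. The lower slope m
  bounds their distance by the gap of the means, and this gap is only the effect of replacing
  \<open>Z'\<close> by \<open>Z\<close> at one level, which \<open>m'\<close> controls.\<close>

lemma critical_lipschitz:
  assumes Z: "integrable M Z" "integrable M Z'"
  shows "\<bar>critical Z - critical Z'\<bar> \<le> m' / m * (\<integral>\<omega>. \<bar>Z \<omega> - Z' \<omega>\<bar> \<partial>M)"
proof -
  have "m * \<bar>critical Z - critical Z'\<bar> \<le> \<bar>mean (critical Z) Z - mean (critical Z') Z\<bar>"
    using mean_increasing[OF Z(1), of "critical Z" "critical Z'"] mean_increasing[OF Z(1), of "critical Z'" "critical Z"]
    by (cases "critical Z \<le> critical Z'") (auto simp: abs_if)
  also have "\<dots> = \<bar>mean (critical Z') Z - mean (critical Z') Z'\<bar>"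
    using mean_critical[OF Z(1)] mean_critical[OF Z(2)] by simp
  also have "\<dots> \<le> m' * (\<integral>\<omega>. \<bar>Z \<omega> - Z' \<omega>\<bar> \<partial>M)"
    using mean_lipschitz[OF Z, of "critical Z'" "critical Z'"] by simp
  finally show ?thesis using m_pos by (simp add: field_simps)
qed

lemma critical_square_le:
  assumes [measurable]: "Z \<in> borel_measurable M" "Z' \<in> borel_measurable M"
    and i: "integrable M (\<lambda>\<omega>. (Z \<omega>)\<^sup>2)" "integrable M (\<lambda>\<omega>. (Z' \<omega>)\<^sup>2)"
  shows "(critical Z - critical Z')\<^sup>2 \<le> (m' / m)\<^sup>2 * (\<integral>\<omega>. (Z \<omega> - Z' \<omega>)\<^sup>2 \<partial>M)"
proof -
  have iZ: "integrable M Z" "integrable M Z'"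
    by (rule square_integrable_imp_integrable; use i in simp)+
  have "\<bar>critical Z - critical Z'\<bar>\<^sup>2 \<le> (m' / m * (\<integral>\<omega>. \<bar>Z \<omega> - Z' \<omega>\<bar> \<partial>M))\<^sup>2"
    by (intro power_mono critical_lipschitz iZ) auto
  also have "\<dots> = (m' / m)\<^sup>2 * (\<integral>\<omega>. \<bar>Z \<omega> - Z' \<omega>\<bar> \<partial>M)\<^sup>2" by (rule power_mult_distrib)
  also have "\<dots> \<le> (m' / m)\<^sup>2 * (\<integral>\<omega>. (Z \<omega> - Z' \<omega>)\<^sup>2 \<partial>M)"
    by (intro mult_left_mono expectation_abs_square_le(2) integrable_square_diff i) auto
  finally show ?thesis by simp
qed

lemma critical_continuous:
  assumes U: "S2 U"
  shows "continuous_on {0..} (\<lambda>t. critical (U t))"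
  unfolding continuous_on_sequentially
proof (intro ballI allI impI)
  fix u :: "nat \<Rightarrow> real" and t :: real assume t: "t \<in> {0..}" and u: "(\<forall>n. u n \<in> {0..}) \<and> u \<longlonglongrightarrow> t"
  have "(\<lambda>n. (m' / m)\<^sup>2 * (\<integral>\<omega>. (U (u n) \<omega> - U t \<omega>)\<^sup>2 \<partial>M)) \<longlonglongrightarrow> (m' / m)\<^sup>2 * 0"
    using t u by (intro tendsto_intros S2_mean_square_continuous[OF U]) auto
  then have lim: "(\<lambda>n. (m' / m)\<^sup>2 * (\<integral>\<omega>. (U (u n) \<omega> - U t \<omega>)\<^sup>2 \<partial>M)) \<longlonglongrightarrow> 0" by simp
  have "(critical (U (u n)) - critical (U t))\<^sup>2 \<le> (m' / m)\<^sup>2 * (\<integral>\<omega>. (U (u n) \<omega> - U t \<omega>)\<^sup>2 \<partial>M)" for n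
    using t u by (intro critical_square_le S2_measurable[OF U] S2_square_integrable[OF U]) auto
  from tendsto_square_le[OF this lim]
  show "((\<lambda>t. critical (U t)) \<circ> u) \<longlonglongrightarrow> critical (U t)" by (simp add: comp_def)
qed

lemma mean_continuous:
  assumes U: "S2 U" and K: "continuous_on {0..} K"
  shows "continuous_on {0..} (\<lambda>t. mean (K t) (U t))"
  unfolding continuous_on_sequentially
proof (intro ballI allI impI)
  fix u :: "nat \<Rightarrow> real" and t :: real assume t: "t \<in> {0..}" and u: "(\<forall>n. u n \<in> {0..}) \<and> u \<longlonglongrightarrow> t"
  have "(\<lambda>n. K (u n)) \<longlonglongrightarrow> K t"
    by (rule continuous_on_tendsto_compose[OF K]) (use t u in auto)
  moreover have "(\<lambda>n. \<integral>\<omega>. (U (u n) \<omega> - U t \<omega>)\<^sup>2 \<partial>M) \<longlonglongrightarrow> 0"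
    using t u by (intro S2_mean_square_continuous[OF U]) auto
  ultimately have "(\<lambda>n. 2 * m'\<^sup>2 * ((K (u n) - K t)\<^sup>2 + (\<integral>\<omega>. (U (u n) \<omega> - U t \<omega>)\<^sup>2 \<partial>M)))
     \<longlonglongrightarrow> 2 * m'\<^sup>2 * ((K t - K t)\<^sup>2 + 0)" by (intro tendsto_intros)
  then have lim: "(\<lambda>n. 2 * m'\<^sup>2 * ((K (u n) - K t)\<^sup>2 + (\<integral>\<omega>. (U (u n) \<omega> - U t \<omega>)\<^sup>2 \<partial>M))) \<longlonglongrightarrow> 0" by simp
  have "(mean (K (u n)) (U (u n)) - mean (K t) (U t))\<^sup>2
     \<le> 2 * m'\<^sup>2 * ((K (u n) - K t)\<^sup>2 + (\<integral>\<omega>. (U (u n) \<omega> - U t \<omega>)\<^sup>2 \<partial>M))" for n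
  proof -
    have n: "0 \<le> u n" "0 \<le> t" using t u by auto
    let ?a = "\<bar>K (u n) - K t\<bar>" and ?b = "\<integral>\<omega>. \<bar>U (u n) \<omega> - U t \<omega>\<bar> \<partial>M"
    have "\<bar>mean (K (u n)) (U (u n)) - mean (K t) (U t)\<bar>\<^sup>2 \<le> (m' * (?a + ?b))\<^sup>2"
      by (intro power_mono mean_lipschitz S2_integrable[OF U] n) auto
    also have "\<dots> = m'\<^sup>2 * (?a + ?b)\<^sup>2" by (rule power_mult_distrib)
    also have "\<dots> \<le> m'\<^sup>2 * (2 * ?a\<^sup>2 + 2 * ?b\<^sup>2)"
      using sum_squares_bound[of ?a ?b] by (intro mult_left_mono) (auto simp: power2_sum)
    also have "\<dots> \<le> m'\<^sup>2 * (2 * ?a\<^sup>2 + 2 * (\<integral>\<omega>. (U (u n) \<omega> - U t \<omega>)\<^sup>2 \<partial>M))"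
      by (intro mult_left_mono add_left_mono expectation_abs_square_le(2) integrable_square_diff
          borel_measurable_diff S2_measurable[OF U] S2_square_integrable[OF U] n) auto
    finally show ?thesis by (simp add: algebra_simps)
  qed
  from tendsto_square_le[OF this lim]
  show "((\<lambda>t. mean (K t) (U t)) \<circ> u) \<longlonglongrightarrow> mean (K t) (U t)" by (simp add: comp_def)
qed

section \<open>The deterministic Skorokhod problem\<close>

definition regulator :: "(real \<Rightarrow> 'a \<Rightarrow> real) \<Rightarrow> real \<Rightarrow> real" where
  "regulator U t = (SUP s\<in>{0..t}. max 0 (critical (U s)))"

lemma max_critical_continuous: "S2 U \<Longrightarrow> continuous_on {0..} (\<lambda>t. max 0 (critical (U t)))"
  by (intro continuous_intros critical_continuous)

lemma regulator_upper: "S2 U \<Longrightarrow> 0 \<le> s \<Longrightarrow> s \<le> t \<Longrightarrow> max 0 (critical (U s)) \<le> regulator U t"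
  unfolding regulator_def by (rule running_sup_upper[OF max_critical_continuous])

lemma regulator_least: "0 \<le> t \<Longrightarrow> (\<And>s. 0 \<le> s \<Longrightarrow> s \<le> t \<Longrightarrow> max 0 (critical (U s)) \<le> C) \<Longrightarrow> regulator U t \<le> C"
  unfolding regulator_def by (rule cSUP_least) auto

lemma regulator_continuous: "S2 U \<Longrightarrow> continuous_on {0..} (regulator U)"
  using running_sup_continuous[OF max_critical_continuous[of U]] unfolding regulator_def[abs_def] .

lemma regulator_mono: "S2 U \<Longrightarrow> 0 \<le> s \<Longrightarrow> s \<le> t \<Longrightarrow> regulator U s \<le> regulator U t"
  by (rule regulator_least) (auto intro: regulator_upper[THEN order_trans[rotated]] dest: regulator_upper[of U _ t])

lemma regulator_nonneg: "S2 U \<Longrightarrow> 0 \<le> t \<Longrightarrow> 0 \<le> regulator U t"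
  using regulator_upper[of U t t] by simp

lemma regulator_0:
  assumes U: "S2 U" and "0 \<le> mean 0 (U 0)"
  shows "regulator U 0 = 0"
proof -
  have "critical (U 0) \<le> 0" using mean_nonneg_iff(1)[OF S2_integrable[OF U], of 0 0] assms by simp
  then have "regulator U 0 \<le> 0" by (intro regulator_least) auto
  then show ?thesis using regulator_nonneg[OF U, of 0] by simp
qed

lemma regulator_mean_nonneg:
  assumes U: "S2 U" and t: "0 \<le> t"
  shows "0 \<le> mean (regulator U t) (U t)"
  using regulator_upper[OF U t order_refl] by (subst mean_nonneg_iff[OF S2_integrable[OF U t]]) simp

text \<open>Positive part and running supremum are both non-expansive for uniform distance.\<close>

lemma regulator_diff_le:
  assumes U: "S2 U" "S2 U'" and t: "0 \<le> t"
    and le: "\<And>s. 0 \<le> s \<Longrightarrow> s \<le> t \<Longrightarrow> \<bar>critical (U s) - critical (U' s)\<bar> \<le> C"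
  shows "\<bar>regulator U t - regulator U' t\<bar> \<le> C"
proof -
  have "regulator U t \<le> regulator U' t + C"
  proof (rule regulator_least[OF t])
    fix s assume s: "0 \<le> s" "s \<le> t"
    show "max 0 (critical (U s)) \<le> regulator U' t + C"
      using le[OF s] regulator_upper[OF U(2) s] by linarith
  qed
  moreover have "regulator U' t \<le> regulator U t + C"
  proof (rule regulator_least[OF t])
    fix s assume s: "0 \<le> s" "s \<le> t"
    show "max 0 (critical (U' s)) \<le> regulator U t + C"
      using le[OF s] regulator_upper[OF U(1) s] by linarith
  qed
  ultimately show ?thesis by linarith
qed

text \<open>The second moment at each single time is at most \<open>sup_moment\<close>, so one bound
  serves all levels up to t and passes through the running maximum.\<close>

lemma regulator_diff_square_le:
  assumes U: "S2 U" "S2 U'" and s: "0 \<le> s" "s \<le> t"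
  shows "ennreal ((regulator U s - regulator U' s)\<^sup>2) \<le> ennreal ((m' / m)\<^sup>2) * sup_moment (\<lambda>t \<omega>. U t \<omega> - U' t \<omega>) t"
proof -
  have D: "S2 (\<lambda>t \<omega>. U t \<omega> - U' t \<omega>)" by (rule S2_diff[OF U])
  define v where "v = enn2real (sup_moment (\<lambda>t \<omega>. U t \<omega> - U' t \<omega>) t)"
  have v: "sup_moment (\<lambda>t \<omega>. U t \<omega> - U' t \<omega>) t = ennreal v" "0 \<le> v"
    using D s by (auto simp: v_def S2_def)
  have "\<bar>critical (U r) - critical (U' r)\<bar> \<le> m' / m * sqrt v" if r: "0 \<le> r" "r \<le> s" for r
  proof -
    have "ennreal (\<integral>\<omega>. (U r \<omega> - U' r \<omega>)\<^sup>2 \<partial>M) \<le> ennreal v"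
      unfolding v(1)[symmetric] by (rule square_moment_le_sup_moment[OF D]) (use r s in auto)
    then have e: "(\<integral>\<omega>. (U r \<omega> - U' r \<omega>)\<^sup>2 \<partial>M) \<le> v" using v(2) by (simp add: ennreal_le_iff)
    have "(critical (U r) - critical (U' r))\<^sup>2 \<le> (m' / m)\<^sup>2 * (\<integral>\<omega>. (U r \<omega> - U' r \<omega>)\<^sup>2 \<partial>M)"
      using r by (intro critical_square_le S2_measurable S2_square_integrable U) auto
    also have "\<dots> \<le> (m' / m)\<^sup>2 * v" by (intro mult_left_mono e) auto
    also have "\<dots> = (m' / m * sqrt v)\<^sup>2" using v(2) by (simp add: power_mult_distrib power_divide)
    finally have "\<bar>critical (U r) - critical (U' r)\<bar> \<le> \<bar>m' / m * sqrt v\<bar>" by (simp only: abs_le_square_iff)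
    then show ?thesis using m_pos m'_pos v(2) by (simp add: abs_mult)
  qed
  then have "\<bar>regulator U s - regulator U' s\<bar> \<le> m' / m * sqrt v" by (rule regulator_diff_le[OF U s(1)])
  then have "\<bar>regulator U s - regulator U' s\<bar>\<^sup>2 \<le> (m' / m * sqrt v)\<^sup>2" by (intro power_mono) auto
  then have "(regulator U s - regulator U' s)\<^sup>2 \<le> (m' / m)\<^sup>2 * v" using v(2) by (simp add: power_mult_distrib power_divide)
  then have "ennreal ((regulator U s - regulator U' s)\<^sup>2) \<le> ennreal ((m' / m)\<^sup>2 * v)" by (rule ennreal_leI)
  then show ?thesis using v by (simp add: ennreal_mult)
qed

text \<open>The measure of the regulator gives no mass to times of slack, where it stands strictly
  above the critical level, and at all other times the integrand is zero.\<close>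

lemma regulator_flat:
  assumes U: "S2 U" and t: "0 \<le> t"
  shows "(LINT s:{0..t}|interval_measure (\<lambda>s. regulator U (max 0 s)). mean (regulator U s) (U s)) = 0"
proof -
  \<comment> \<open>Both curves are extended by their values at 0, so that neighbourhoods of time 0
    may be two-sided and \<open>p\<close> may be negative.\<close>
  let ?K = "\<lambda>s. regulator U (max 0 s)" and ?R = "\<lambda>s. critical (U (max 0 s))"
  let ?\<mu> = "interval_measure ?K"
  have mono: "mono_on {0..} (regulator U)" using U by (auto intro!: mono_onI regulator_mono)
  note ext = extended_by_constant[OF mono regulator_continuous[OF U]]
  have cR: "continuous_on UNIV ?R"
    by (rule continuous_on_compose2[OF critical_continuous[OF U]]) (auto intro!: continuous_intros)
  \<comment> \<open>The regulator is constant near every time at which the constraint is inactive, so the rational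
    intervals of constancy cover these times.\<close>
  define Q where "Q = {(p, q). p \<in> \<rat> \<and> q \<in> \<rat> \<and> p \<le> q \<and> ?K p = ?K q}"
  define N where "N = (\<Union>(p, q)\<in>Q. {p<..q})"
  have "Q \<subseteq> \<rat> \<times> \<rat>" by (auto simp: Q_def)
  then have cQ: "countable Q" by (rule countable_subset) (intro countable_SIGMA countable_rat)
  have "N \<in> null_sets ?\<mu>"
    unfolding N_def
  proof (rule null_sets_UN'[OF cQ])
    fix x assume "x \<in> Q"
    then obtain p q where x: "x = (p, q)" "p \<le> q" "?K p = ?K q" by (auto simp: Q_def)
    have "emeasure ?\<mu> {p<..q} = 0"
      by (subst emeasure_interval_measure_Ioc[OF x(2) ext(1) ext(3)]) (simp_all add: x(3))
    then show "(case x of (p, q) \<Rightarrow> {p<..q}) \<in> null_sets ?\<mu>" by (auto simp: x(1) intro!: null_setsI)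
  qed
  have loc: "s \<in> N" if s: "?R s < ?K s" for s
  proof -
    \<comment> \<open>Near s the critical level stays below c and the regulator above it. Critical
      levels met between p and q therefore cannot raise the maximum already attained at p.\<close>
    define c where "c = (?R s + ?K s) / 2"
    have c: "?R s < c" "c < ?K s" using s by (auto simp: c_def)
    have "isCont ?R s" "isCont ?K s" using cR ext(2) by (simp_all add: continuous_on_eq_continuous_at)
    moreover have "(f \<longlongrightarrow> f s) (nhds s)" if "isCont f s" for f :: "real \<Rightarrow> real"
      using that unfolding isCont_def tendsto_at_iff_tendsto_nhds .
    ultimately have lim: "(?R \<longlongrightarrow> ?R s) (nhds s)" "(?K \<longlongrightarrow> ?K s) (nhds s)" by blast+
    have "\<forall>\<^sub>F v in nhds s. ?R v < c" by (rule order_tendstoD(2)[OF lim(1) c(1)])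
    moreover have "\<forall>\<^sub>F v in nhds s. c < ?K v" by (rule order_tendstoD(1)[OF lim(2) c(2)])
    ultimately have "\<forall>\<^sub>F v in nhds s. ?R v < c \<and> c < ?K v" by eventually_elim simp
    then obtain d where d: "0 < d" "\<And>v. \<bar>v - s\<bar> < d \<Longrightarrow> ?R v < c \<and> c < ?K v"
      unfolding eventually_nhds_metric dist_real_def by blast
    obtain p where p: "p \<in> \<rat>" "s - d < p" "p < s" using Rats_dense_in_real[of "s - d" s] d(1) by auto
    obtain q where q: "q \<in> \<rat>" "s < q" "q < s + d" using Rats_dense_in_real[of s "s + d"] d(1) by auto
    have Kp: "c < ?K p" using d(2)[of p] p by auto
    have "?K q \<le> ?K p"
    proof (rule regulator_least)
      fix w assume w: "0 \<le> w" "w \<le> max 0 q"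
      show "max 0 (critical (U w)) \<le> ?K p"
      proof (cases "w \<le> max 0 p")
        case True show ?thesis by (rule regulator_upper[OF U w(1) True])
      next
        case False
        then have "\<bar>w - s\<bar> < d" using w p q by auto
        then have "?R w < c" using d(2) by blast
        then have "critical (U w) \<le> ?K p" using w Kp by (simp add: max_def)
        then show ?thesis using regulator_nonneg[OF U, of "max 0 p"] by simp
      qed
    qed simp
    then have "?K p = ?K q" using ext(1)[of p q] p q by simp
    then have "(p, q) \<in> Q" using p q by (auto simp: Q_def)
    then show "s \<in> N" unfolding N_def using p q by (intro UN_I[of "(p, q)"]) auto
  qed
  have "AE s in ?\<mu>. indicator {0..t} s *\<^sub>R mean (regulator U s) (U s) = 0"
  proof (rule AE_I'[OF \<open>N \<in> null_sets ?\<mu>\<close>], safe)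
    fix s assume "indicator {0..t} s *\<^sub>R mean (regulator U s) (U s) \<noteq> 0"
    then have s: "0 \<le> s" and ne: "mean (regulator U s) (U s) \<noteq> 0" by (auto simp: indicator_def split: if_splits)
    then have "critical (U s) < regulator U s"
      using regulator_mean_nonneg[OF U s] mean_nonneg_iff(2)[OF S2_integrable[OF U s], of "regulator U s"] by simp
    then show "s \<in> N" using s by (intro loc) simp
  qed
  then show ?thesis unfolding set_lebesgue_integral_def by (rule integral_eq_zero_AE)
qed

text \<open>Minimality is immediate: \<open>K\<close> is non-decreasing, non-negative and above each
  critical level. If it exceeded the regulator, then on its last climb the mean would be positive,
  and flatness would forbid that climb.\<close>

lemma regulator_unique:
  assumes U: "S2 U" and K: "mono_on {0..} K" "continuous_on {0..} K" "K 0 = 0"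
    and nonneg: "\<And>t. 0 \<le> t \<Longrightarrow> 0 \<le> mean (K t) (U t)"
    and flat: "\<And>t. 0 \<le> t \<Longrightarrow> (LINT s:{0..t}|interval_measure (\<lambda>s. K (max 0 s)). mean (K s) (U s)) = 0"
    and t: "0 \<le> t"
  shows "K t = regulator U t"
proof (rule antisym)
  have critical_le: "critical (U s) \<le> K s" if "0 \<le> s" for s
    using nonneg[OF that] mean_nonneg_iff(1)[OF S2_integrable[OF U that]] by simp
  have mono: "K s \<le> K s'" if "0 \<le> s" "s \<le> s'" for s s' using that by (intro mono_onD[OF K(1)]) auto
  show "regulator U t \<le> K t"
  proof (rule regulator_least[OF t])
    fix s assume s: "0 \<le> s" "s \<le> t"
    show "max 0 (critical (U s)) \<le> K t"
      using critical_le[OF s(1)] mono[OF s] mono[of 0 t] t K(3) by simp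
  qed
  show "K t \<le> regulator U t"
  proof (rule ccontr)
    assume "\<not> K t \<le> regulator U t"
    then have less: "regulator U t < K t" by simp
    \<comment> \<open>\<open>K\<close> reaches this intermediate value at some u. From u to t it
      lies strictly above all critical levels, although it still has to climb from c to
      \<open>K t\<close>.\<close>
    define c where "c = (regulator U t + K t) / 2"
    have c: "regulator U t < c" "c < K t" using less by (auto simp: c_def)
    have c0: "K 0 \<le> c" using c regulator_nonneg[OF U t] K(3) by simp
    have "continuous_on {0..t} K" using K(2) by (rule continuous_on_subset) auto
    then obtain u where u: "0 \<le> u" "u \<le> t" "K u = c" using IVT'[of K 0 c t] c0 c t by auto
    let ?K = "\<lambda>s. K (max 0 s)" and ?g = "\<lambda>s. indicator {0..t} s *\<^sub>R mean (K s) (U s)"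
    let ?\<mu> = "interval_measure ?K"
    note ext = extended_by_constant[OF K(1,2)]
    have gc: "continuous_on {0..t} (\<lambda>s. mean (K s) (U s))"
      by (rule continuous_on_subset[OF mean_continuous[OF U K(2)]]) auto
    then have "?g \<in> borel_measurable borel" by (intro borel_measurable_continuous_on_indicator) auto
    then have gm: "?g \<in> borel_measurable ?\<mu>" by simp
    have "bounded ((\<lambda>s. mean (K s) (U s)) ` {0..t})"
      by (intro compact_imp_bounded compact_continuous_image gc) simp
    then obtain C where "\<forall>x\<in>(\<lambda>s. mean (K s) (U s)) ` {0..t}. norm x \<le> C" unfolding bounded_iff by blast
    then have C: "\<bar>mean (K s) (U s)\<bar> \<le> C" if "s \<in> {0..t}" for s using that by auto
    have "emeasure ?\<mu> {0..t} = ennreal (?K t - ?K 0)"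
      by (rule emeasure_interval_measure_Icc[OF t ext(1) ext(2)])
    then have fin: "emeasure ?\<mu> {0..t} < \<infinity>" by simp
    \<comment> \<open>Integrability comes first: a Bochner integral is also 0 by default for
      non-integrable functions, and only here does its vanishing force a non-negative integrand to
      vanish almost everywhere.\<close>
    have gi: "integrable ?\<mu> ?g"
      by (rule integrableI_bounded_set[of "{0..t}" _ _ C])
         (use gm fin C in \<open>auto simp: indicator_def\<close>)
    have g0: "0 \<le> ?g s" for s using nonneg by (auto simp: indicator_def)
    have "(\<integral>s. ?g s \<partial>?\<mu>) = 0" using flat[OF t] by (simp add: set_lebesgue_integral_def)
    then have "AE s in ?\<mu>. ?g s = 0"
      using integral_nonneg_eq_0_iff_AE[OF gi] g0 by simp
    moreover have "?g s \<noteq> 0" if s: "s \<in> {u<..t}" for s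
    proof -
      have s0: "0 \<le> s" "s \<le> t" "u \<le> s" using s u by auto
      have "critical (U s) \<le> regulator U t" using regulator_upper[OF U s0(1,2)] by simp
      also have "\<dots> < K s" using c(1) mono[OF u(1) s0(3)] u(3) by simp
      finally have "0 < mean (K s) (U s)" by (simp add: mean_nonneg_iff(2)[OF S2_integrable[OF U s0(1)]])
      then show ?thesis using s0 by simp
    qed
    ultimately have "AE s in ?\<mu>. s \<notin> {u<..t}" by (auto elim!: eventually_mono)
    then have "emeasure ?\<mu> {u<..t} = 0"
      by (subst (asm) AE_iff_measurable[of "{u<..t}"]) auto
    moreover have "emeasure ?\<mu> {u<..t} = ennreal (?K t - ?K u)"
      by (rule emeasure_interval_measure_Ioc[OF u(2) ext(1) ext(3)])
    ultimately show False using u c t by (simp add: ennreal_eq_0_iff)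
  qed
qed

end

section \<open>The Picard iteration\<close>

text \<open>Integrating the exponential weight gains a factor \<open>1 / \<rho>\<close>; with
  \<open>\<rho>\<close> at least \<open>16 * c\<close> this beats any constant c down to
  1/16.\<close>

lemma nn_integral_exp_le:
  assumes t: "0 \<le> t" and a: "0 \<le> a" and c: "0 \<le> c" and \<rho>: "0 < \<rho>" "16 * c \<le> \<rho>"
  shows "ennreal c * (\<integral>\<^sup>+s\<in>{0..t}. ennreal (a * exp (\<rho> * s)) \<partial>lborel) \<le> ennreal (a / 16 * exp (\<rho> * t))"
proof -
  have "(\<integral>\<^sup>+s\<in>{0..t}. ennreal (a * exp (\<rho> * s)) \<partial>lborel) = ennreal (a * exp (\<rho> * t) / \<rho> - a * exp (\<rho> * 0) / \<rho>)"
    by (rule nn_integral_FTC_Icc)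
      (use t a \<rho> in \<open>auto intro!: derivative_eq_intros simp: has_real_derivative_iff_has_vector_derivative[symmetric]\<close>)
  also have "\<dots> \<le> ennreal (a * exp (\<rho> * t) / \<rho>)" using a \<rho> by (intro ennreal_leI) simp
  finally have "ennreal c * (\<integral>\<^sup>+s\<in>{0..t}. ennreal (a * exp (\<rho> * s)) \<partial>lborel) \<le> ennreal c * ennreal (a * exp (\<rho> * t) / \<rho>)"
    by (intro mult_left_mono) auto
  also have "\<dots> = ennreal (c * (a * exp (\<rho> * t)) / \<rho>)" using c by (simp add: ennreal_mult'[symmetric])
  also have "\<dots> \<le> ennreal (a / 16 * exp (\<rho> * t))"
  proof (rule ennreal_leI)
    have "c * (a * exp (\<rho> * t)) \<le> \<rho> / 16 * (a * exp (\<rho> * t))"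
      using \<rho> a by (intro mult_right_mono) auto
    then show "c * (a * exp (\<rho> * t)) / \<rho> \<le> a / 16 * exp (\<rho> * t)"
      using \<rho>(1) by (simp add: divide_le_eq mult_ac)
  qed
  finally show ?thesis .
qed

lemma (in complete_filtered_prob_space) sup_moment_zero_AE:
  assumes "adapted F Z" "continuous_process M Z" and zero: "\<And>T. 0 \<le> T \<Longrightarrow> sup_moment Z T = 0"
  shows "AE \<omega> in M. \<forall>t\<ge>0. Z t \<omega> = 0"
proof -
  have "AE \<omega> in M. supsq Z (real k) \<omega> = 0" for k
    using zero[of "real k"] supsq_measurable_M[OF assms(1,2), of "real k"]
    by (simp add: sup_moment_def nn_integral_0_iff_AE)
  then have "AE \<omega> in M. \<forall>k. supsq Z (real k) \<omega> = 0" by (simp add: AE_all_countable)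
  then show ?thesis
  proof eventually_elim
    fix \<omega> assume z: "\<forall>k. supsq Z (real k) \<omega> = 0"
    show "\<forall>t\<ge>0. Z t \<omega> = 0"
    proof (intro allI impI)
      fix t :: real assume t: "0 \<le> t"
      obtain k where "t \<le> real k" using real_arch_simple by blast
      then have "ennreal ((Z t \<omega>)\<^sup>2) \<le> 0" using supsq_upper[OF t, of "real k" Z \<omega>] z by simp
      then show "Z t \<omega> = 0" by simp
    qed
  qed
qed

lemma set_integral_cong_nonneg:
  assumes "\<And>s. 0 \<le> s \<Longrightarrow> f s = g s"
  shows "(LINT s:{0..t}|\<mu>. f s) = (LINT s:{0..t}|\<mu>. g s)"
  unfolding set_lebesgue_integral_def
  by (intro Bochner_Integration.integral_cong refl) (use assms in \<open>auto simp: indicator_def\<close>)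

lemma (in complete_filtered_prob_space) S2_const_process:
  assumes "Z \<in> borel_measurable (F 0)" "integrable M (\<lambda>\<omega>. (Z \<omega>)\<^sup>2)"
  shows "S2 (\<lambda>t. Z)"
  unfolding S2_def
proof (intro conjI allI impI)
  show "adapted F (\<lambda>t. Z)" unfolding adapted_def by (intro allI impI measurable_F_mono[OF order_refl _ assms(1)])
  show "continuous_process M (\<lambda>t. Z)" by (simp add: continuous_process_def)
  fix T :: real assume "0 \<le> T"
  then have "supsq (\<lambda>t. Z) T \<omega> = ennreal ((Z \<omega>)\<^sup>2)" for \<omega> by (simp add: supsq_def)
  then show "sup_moment (\<lambda>t. Z) T < \<infinity>"
    using assms by (simp add: sup_moment_def nn_integral_square)
qed

lemma (in complete_filtered_prob_space) S2_deterministic: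
  assumes "continuous_on {0..} K"
  shows "S2 (\<lambda>t \<omega>. K t)"
  unfolding S2_def
proof (intro conjI allI impI)
  show "adapted F (\<lambda>t \<omega>. K t)" by (simp add: adapted_def)
  show "continuous_process M (\<lambda>t \<omega>. K t)" using assms by (simp add: continuous_process_def)
  fix T :: real assume T: "0 \<le> T"
  have "bounded (K ` {0..T})"
    by (intro compact_imp_bounded compact_continuous_image continuous_on_subset[OF assms]) auto
  then obtain C where "\<forall>x\<in>K ` {0..T}. norm x \<le> C" unfolding bounded_iff by blast
  then have C: "\<bar>K t\<bar> \<le> C" if "0 \<le> t" "t \<le> T" for t using that by auto
  have "supsq (\<lambda>t \<omega>. K t) T \<omega> \<le> ennreal (C\<^sup>2)" for \<omega> :: 'a
  proof (intro supsq_least ennreal_leI)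
    fix t assume "0 \<le> t" "t \<le> T"
    then have "\<bar>K t\<bar>\<^sup>2 \<le> C\<^sup>2" by (intro power_mono C) auto
    then show "(K t)\<^sup>2 \<le> C\<^sup>2" by simp
  qed
  then have "sup_moment (\<lambda>t \<omega>. K t) T \<le> (\<integral>\<^sup>+\<omega>. ennreal (C\<^sup>2) \<partial>M)"
    unfolding sup_moment_def by (intro nn_integral_mono)
  also have "\<dots> < \<infinity>" by (simp add: emeasure_space_1)
  finally show "sup_moment (\<lambda>t \<omega>. K t) T < \<infinity>" .
qed

text \<open>The definition of the integral does not prescribe its initial value. Comparison with the
  integral of 0 on the degenerate horizon \<open>[0,0]\<close> supplies it.\<close>

lemma (in brownian_filtration) ito_0_AE:
  assumes I: "is_ito_integral M F B H I"
  shows "AE \<omega> in M. I 0 \<omega> = 0"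
proof -
  have "is_ito_integral M F B (\<lambda>s \<omega>. 0) (\<lambda>s \<omega>. 0)"
    unfolding is_ito_integral_def ito_integrand_def
    by (intro conjI exI[of _ "\<lambda>_. 0"] exI[of _ "\<lambda>_ _. 0"] exI[of _ "\<lambda>_ _ _. 0"])
      (auto simp: adapted_def continuous_process_def simple_integrand_def simple_process_def simple_ito_integral_def)
  from ito_isometry_le[OF I this order_refl]
  have "(\<integral>\<^sup>+\<omega>. ennreal ((I 0 \<omega>)\<^sup>2) \<partial>M) \<le> 16 * sq_dist 0 H (\<lambda>s \<omega>. 0)" by simp
  also have "sq_dist 0 H (\<lambda>s \<omega>. 0) = 0"
  proof -
    have "(\<integral>\<^sup>+s\<in>{0..0}. ennreal ((H s \<omega> - 0)\<^sup>2) \<partial>lborel) = 0" for \<omega>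
    proof -
      have "(\<integral>\<^sup>+s\<in>{0..0}. ennreal ((H s \<omega> - 0)\<^sup>2) \<partial>lborel) = (\<integral>\<^sup>+s. 0 \<partial>(lborel :: real measure))"
        by (rule nn_integral_cong_AE) (use AE_lborel_singleton[of "0::real"] in \<open>eventually_elim, auto simp: indicator_def\<close>)
      then show ?thesis by simp
    qed
    then show ?thesis by (simp add: sq_dist_def)
  qed
  finally have "(\<integral>\<^sup>+\<omega>. ennreal ((I 0 \<omega>)\<^sup>2) \<partial>M) = 0" by simp
  moreover have "I 0 \<in> borel_measurable M" using S2_measurable[OF ito_S2[OF I]] by simp
  ultimately show ?thesis by (simp add: nn_integral_0_iff_AE)
qed

section \<open>The map whose fixed points are the solutions\<close>

locale mckean_vlasov = brownian_filtration M F B + mean_reflection M F h m m'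
  for M :: "'a measure" and F B h m m' +
  fixes b \<sigma> :: "real \<Rightarrow> real measure \<Rightarrow> real" and \<xi> :: "'a \<Rightarrow> real" and L :: real
  assumes b_lipschitz: "lipschitz_coeff L b" and \<sigma>_lipschitz: "lipschitz_coeff L \<sigma>"
    and \<xi>_F0: "\<xi> \<in> borel_measurable (F 0)" and \<xi>_square: "integrable M (\<lambda>\<omega>. (\<xi> \<omega>)\<^sup>2)"
    and \<xi>_mean: "0 \<le> mean 0 \<xi>"
begin

abbreviation coeff_process :: "(real \<Rightarrow> real measure \<Rightarrow> real) \<Rightarrow> (real \<Rightarrow> 'a \<Rightarrow> real) \<Rightarrow> real \<Rightarrow> 'a \<Rightarrow> real" where
  "coeff_process f X \<equiv> \<lambda>s \<omega>. f (X s \<omega>) (law M (X s))"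

abbreviation diffusion :: "(real \<Rightarrow> 'a \<Rightarrow> real) \<Rightarrow> (real \<Rightarrow> 'a \<Rightarrow> real) \<Rightarrow> bool" where
  "diffusion X I \<equiv> is_ito_integral M F B (coeff_process \<sigma> X) I"

abbreviation free :: "(real \<Rightarrow> 'a \<Rightarrow> real) \<Rightarrow> (real \<Rightarrow> 'a \<Rightarrow> real) \<Rightarrow> real \<Rightarrow> 'a \<Rightarrow> real" where
  "free X I \<equiv> unreflected M b \<xi> X I"

text \<open>The integral \<open>I\<close> is an argument of its own because \<open>X\<close>
  determines it only up to indistinguishability.\<close>

definition reflected :: "(real \<Rightarrow> 'a \<Rightarrow> real) \<Rightarrow> (real \<Rightarrow> 'a \<Rightarrow> real) \<Rightarrow> real \<Rightarrow> 'a \<Rightarrow> real" where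
  "reflected X I t \<omega> = free X I t \<omega> + regulator (free X I) t"

lemma S2_free:
  assumes X: "S2 X" and I: "diffusion X I"
  shows "S2 (free X I)"
proof -
  have "S2 (\<lambda>t \<omega>. (\<xi> \<omega> + (LINT s:{0..t}|lborel. coeff_process b X s \<omega>)) + I t \<omega>)"
    by (intro S2_add S2_const_process \<xi>_F0 \<xi>_square drift_S2 S2_coeff[OF b_lipschitz] X ito_S2[OF I])
  then show ?thesis by (simp add: unreflected_def[abs_def])
qed

lemma S2_reflected:
  assumes "S2 X" "diffusion X I"
  shows "S2 (reflected X I)"
  unfolding reflected_def[abs_def]
  by (intro S2_add S2_deterministic regulator_continuous S2_free assms)

text \<open>The initial condition on the mean of \<open>h\<close> enters here; through
  \<open>regulator_0\<close> it makes the regulator start at 0.\<close>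

lemma mean_free_0:
  assumes "S2 X" "diffusion X I"
  shows "0 \<le> mean 0 (free X I 0)"
proof -
  have [measurable]: "\<xi> \<in> borel_measurable M" using \<xi>_F0 by (rule measurable_F_M[OF order_refl])
  have [measurable]: "free X I 0 \<in> borel_measurable M" using S2_measurable[OF S2_free[OF assms]] by simp
  have "(LINT s:{0..0}|lborel. f s) = 0" for f :: "real \<Rightarrow> real"
  proof -
    have "(\<integral>s. indicator {0..0} s *\<^sub>R f s \<partial>lborel) = 0"
      by (rule integral_eq_zero_AE) (use AE_lborel_singleton[of "0::real"] in \<open>eventually_elim, auto simp: indicator_def\<close>)
    then show ?thesis by (simp add: set_lebesgue_integral_def)
  qed
  then have "AE \<omega> in M. free X I 0 \<omega> = \<xi> \<omega>"
    using ito_0_AE[OF assms(2)] by (auto simp: unreflected_def elim!: eventually_mono)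
  then have "mean 0 (free X I 0) = mean 0 \<xi>"
    unfolding mean_def by (intro integral_cong_AE) (auto elim!: eventually_mono)
  then show ?thesis using \<xi>_mean by simp
qed

text \<open>Fubini puts the expectation inside. There the pathwise difference and the distance of
  the laws contribute the same second moment, which doubles the factor
  \<open>2 * L^2\<close>.\<close>

lemma coeff_sq_dist:
  assumes f: "lipschitz_coeff L f" and X: "S2 X" "S2 X'" and t: "0 \<le> t"
  shows "sq_dist t (coeff_process f X) (coeff_process f X')
    \<le> ennreal (4 * L\<^sup>2) * (\<integral>\<^sup>+s\<in>{0..t}. ennreal (\<integral>\<omega>. (X s \<omega> - X' s \<omega>)\<^sup>2 \<partial>M) \<partial>lborel)"
proof -
  have S: "S2 (coeff_process f X)" "S2 (coeff_process f X')" by (intro S2_coeff[OF f] X)+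
  have tm: "time_measurable t (coeff_process f X)" "time_measurable t (coeff_process f X')" "time_measurable t X" "time_measurable t X'"
    using S X t by (auto simp: S2_def intro: time_measurable_continuous)
  interpret R: sigma_finite_measure "lborel_upto t" by (rule sigma_finite_lborel_upto)
  interpret P: pair_sigma_finite M "lborel_upto t" ..
  have swap: "(\<integral>\<^sup>+\<omega>. (\<integral>\<^sup>+s. ennreal ((G s \<omega> - G' s \<omega>)\<^sup>2) \<partial>lborel_upto t) \<partial>M)
    = (\<integral>\<^sup>+s. (\<integral>\<^sup>+\<omega>. ennreal ((G s \<omega> - G' s \<omega>)\<^sup>2) \<partial>M) \<partial>lborel_upto t)"
    if "time_measurable t G" "time_measurable t G'" for G G'
    using P.Fubini[OF time_measurable_inner(1)[OF that]] by simp
  have meas: "(\<lambda>s. \<integral>\<^sup>+\<omega>. ennreal ((X s \<omega> - X' s \<omega>)\<^sup>2) \<partial>M) \<in> borel_measurable (lborel_upto t)"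
    using borel_measurable_nn_integral_fst[OF measurable_pair_swap[OF time_measurable_inner(1)[OF tm(3,4)]]] by simp
  have inner: "(\<integral>\<^sup>+\<omega>. ennreal ((coeff_process f X s \<omega> - coeff_process f X' s \<omega>)\<^sup>2) \<partial>M)
     \<le> ennreal (4 * L\<^sup>2) * (\<integral>\<^sup>+\<omega>. ennreal ((X s \<omega> - X' s \<omega>)\<^sup>2) \<partial>M)" if s: "0 \<le> s" for s
  proof -
    note mX = S2_measurable[OF X(1) s] S2_measurable[OF X(2) s]
    note iX = S2_square_integrable[OF X(1) s] S2_square_integrable[OF X(2) s]
    note [measurable] = mX
    let ?e = "\<integral>\<omega>. (X s \<omega> - X' s \<omega>)\<^sup>2 \<partial>M"
    have i: "integrable M (\<lambda>\<omega>. (X s \<omega> - X' s \<omega>)\<^sup>2)" by (rule integrable_square_diff[OF mX iX])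
    have "(\<integral>\<^sup>+\<omega>. ennreal ((coeff_process f X s \<omega> - coeff_process f X' s \<omega>)\<^sup>2) \<partial>M)
      \<le> (\<integral>\<^sup>+\<omega>. ennreal (2 * L\<^sup>2 * ((X s \<omega> - X' s \<omega>)\<^sup>2 + ?e)) \<partial>M)"
      by (intro nn_integral_mono ennreal_leI lipschitz_coeff_diff[OF f mX iX])
    also have "\<dots> = ennreal (\<integral>\<omega>. 2 * L\<^sup>2 * ((X s \<omega> - X' s \<omega>)\<^sup>2 + ?e) \<partial>M)"
      by (intro nn_integral_eq_integral) (use i in auto)
    also have "(\<integral>\<omega>. 2 * L\<^sup>2 * ((X s \<omega> - X' s \<omega>)\<^sup>2 + ?e) \<partial>M) = 4 * L\<^sup>2 * ?e"
      using i by (simp add: prob_space)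
    also have "ennreal (4 * L\<^sup>2 * ?e) = ennreal (4 * L\<^sup>2) * (\<integral>\<^sup>+\<omega>. ennreal ((X s \<omega> - X' s \<omega>)\<^sup>2) \<partial>M)"
      by (subst nn_integral_square[OF i], subst ennreal_mult) auto
    finally show ?thesis .
  qed
  have "sq_dist t (coeff_process f X) (coeff_process f X')
    = (\<integral>\<^sup>+s. (\<integral>\<^sup>+\<omega>. ennreal ((coeff_process f X s \<omega> - coeff_process f X' s \<omega>)\<^sup>2) \<partial>M) \<partial>lborel_upto t)"
    unfolding sq_dist_def nn_integral_lborel_upto by (rule swap[OF tm(1,2)])
  also have "\<dots> \<le> (\<integral>\<^sup>+s. ennreal (4 * L\<^sup>2) * (\<integral>\<^sup>+\<omega>. ennreal ((X s \<omega> - X' s \<omega>)\<^sup>2) \<partial>M) \<partial>lborel_upto t)"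
    by (intro nn_integral_mono inner) (auto simp: space_restrict_space)
  also have "\<dots> = ennreal (4 * L\<^sup>2) * (\<integral>\<^sup>+s. (\<integral>\<^sup>+\<omega>. ennreal ((X s \<omega> - X' s \<omega>)\<^sup>2) \<partial>M) \<partial>lborel_upto t)"
    by (rule nn_integral_cmult[OF meas])
  also have "(\<integral>\<^sup>+s. (\<integral>\<^sup>+\<omega>. ennreal ((X s \<omega> - X' s \<omega>)\<^sup>2) \<partial>M) \<partial>lborel_upto t)
     = (\<integral>\<^sup>+s. ennreal (\<integral>\<omega>. (X s \<omega> - X' s \<omega>)\<^sup>2 \<partial>M) \<partial>lborel_upto t)"
    by (intro nn_integral_cong nn_integral_square integrable_square_diff S2_measurable S2_square_integrable X)
      (auto simp: space_restrict_space)
  finally show ?thesis by (simp only: nn_integral_lborel_upto)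
qed

text \<open>The sum of \<open>2 * T * 4 L^2\<close>, from Cauchy-Schwarz for the drift, and
  \<open>2 * 64 * 4 L^2\<close>, from \<open>ito_sup_moment_diff\<close>.\<close>

definition free_const :: "real \<Rightarrow> real" where
  "free_const T = 8 * L\<^sup>2 * T + 512 * L\<^sup>2"

text \<open>The free part counts twice, and the regulator, which follows it with Lipschitz factor
  \<open>m' / m\<close>, adds twice the square of that factor.\<close>

definition reflected_const :: "real \<Rightarrow> real" where
  "reflected_const T = (2 + 2 * (m' / m)\<^sup>2) * free_const T"

lemma const_nonneg: "0 \<le> T \<Longrightarrow> 0 \<le> free_const T" "0 \<le> T \<Longrightarrow> 0 \<le> reflected_const T"
  by (simp_all add: free_const_def reflected_const_def)

text \<open>The constant itself may be large; what matters is the Volterra form, with the distances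
  at earlier times under a time integral. The version without regulator is needed separately to
  identify \<open>K\<close>.\<close>

lemma free_contraction:
  assumes X: "S2 X" "S2 X'" and I: "diffusion X I" "diffusion X' I'" and t: "0 \<le> t" "t \<le> T"
  shows "sup_moment (\<lambda>t \<omega>. free X I t \<omega> - free X' I' t \<omega>) t
    \<le> ennreal (free_const T) * (\<integral>\<^sup>+s\<in>{0..t}. ennreal (\<integral>\<omega>. (X s \<omega> - X' s \<omega>)\<^sup>2 \<partial>M) \<partial>lborel)"
proof -
  let ?J = "\<integral>\<^sup>+s\<in>{0..t}. ennreal (\<integral>\<omega>. (X s \<omega> - X' s \<omega>)\<^sup>2 \<partial>M) \<partial>lborel"
  define V where "V t \<omega> = (LINT s:{0..t}|lborel. coeff_process b X s \<omega>) - (LINT s:{0..t}|lborel. coeff_process b X' s \<omega>)" for t \<omega>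
  define W where "W t \<omega> = I t \<omega> - I' t \<omega>" for t \<omega>
  have S: "S2 (coeff_process b X)" "S2 (coeff_process b X')" by (intro S2_coeff[OF b_lipschitz] X)+
  have V: "S2 V" unfolding V_def[abs_def] by (intro S2_diff drift_S2 S)
  have W: "S2 W" unfolding W_def[abs_def] by (intro S2_diff ito_S2[OF I(1)] ito_S2[OF I(2)])
  have eq: "(\<lambda>t \<omega>. free X I t \<omega> - free X' I' t \<omega>) = (\<lambda>t \<omega>. V t \<omega> + W t \<omega>)"
    by (intro ext) (simp add: unreflected_def V_def W_def)
  have "sup_moment (\<lambda>t \<omega>. V t \<omega> + W t \<omega>) t \<le> 2 * sup_moment V t + 2 * sup_moment W t"
    using V W t(1) by (intro sup_moment_add) (auto simp: S2_def)
  also have "\<dots> \<le> 2 * (ennreal T * (ennreal (4 * L\<^sup>2) * ?J)) + 2 * (64 * (ennreal (4 * L\<^sup>2) * ?J))"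
  proof (intro add_mono mult_left_mono)
    have "sup_moment V t \<le> ennreal t * sq_dist t (coeff_process b X) (coeff_process b X')"
      unfolding V_def[abs_def] by (rule drift_sup_moment_diff[OF S t(1)])
    also have "\<dots> \<le> ennreal T * (ennreal (4 * L\<^sup>2) * ?J)"
      by (intro mult_mono coeff_sq_dist[OF b_lipschitz X t(1)] ennreal_leI t) auto
    finally show "sup_moment V t \<le> ennreal T * (ennreal (4 * L\<^sup>2) * ?J)" .
    have "sup_moment W t \<le> 64 * sq_dist t (coeff_process \<sigma> X) (coeff_process \<sigma> X')"
      unfolding W_def[abs_def] by (rule ito_sup_moment_diff[OF I t(1)])
    also have "\<dots> \<le> 64 * (ennreal (4 * L\<^sup>2) * ?J)"
      by (intro mult_left_mono coeff_sq_dist[OF \<sigma>_lipschitz X t(1)]) auto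
    finally show "sup_moment W t \<le> 64 * (ennreal (4 * L\<^sup>2) * ?J)" .
  qed auto
  also have "\<dots> = (2 * (ennreal T * ennreal (4 * L\<^sup>2)) + 2 * (64 * ennreal (4 * L\<^sup>2))) * ?J"
    by (simp add: distrib_right mult.assoc)
  also have "2 * (ennreal T * ennreal (4 * L\<^sup>2)) + 2 * (64 * ennreal (4 * L\<^sup>2)) = ennreal (free_const T)"
  proof -
    have "2 * (ennreal T * ennreal (4 * L\<^sup>2)) + 2 * (64 * ennreal (4 * L\<^sup>2))
      = ennreal (2 * (T * (4 * L\<^sup>2)) + 2 * (64 * (4 * L\<^sup>2)))"
      using t by (simp add: ennreal_mult mult.left_commute[of "ennreal T" 4])
    then show ?thesis by (simp add: free_const_def algebra_simps)
  qed
  finally show ?thesis by (simp only: eq)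
qed

lemma reflected_contraction:
  assumes X: "S2 X" "S2 X'" and I: "diffusion X I" "diffusion X' I'" and t: "0 \<le> t" "t \<le> T"
  shows "sup_moment (\<lambda>t \<omega>. reflected X I t \<omega> - reflected X' I' t \<omega>) t
    \<le> ennreal (reflected_const T) * (\<integral>\<^sup>+s\<in>{0..t}. ennreal (\<integral>\<omega>. (X s \<omega> - X' s \<omega>)\<^sup>2 \<partial>M) \<partial>lborel)"
proof -
  let ?J = "\<integral>\<^sup>+s\<in>{0..t}. ennreal (\<integral>\<omega>. (X s \<omega> - X' s \<omega>)\<^sup>2 \<partial>M) \<partial>lborel"
  define V where "V t \<omega> = free X I t \<omega> - free X' I' t \<omega>" for t \<omega>
  define W where "W t \<omega> = regulator (free X I) t - regulator (free X' I') t" for t and \<omega> :: 'a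
  have S: "S2 (free X I)" "S2 (free X' I')" using S2_free[OF X(1) I(1)] S2_free[OF X(2) I(2)] .
  have V: "S2 V" unfolding V_def[abs_def] by (intro S2_diff S)
  have W: "S2 W" unfolding W_def[abs_def] by (intro S2_deterministic continuous_intros regulator_continuous S)
  have eq: "(\<lambda>t \<omega>. reflected X I t \<omega> - reflected X' I' t \<omega>) = (\<lambda>t \<omega>. V t \<omega> + W t \<omega>)"
    by (intro ext) (simp add: reflected_def V_def W_def)
  \<comment> \<open>\<open>W\<close> does not depend on the sample point, so this bound passes
    unchanged through the expectation.\<close>
  have "supsq W t \<omega> \<le> ennreal ((m' / m)\<^sup>2) * sup_moment V t" for \<omega>
    unfolding W_def V_def[abs_def] by (intro supsq_least regulator_diff_square_le S)
  then have "sup_moment W t \<le> (\<integral>\<^sup>+\<omega>. ennreal ((m' / m)\<^sup>2) * sup_moment V t \<partial>M)"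
    unfolding sup_moment_def[of W] by (intro nn_integral_mono)
  then have W': "sup_moment W t \<le> ennreal ((m' / m)\<^sup>2) * sup_moment V t" by (simp add: emeasure_space_1)
  have "sup_moment (\<lambda>t \<omega>. V t \<omega> + W t \<omega>) t \<le> 2 * sup_moment V t + 2 * sup_moment W t"
    using V W t(1) by (intro sup_moment_add) (auto simp: S2_def)
  also have "\<dots> \<le> 2 * sup_moment V t + 2 * (ennreal ((m' / m)\<^sup>2) * sup_moment V t)"
    by (intro add_mono mult_left_mono W') auto
  also have "\<dots> = (2 + 2 * ennreal ((m' / m)\<^sup>2)) * sup_moment V t" by (simp add: distrib_right mult.assoc)
  also have "2 + 2 * ennreal ((m' / m)\<^sup>2) = ennreal (2 + 2 * (m' / m)\<^sup>2)"
    by (simp add: ennreal_plus ennreal_mult')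
  also have "ennreal (2 + 2 * (m' / m)\<^sup>2) * sup_moment V t \<le> ennreal (2 + 2 * (m' / m)\<^sup>2) * (ennreal (free_const T) * ?J)"
    unfolding V_def[abs_def] by (intro mult_left_mono free_contraction X I t) auto
  also have "\<dots> = ennreal (reflected_const T) * ?J"
    using const_nonneg(1)[of T] t by (simp add: reflected_const_def ennreal_mult mult.assoc)
  finally show ?thesis by (simp only: eq)
qed

text \<open>With the weight \<open>exp (\<rho> t)\<close>, \<open>\<rho>\<close> large, one application of the map divides the
  distance by 16 on the whole of \<open>[0,T]\<close>.\<close>

lemma reflected_exp_contraction:
  assumes X: "S2 X" "S2 X'" and I: "diffusion X I" "diffusion X' I'" and t: "0 \<le> t" "t \<le> T"
    and a: "0 \<le> a" and \<rho>: "\<rho> = 16 * reflected_const T + 1"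
    and le: "\<And>s. 0 \<le> s \<Longrightarrow> s \<le> T \<Longrightarrow> sup_moment (\<lambda>t \<omega>. X t \<omega> - X' t \<omega>) s \<le> ennreal (a * exp (\<rho> * s))"
  shows "sup_moment (\<lambda>t \<omega>. reflected X I t \<omega> - reflected X' I' t \<omega>) t \<le> ennreal (a / 16 * exp (\<rho> * t))"
proof -
  have T: "0 \<le> T" using t by simp
  have "sup_moment (\<lambda>t \<omega>. reflected X I t \<omega> - reflected X' I' t \<omega>) t
    \<le> ennreal (reflected_const T) * (\<integral>\<^sup>+s\<in>{0..t}. ennreal (\<integral>\<omega>. (X s \<omega> - X' s \<omega>)\<^sup>2 \<partial>M) \<partial>lborel)"
    by (rule reflected_contraction[OF X I t])
  also have "\<dots> \<le> ennreal (reflected_const T) * (\<integral>\<^sup>+s\<in>{0..t}. ennreal (a * exp (\<rho> * s)) \<partial>lborel)"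
  proof (intro mult_left_mono nn_integral_mono)
    fix s
    show "ennreal (\<integral>\<omega>. (X s \<omega> - X' s \<omega>)\<^sup>2 \<partial>M) * indicator {0..t} s \<le> ennreal (a * exp (\<rho> * s)) * indicator {0..t} s"
    proof (cases "s \<in> {0..t}")
      case True
      then have "ennreal (\<integral>\<omega>. (X s \<omega> - X' s \<omega>)\<^sup>2 \<partial>M) \<le> sup_moment (\<lambda>t \<omega>. X t \<omega> - X' t \<omega>) s"
        using square_moment_le_sup_moment[OF S2_diff[OF X], of s s] by simp
      also have "\<dots> \<le> ennreal (a * exp (\<rho> * s))" using True t by (intro le) auto
      finally show ?thesis using True by simp
    qed simp
  qed auto
  also have "\<dots> \<le> ennreal (a / 16 * exp (\<rho> * t))"
    using const_nonneg(2)[OF T] \<rho> by (intro nn_integral_exp_le t a) auto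
  finally show ?thesis .
qed

text \<open>Two fixed points reproduce their own distance, so the contraction can be applied to it
  any number of times. Finiteness of the distance, from membership in \<open>S2\<close>, starts the
  iteration.\<close>

lemma reflected_unique:
  assumes X: "S2 X" "S2 X'" and I: "diffusion X I" "diffusion X' I'"
    and eq: "AE \<omega> in M. \<forall>t\<ge>0. X t \<omega> = reflected X I t \<omega>" "AE \<omega> in M. \<forall>t\<ge>0. X' t \<omega> = reflected X' I' t \<omega>"
    and T: "0 \<le> T"
  shows "sup_moment (\<lambda>t \<omega>. X t \<omega> - X' t \<omega>) T = 0"
proof -
  define d where "d = sup_moment (\<lambda>t \<omega>. X t \<omega> - X' t \<omega>)"
  define a where "a = enn2real (d T)"
  define \<rho> where "\<rho> = 16 * reflected_const T + 1"
  have \<rho>: "0 \<le> \<rho>" using const_nonneg(2)[OF T] by (simp add: \<rho>_def)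
  have a: "d T = ennreal a" "0 \<le> a" using S2_diff[OF X] T by (auto simp: a_def d_def S2_def)
  have same: "d t = sup_moment (\<lambda>t \<omega>. reflected X I t \<omega> - reflected X' I' t \<omega>) t" for t
    unfolding d_def by (rule sup_moment_cong_AE) (use eq in \<open>eventually_elim, simp\<close>)
  have le: "d t \<le> ennreal (a * (1/16)^n * exp (\<rho> * t))" if "0 \<le> t" "t \<le> T" for t n
    using that
  proof (induction n arbitrary: t)
    case 0
    have "d t \<le> ennreal a" unfolding a(1)[symmetric] d_def by (rule sup_moment_mono) (use 0 in simp)
    also have "\<dots> \<le> ennreal (a * (1/16)^0 * exp (\<rho> * t))"
      using a(2) \<rho> 0 mult_left_mono[of 1 "exp (\<rho> * t)" a] by (intro ennreal_leI) simp
    finally show ?case .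
  next
    case (Suc n)
    have "d t \<le> ennreal (a * (1/16)^n / 16 * exp (\<rho> * t))"
      unfolding same using Suc a(2)
      by (intro reflected_exp_contraction[OF X I _ _ _ \<rho>_def]) (auto simp: d_def)
    then show ?case by simp
  qed
  have "(\<lambda>n. ennreal (a * (1/16)^n * exp (\<rho> * T))) \<longlonglongrightarrow> ennreal (a * 0 * exp (\<rho> * T))"
    by (intro tendsto_ennrealI tendsto_intros) auto
  then have "d T \<le> ennreal (a * 0 * exp (\<rho> * T))"
    by (rule LIMSEQ_le_const) (use le[of T] T in auto)
  then show ?thesis by (simp add: d_def)
qed

lemma reflected_exists:
  obtains X I where "S2 X" "diffusion X I" "AE \<omega> in M. \<forall>t\<ge>0. X t \<omega> = reflected X I t \<omega>"
proof -
  define ito where "ito X = (SOME I. diffusion X I)" for X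
  have ito: "diffusion X (ito X)" if X: "S2 X" for X
  proof -
    obtain I where "diffusion X I" using ito_exists[OF S2_coeff[OF \<sigma>_lipschitz X]] by blast
    then show ?thesis unfolding ito_def by (rule someI[where P="diffusion X"])
  qed
  \<comment> \<open>The iteration starts at the process constantly equal to the initial value, with
    one chosen version of the stochastic integral at each stage.\<close>
  define X where "X n = ((\<lambda>X. reflected X (ito X)) ^^ n) (\<lambda>t. \<xi>)" for n
  have X_Suc: "X (Suc n) = reflected (X n) (ito (X n))" for n by (simp add: X_def)
  have S: "S2 (X n)" for n
  proof (induction n)
    case 0 show ?case using S2_const_process[OF \<xi>_F0 \<xi>_square] by (simp add: X_def)
  next
    case (Suc n) show ?case unfolding X_Suc by (rule S2_reflected[OF Suc ito[OF Suc]])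
  qed
  have ad: "adapted F (X n)" and co: "continuous_process M (X n)" for n using S[of n] by (auto simp: S2_def)
  have cauchy: "\<exists>N A. A < \<infinity> \<and> (\<forall>n\<ge>N. sup_moment (\<lambda>t \<omega>. X (Suc n) t \<omega> - X n t \<omega>) T \<le> A * ennreal ((1/16)^n))"
    if T: "0 \<le> T" for T
  proof -
    define a where "a = enn2real (sup_moment (\<lambda>t \<omega>. X 1 t \<omega> - X 0 t \<omega>) T)"
    define \<rho> where "\<rho> = 16 * reflected_const T + 1"
    have \<rho>: "0 \<le> \<rho>" using const_nonneg(2)[OF T] by (simp add: \<rho>_def)
    have a: "sup_moment (\<lambda>t \<omega>. X 1 t \<omega> - X 0 t \<omega>) T = ennreal a" "0 \<le> a"
      using S2_diff[OF S[of 1] S[of 0]] T by (auto simp: a_def S2_def)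
    have le: "sup_moment (\<lambda>t \<omega>. X (Suc n) t \<omega> - X n t \<omega>) t \<le> ennreal (a * (1/16)^n * exp (\<rho> * t))"
      if "0 \<le> t" "t \<le> T" for t n
      using that
    proof (induction n arbitrary: t)
      case 0
      have "sup_moment (\<lambda>t \<omega>. X (Suc 0) t \<omega> - X 0 t \<omega>) t \<le> ennreal a"
        unfolding a(1)[symmetric] One_nat_def by (rule sup_moment_mono) (use 0 in simp)
      also have "\<dots> \<le> ennreal (a * (1/16)^0 * exp (\<rho> * t))"
        using a(2) \<rho> 0 mult_left_mono[of 1 "exp (\<rho> * t)" a] by (intro ennreal_leI) simp
      finally show ?case .
    next
      case (Suc n)
      have "sup_moment (\<lambda>t \<omega>. reflected (X (Suc n)) (ito (X (Suc n))) t \<omega> - reflected (X n) (ito (X n)) t \<omega>) t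
        \<le> ennreal (a * (1/16)^n / 16 * exp (\<rho> * t))"
        by (rule reflected_exp_contraction[OF S S ito[OF S] ito[OF S] Suc.prems _ \<rho>_def Suc.IH]) (use a(2) in auto)
      then show ?case by (simp add: X_Suc)
    qed
    show ?thesis
    proof (intro exI[of _ "0::nat"] exI[of _ "ennreal (a * exp (\<rho> * T))"] conjI allI impI)
      fix n
      have "sup_moment (\<lambda>t \<omega>. X (Suc n) t \<omega> - X n t \<omega>) T \<le> ennreal (a * exp (\<rho> * T) * (1/16)^n)"
        using le[of T n] T by (simp add: mult_ac)
      then show "sup_moment (\<lambda>t \<omega>. X (Suc n) t \<omega> - X n t \<omega>) T \<le> ennreal (a * exp (\<rho> * T)) * ennreal ((1/16)^n)"
        using a(2) by (simp add: ennreal_mult)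
    qed simp
  qed
  obtain Y where Y: "adapted F Y" "continuous_process M Y"
    and lim: "\<And>T. 0 \<le> T \<Longrightarrow> (\<lambda>n. sup_moment (\<lambda>t \<omega>. X n t \<omega> - Y t \<omega>) T) \<longlonglongrightarrow> 0"
    using sup_moment_complete[OF ad co cauchy] by blast
  have SY: "S2 Y"
    unfolding S2_def
  proof (intro conjI allI impI Y)
    fix T :: real assume T: "0 \<le> T"
    have "eventually (\<lambda>n. sup_moment (\<lambda>t \<omega>. X n t \<omega> - Y t \<omega>) T < 1) sequentially"
      using order_tendstoD(2)[OF lim[OF T], of 1] by simp
    then obtain n where n: "sup_moment (\<lambda>t \<omega>. X n t \<omega> - Y t \<omega>) T < 1" by (auto simp: eventually_sequentially)
    have "sup_moment (\<lambda>t \<omega>. X n t \<omega> - (X n t \<omega> - Y t \<omega>)) T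
       \<le> 2 * sup_moment (X n) T + 2 * sup_moment (\<lambda>t \<omega>. X n t \<omega> - Y t \<omega>) T"
      by (intro sup_moment_diff adapted_diff continuous_process_diff Y ad co T)
    also have "\<dots> < \<infinity>"
      using S[of n] T n by (auto simp: S2_def ennreal_mult_less_top intro: order.strict_trans)
    finally show "sup_moment Y T < \<infinity>" by simp
  qed
  have I: "diffusion Y (ito Y)" by (rule ito[OF SY])
  have SR: "S2 (reflected Y (ito Y))" by (rule S2_reflected[OF SY I])
  \<comment> \<open>The map is Lipschitz for \<open>sup_moment\<close> on \<open>[0,T]\<close>, so
    the images \<open>X (Suc n)\<close> of \<open>X n\<close> approach the image of \<open>Y\<close>
    as well as \<open>Y\<close> itself.\<close>
  have "sup_moment (\<lambda>t \<omega>. Y t \<omega> - reflected Y (ito Y) t \<omega>) T = 0" if T: "0 \<le> T" for T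
  proof -
    let ?d = "\<lambda>n. sup_moment (\<lambda>t \<omega>. X n t \<omega> - Y t \<omega>) T"
    let ?C = "ennreal (reflected_const T) * ennreal T"
    have le: "sup_moment (\<lambda>t \<omega>. Y t \<omega> - reflected Y (ito Y) t \<omega>) T \<le> 2 * ?d (Suc n) + 2 * (?C * ?d n)" for n
    proof -
      have "sup_moment (\<lambda>t \<omega>. X (Suc n) t \<omega> - reflected Y (ito Y) t \<omega>) T
        \<le> ennreal (reflected_const T) * (\<integral>\<^sup>+s\<in>{0..T}. ennreal (\<integral>\<omega>. (X n s \<omega> - Y s \<omega>)\<^sup>2 \<partial>M) \<partial>lborel)"
        unfolding X_Suc by (rule reflected_contraction[OF S SY ito[OF S] I T order_refl])
      also have "\<dots> \<le> ennreal (reflected_const T) * (\<integral>\<^sup>+s\<in>{0..T}. ?d n \<partial>lborel)"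
        by (intro mult_left_mono nn_integral_mono)
          (auto simp: indicator_def intro!: square_moment_le_sup_moment[OF S2_diff[OF S SY]])
      also have "\<dots> = ?C * ?d n" unfolding nn_integral_const_upto[OF T] by (simp add: mult_ac)
      finally have 1: "sup_moment (\<lambda>t \<omega>. X (Suc n) t \<omega> - reflected Y (ito Y) t \<omega>) T \<le> ?C * ?d n" .
      have "sup_moment (\<lambda>t \<omega>. (X (Suc n) t \<omega> - reflected Y (ito Y) t \<omega>) - (X (Suc n) t \<omega> - Y t \<omega>)) T
        \<le> 2 * sup_moment (\<lambda>t \<omega>. X (Suc n) t \<omega> - reflected Y (ito Y) t \<omega>) T + 2 * ?d (Suc n)"
        using SR by (intro sup_moment_diff adapted_diff continuous_process_diff Y ad co T) (auto simp: S2_def)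
      also have "\<dots> \<le> 2 * (?C * ?d n) + 2 * ?d (Suc n)" by (intro add_mono mult_left_mono 1) auto
      finally show ?thesis by (simp add: add.commute)
    qed
    have "(\<lambda>n. 2 * ?d (Suc n) + 2 * (?C * ?d n)) \<longlonglongrightarrow> 2 * 0 + 2 * (?C * 0)"
      by (intro tendsto_add ennreal_tendsto_cmult LIMSEQ_Suc lim T) (auto simp: ennreal_mult_less_top)
    then have "sup_moment (\<lambda>t \<omega>. Y t \<omega> - reflected Y (ito Y) t \<omega>) T \<le> 2 * 0 + 2 * (?C * 0)"
      by (rule LIMSEQ_le_const) (use le in auto)
    then show ?thesis by simp
  qed
  then have "AE \<omega> in M. \<forall>t\<ge>0. Y t \<omega> - reflected Y (ito Y) t \<omega> = 0"
    using Y SR by (intro sup_moment_zero_AE adapted_diff continuous_process_diff) (auto simp: S2_def)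
  then have "AE \<omega> in M. \<forall>t\<ge>0. Y t \<omega> = reflected Y (ito Y) t \<omega>" by simp
  then show thesis by (rule that[OF SY I])
qed

section \<open>Flat solutions\<close>

lemma flat_solution_S2: "flat_solution M F B b \<sigma> h \<xi> X K \<Longrightarrow> S2 X"
  unfolding S2_def
proof (intro conjI allI impI)
  assume fl: "flat_solution M F B b \<sigma> h \<xi> X K"
  then show "adapted F X" "continuous_process M X" by (auto simp: flat_solution_def)
  fix T :: real assume "0 \<le> T"
  \<comment> \<open>Solutions have finite moments only for positive horizons by definition;
    enlarging the horizon covers \<open>T = 0\<close>.\<close>
  have "sup_moment X T \<le> sup_moment X (max T 1)" by (rule sup_moment_mono) simp
  also have "\<dots> < \<infinity>"
  proof -
    have "0 < max T 1" by simp
    then show ?thesis using fl by (auto simp: flat_solution_def sup_moment_def supsq_def)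
  qed
  finally show "sup_moment X T < \<infinity>" .
qed

lemma mean_eq_expectation:
  assumes X: "S2 X" and I: "diffusion X I" and t: "0 \<le> t"
    and eq: "AE \<omega> in M. \<forall>t\<ge>0. X t \<omega> = free X I t \<omega> + K t"
  shows "(\<integral>\<omega>. h (X t \<omega>) \<partial>M) = mean (K t) (free X I t)"
proof -
  have [measurable]: "X t \<in> borel_measurable M" "free X I t \<in> borel_measurable M"
    using S2_measurable[OF X t] S2_measurable[OF S2_free[OF X I] t] .
  show ?thesis unfolding mean_def
    by (rule integral_cong_AE) (use eq t in \<open>auto elim!: eventually_mono simp: add.commute\<close>)
qed

text \<open>Uniqueness for the deterministic problem eliminates \<open>K\<close>, so that the pair
  of unknowns becomes a fixed point in \<open>X\<close> alone.\<close>

lemma flat_solution_reflected: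
  assumes fl: "flat_solution M F B b \<sigma> h \<xi> X K"
  obtains I where "diffusion X I" "\<And>t. 0 \<le> t \<Longrightarrow> K t = regulator (free X I) t"
    "AE \<omega> in M. \<forall>t\<ge>0. X t \<omega> = reflected X I t \<omega>"
proof -
  have X: "S2 X" by (rule flat_solution_S2[OF fl])
  obtain I where I: "diffusion X I" and eq: "AE \<omega> in M. \<forall>t\<ge>0. X t \<omega> = free X I t \<omega> + K t"
    using fl by (auto simp: flat_solution_def)
  have mean: "(\<integral>\<omega>. h (X t \<omega>) \<partial>M) = mean (K t) (free X I t)" if "0 \<le> t" for t
    by (rule mean_eq_expectation[OF X I that eq])
  have K: "K t = regulator (free X I) t" if t: "0 \<le> t" for t
  proof (rule regulator_unique[OF S2_free[OF X I] _ _ _ _ _ t])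
    show "mono_on {0..} K" "continuous_on {0..} K" "K 0 = 0" using fl by (auto simp: flat_solution_def)
    show "0 \<le> mean (K s) (free X I s)" if "0 \<le> s" for s
      using fl that by (simp add: flat_solution_def mean[symmetric])
    show "(LINT s:{0..r}|interval_measure (\<lambda>s. K (max 0 s)). mean (K s) (free X I s)) = 0" if r: "0 \<le> r" for r
    proof -
      have "(LINT s:{0..r}|interval_measure (\<lambda>s. K (max 0 s)). mean (K s) (free X I s))
        = (LINT s:{0..r}|interval_measure (\<lambda>s. K (max 0 s)). (\<integral>\<omega>. h (X s \<omega>) \<partial>M))"
        by (rule set_integral_cong_nonneg) (simp add: mean)
      also have "\<dots> = 0" using fl r by (simp add: flat_solution_def)
      finally show ?thesis .
    qed
  qed
  have "AE \<omega> in M. \<forall>t\<ge>0. X t \<omega> = reflected X I t \<omega>"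
    using eq by eventually_elim (simp add: reflected_def K)
  then show thesis using I K by (intro that)
qed

lemma reflected_flat_solution:
  assumes X: "S2 X" and I: "diffusion X I" and eq: "AE \<omega> in M. \<forall>t\<ge>0. X t \<omega> = reflected X I t \<omega>"
  shows "flat_solution M F B b \<sigma> h \<xi> X (regulator (free X I))"
proof -
  let ?K = "regulator (free X I)"
  have U: "S2 (free X I)" by (rule S2_free[OF X I])
  have eq': "AE \<omega> in M. \<forall>t\<ge>0. X t \<omega> = free X I t \<omega> + ?K t" using eq by (simp add: reflected_def)
  note mean = mean_eq_expectation[OF X I _ eq']
  show ?thesis
    unfolding flat_solution_def
  proof (intro conjI allI impI exI[of _ I] I eq')
    show "adapted F X" "continuous_process M X" using X by (auto simp: S2_def)
    show "(\<integral>\<^sup>+\<omega>. (SUP t\<in>{0..T}. ennreal (\<bar>X t \<omega>\<bar>\<^sup>2)) \<partial>M) < \<infinity>" if "0 < T" for T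
      using X that by (simp add: S2_def sup_moment_def supsq_def)
    show "mono_on {0..} ?K" by (auto intro!: mono_onI regulator_mono[OF U])
    show "continuous_on {0..} ?K" by (rule regulator_continuous[OF U])
    show "?K 0 = 0" by (rule regulator_0[OF U mean_free_0[OF X I]])
    show "0 \<le> (\<integral>\<omega>. h (X t \<omega>) \<partial>M)" if "0 \<le> t" for t
      unfolding mean[OF that] by (rule regulator_mean_nonneg[OF U that])
    show "(LINT s:{0..t}|interval_measure (\<lambda>s. ?K (max 0 s)). (\<integral>\<omega>. h (X s \<omega>) \<partial>M)) = 0" if t: "0 \<le> t" for t
    proof -
      have "(LINT s:{0..t}|interval_measure (\<lambda>s. ?K (max 0 s)). (\<integral>\<omega>. h (X s \<omega>) \<partial>M))
        = (LINT s:{0..t}|interval_measure (\<lambda>s. ?K (max 0 s)). mean (?K s) (free X I s))"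
        by (rule set_integral_cong_nonneg) (rule mean)
      also have "\<dots> = 0" by (rule regulator_flat[OF U t])
      finally show ?thesis .
    qed
  qed
qed

text \<open>Serves twice: for the uniqueness of \<open>K\<close>, and with \<open>X = X'\<close> to
  pass between two versions of the stochastic integral.\<close>

lemma regulator_free_cong:
  assumes X: "S2 X" "S2 X'" and I: "diffusion X I" "diffusion X' I'"
    and zero: "\<And>T. 0 \<le> T \<Longrightarrow> sup_moment (\<lambda>t \<omega>. X t \<omega> - X' t \<omega>) T = 0" and t: "0 \<le> t"
  shows "regulator (free X I) t = regulator (free X' I') t"
proof -
  have "(\<integral>\<^sup>+s\<in>{0..t}. ennreal (\<integral>\<omega>. (X s \<omega> - X' s \<omega>)\<^sup>2 \<partial>M) \<partial>lborel) = (\<integral>\<^sup>+s. 0 \<partial>(lborel :: real measure))"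
  proof (rule nn_integral_cong)
    fix s :: real
    show "ennreal (\<integral>\<omega>. (X s \<omega> - X' s \<omega>)\<^sup>2 \<partial>M) * indicator {0..t} s = 0"
    proof (cases "s \<in> {0..t}")
      case True
      then show ?thesis
        using square_moment_le_sup_moment[OF S2_diff[OF X], of s s] zero[of s] by simp
    qed simp
  qed
  then have "sup_moment (\<lambda>t \<omega>. free X I t \<omega> - free X' I' t \<omega>) t = 0"
    using free_contraction[OF X I t order_refl] by simp
  then have "ennreal ((regulator (free X I) t - regulator (free X' I') t)\<^sup>2) \<le> 0"
    using regulator_diff_square_le[OF S2_free[OF X(1) I(1)] S2_free[OF X(2) I(2)] t order_refl] by simp
  then show ?thesis by simp
qed

lemma regulator_eq_SUP:
  assumes U: "S2 U" and t: "0 \<le> t"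
  shows "regulator U t = (SUP s\<in>{0..t}. Inf {x. 0 \<le> x \<and> 0 \<le> (\<integral>\<omega>. h (x + U s \<omega>) \<partial>M)})"
    "regulator U t = (SUP s\<in>{0..t}. G0 h (law M (U s)))"
  unfolding regulator_def
  by (intro SUP_cong refl Inf_mean_nonneg[symmetric] G0_law[symmetric] S2_integrable[OF U]; simp)+

lemma unique_flat_solution:
  "\<exists>X K. flat_solution M F B b \<sigma> h \<xi> X K \<and>
     (\<forall>X' K'. flat_solution M F B b \<sigma> h \<xi> X' K' \<longrightarrow>
        (AE \<omega> in M. \<forall>t\<ge>0. X' t \<omega> = X t \<omega>) \<and> (\<forall>t\<ge>0. K' t = K t)) \<and>
     (\<forall>I. diffusion X I \<longrightarrow>
        (let U = free X I in
           \<forall>t\<ge>0.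
             K t = (SUP s\<in>{0..t}. Inf {x. 0 \<le> x \<and> 0 \<le> (\<integral>\<omega>. h (x + U s \<omega>) \<partial>M)}) \<and>
             K t = (SUP s\<in>{0..t}. G0 h (law M (U s)))))"
proof -
  obtain X I where X: "S2 X" and I: "diffusion X I"
    and eq: "AE \<omega> in M. \<forall>t\<ge>0. X t \<omega> = reflected X I t \<omega>"
    by (rule reflected_exists)
  have ad: "adapted F X" "continuous_process M X" using X by (auto simp: S2_def)
  show ?thesis
  proof (intro exI[of _ X] exI[of _ "regulator (free X I)"] conjI allI impI)
    show "flat_solution M F B b \<sigma> h \<xi> X (regulator (free X I))"
      by (rule reflected_flat_solution[OF X I eq])
  next
    fix X' K' assume fl: "flat_solution M F B b \<sigma> h \<xi> X' K'"
    have X': "S2 X'" by (rule flat_solution_S2[OF fl])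
    obtain I' where I': "diffusion X' I'" and K': "\<And>t. 0 \<le> t \<Longrightarrow> K' t = regulator (free X' I') t"
      and eq': "AE \<omega> in M. \<forall>t\<ge>0. X' t \<omega> = reflected X' I' t \<omega>"
      using flat_solution_reflected[OF fl] by blast
    have zero: "sup_moment (\<lambda>t \<omega>. X' t \<omega> - X t \<omega>) T = 0" if "0 \<le> T" for T
      by (rule reflected_unique[OF X' X I' I eq' eq that])
    have "AE \<omega> in M. \<forall>t\<ge>0. X' t \<omega> - X t \<omega> = 0"
      using X' ad by (intro sup_moment_zero_AE zero adapted_diff continuous_process_diff) (auto simp: S2_def)
    then show "AE \<omega> in M. \<forall>t\<ge>0. X' t \<omega> = X t \<omega>" by simp
    fix t :: real assume t: "0 \<le> t"
    show "K' t = regulator (free X I) t"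
      unfolding K'[OF t] by (rule regulator_free_cong[OF X' X I' I zero t])
  next
    \<comment> \<open>The formula is claimed for every version of the integral, while the regulator
      was built from one of them.\<close>
    fix I' assume I': "diffusion X I'"
    have zero: "sup_moment (\<lambda>t \<omega>. X t \<omega> - X t \<omega>) T = 0" if "0 \<le> T" for T
      using that by (simp add: sup_moment_def supsq_def)
    have "regulator (free X I) t = regulator (free X I') t" if "0 \<le> t" for t
      by (rule regulator_free_cong[OF X X I I' zero that])
    then show "let U = free X I' in \<forall>t\<ge>0.
        regulator (free X I) t = (SUP s\<in>{0..t}. Inf {x. 0 \<le> x \<and> 0 \<le> (\<integral>\<omega>. h (x + U s \<omega>) \<partial>M)}) \<and>
        regulator (free X I) t = (SUP s\<in>{0..t}. G0 h (law M (U s)))"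
      unfolding Let_def using regulator_eq_SUP[OF S2_free[OF X I']] by simp
  qed
qed

end

theorem theorem3p2:
  fixes M :: "'a measure"
    and F :: "real \<Rightarrow> 'a measure"
    and B :: "real \<Rightarrow> 'a \<Rightarrow> real"
    and b \<sigma> :: "real \<Rightarrow> real measure \<Rightarrow> real"
    and h :: "real \<Rightarrow> real"
    and \<xi> :: "'a \<Rightarrow> real"
    and L m m' :: real
  assumes "complete_filtered_prob_space M F"
    and "brownian_motion M F B"
    and "L > 0"
    and "\<And>x y \<mu> \<nu>. \<mu> \<in> prob_moment 2 \<Longrightarrow> \<nu> \<in> prob_moment 2 \<Longrightarrow>
           \<bar>b x \<mu> - b y \<nu>\<bar> + \<bar>\<sigma> x \<mu> - \<sigma> y \<nu>\<bar> \<le> L * (\<bar>x - y\<bar> + wasserstein 2 \<mu> \<nu>)"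
    and "mono h"
    and "0 < m" and "m \<le> m'"
    and "\<And>x y. m * \<bar>x - y\<bar> \<le> \<bar>h x - h y\<bar> \<and> \<bar>h x - h y\<bar> \<le> m' * \<bar>x - y\<bar>"
    and "\<xi> \<in> borel_measurable (F 0)"
    and "integrable M (\<lambda>\<omega>. (\<xi> \<omega>)\<^sup>2)"
    and "0 \<le> (\<integral>\<omega>. h (\<xi> \<omega>) \<partial>M)"
  shows "\<exists>X K. flat_solution M F B b \<sigma> h \<xi> X K \<and>
           (\<forall>X' K'. flat_solution M F B b \<sigma> h \<xi> X' K' \<longrightarrow>
              (AE \<omega> in M. \<forall>t\<ge>0. X' t \<omega> = X t \<omega>) \<and> (\<forall>t\<ge>0. K' t = K t)) \<and>
           (\<forall>I. is_ito_integral M F B (\<lambda>s \<omega>. \<sigma> (X s \<omega>) (law M (X s))) I \<longrightarrow>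
              (let U = unreflected M b \<xi> X I in
                 \<forall>t\<ge>0.
                   K t = (SUP s\<in>{0..t}. Inf {x. 0 \<le> x \<and> 0 \<le> (\<integral>\<omega>. h (x + U s \<omega>) \<partial>M)}) \<and>
                   K t = (SUP s\<in>{0..t}. G0 h (law M (U s)))))"
proof -
  interpret complete_filtered_prob_space M F by fact
  interpret mean_reflection M F h m m' by unfold_locales (use assms in auto)
  \<comment> \<open>Each coefficient's increment is at most the sum of both increments, which is
    what the joint hypothesis bounds.\<close>
  have lip: "lipschitz_coeff L b" "lipschitz_coeff L \<sigma>"
    unfolding lipschitz_coeff_def
    by (intro conjI allI ballI order_trans[OF _ assms(4)] less_imp_le[OF assms(3)]; simp)+
  interpret mckean_vlasov M F B h m m' b \<sigma> \<xi> L
    by unfold_locales (use assms lip in \<open>auto simp: mean_def\<close>)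
  show ?thesis by (rule unique_flat_solution)
qed

end
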